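(* Let $\Bbbk$ be a field, let $I=\langle Q\mid R\rangle$ be a small category presented by a quiver $Q$ and a set $R$ of relations of $\mathbb{P}Q$, and let $X\colon I\to\Bbbk\text{-}\mathbf{Cat}$ be a functor. For each object $i$ of $I$ write $X(i)=\Bbbk Q^{(i)}/\langle R^{(i)}\rangle$, where $Q^{(i)}$ is a quiver, $R^{(i)}\subseteq\Bbbk Q^{(i)}$ and $\langle R^{(i)}\rangle\cap\{e_x\mid x\in Q^{(i)}_0\}=\emptyset$, and let $\Phi^{(i)}\colon\Bbbk Q^{(i)}\to X(i)$ be the canonical morphism. For a path $a\colon i\to j$ in $Q$, write $\overline{a}$ for its class in $I(i,j)$, and for $x\in Q^{(i)}_0$ set $ax:=X(\overline{a})(x)\in Q^{(j)}_0$. Define a quiver $Q'=(Q'_0,Q'_1,t',h')$ by: (i) $Q'_0:=\bigcup_{i\in I}\{{}_ix\mid x\in Q^{(i)}_0\}$ (a disjoint union of labelled copies of the $Q^{(i)}_0$); (ii) $Q'_1:=\bigcup_{i\in I}\bigl(\{{}_i\alpha\mid\alpha\in Q^{(i)}_1\}\cup\{(a,{}_ix)\mid a\colon i\to j\text{ in }Q_1,\ x\in Q^{(i)}_0\}\bigr)$; (iii) for $\alpha\in Q^{(i)}_1$, $t'({}_i\alpha)={}_i(t^{(i)}(\alpha))$ and $h'({}_i\alpha)={}_i(h^{(i)}(\alpha))$; (iv) for $a\colon i\to j$ in $Q_1$ and $x\in Q^{(i)}_0$, $t'(a,{}_ix)={}_ix$ and $h'(a,{}_ix)={}_j(ax)$.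 Define $R':=R'_1\cup R'_2\cup R'_3$, a set of morphisms of $\Bbbk Q'$, by: (i) $R'_1:=\{\sigma^{(i)}(\mu)\mid i\in Q_0,\ \mu\in R^{(i)}\}$, where $\sigma^{(i)}\colon\Bbbk Q^{(i)}\hookrightarrow\Bbbk Q'$ is the inclusion $x\mapsto{}_ix$, $\alpha\mapsto{}_i\alpha$; (ii) $R'_2:=\{\pi(g,{}_ix)-\pi(h,{}_ix)\mid i,j\in Q_0,\ (g,h)\in R(i,j),\ x\in Q^{(i)}_0\}$, where for a path $a=a_n\cdots a_2a_1$ of $Q$ starting at $i$ with $a_1,\dots,a_n\in Q_1$ ($n\ge1$) and $i_k$ the head of $a_k$, $$\pi(a,{}_ix):=(a_n,{}_{i_{n-1}}(a_{n-1}a_{n-2}\cdots a_1x))\cdots(a_2,{}_{i_1}(a_1x))(a_1,{}_ix),$$ and $\pi(e_i,{}_ix):=e_{{}_ix}$; (iii) $R'_3:=\{(a,{}_iy)\,{}_i\alpha-{}_j(a\alpha)\,(a,{}_ix)\mid a\colon i\to j\text{ in }Q_1,\ \alpha\colon x\to y\text{ in }Q^{(i)}_1\}$, where for each such $a,\alpha$ one chooses a morphism $a\alpha\colon ax\to ay$ of $\Bbbk Q^{(j)}$ with $\Phi^{(j)}(a\alpha)=X(\overline{a})(\Phi^{(i)}(\alpha))$, and ${}_j(a\alpha):=\sigma^{(j)}(a\alpha)$. Then the ideal $\langle R'\rangle$ of $\Bbbk Q'$ is independent of the choice of the $a\alpha$, and the Grothendieck construction $\operatorname{Gr}(X)$ is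 presented by the quiver with relations $(Q',R')$; that is, there is an isomorphism of $\Bbbk$-categories $$\operatorname{Gr}(X)\cong\Bbbk Q'/\langle R'\rangle.$$
   Context: **$\Bbbk$-categories.** A $\Bbbk$-category is a category whose morphism sets are $\Bbbk$-modules and whose compositions are $\Bbbk$-bilinear. $\Bbbk\text{-}\mathbf{Cat}$ is the 2-category of all $\Bbbk$-categories, $\Bbbk$-functors ($\Bbbk$-linear functors) and natural transformations. "Functor" $I\to\Bbbk\text{-}\mathbf{Cat}$ means a strict functor to the underlying category of $\Bbbk$-categories and $\Bbbk$-functors. **Quivers and presentations.** A quiver $Q=(Q_0,Q_1,t,h)$ has vertex set $Q_0$, arrow set $Q_1$, and tail and head maps $t,h$; those of $Q^{(i)}$ are written $t^{(i)},h^{(i)}$. Paths are written from right to left: $\alpha_n\cdots\alpha_1$ has first arrow $\alpha_1$. The free category $\mathbb{P}Q$ has object set $Q_0$ and all paths of $Q$ (including the length $0$ paths $e_i$, $i\in Q_0$) as morphisms, with the usual composition of paths. The path $\Bbbk$-category $\Bbbk Q$ is the $\Bbbk$-linearization of $\mathbb{P}Q$. For a set $S$ of morphisms of $\Bbbk Q$, $\langle S\rangle$ is the two-sided ideal of the $\Bbbk$-category $\Bbbk Q$ generated by $S$, and $\Bbbk Q/\langle S\rangle$ is the quotient $\Bbbk$-category, with object set $Q_0$. For a category $\mathcal{C}$, a relation of $\mathcal{C}$ is an element of $\bigcup_{i,j}\mathcal{C}(i,j)\times\mathcal{C}(i,j)$. For a set $R$ of relations, $R(i,j):=R\cap(\mathcal{C}(i,j)\times\mathcal{C}(i,j))$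 and $$R^c:=\bigcup_{i,j}\{(dac,dbc)\mid c\in\mathcal{C}(-,i),\ d\in\mathcal{C}(j,-),\ (a,b)\in R(i,j)\}.$$ $R^\#$ is the equivalence relation generated by $R^c$ (on each morphism set $\mathcal{C}(i,j)$, the smallest equivalence relation containing $R^c(i,j)$). The category $\mathcal{C}/R^\#$ has the same objects as $\mathcal{C}$, morphism sets $\mathcal{C}(i,j)/R^\#(i,j)$, and composition induced from $\mathcal{C}$. For $R$ a set of relations of $\mathbb{P}Q$, $\langle Q\mid R\rangle:=\mathbb{P}Q/R^\#$; in particular its objects are the vertices of $Q$. **Grothendieck construction.** For a functor $X\colon I\to\Bbbk\text{-}\mathbf{Cat}$, the category $\operatorname{Gr}(X)$ has objects the pairs $(i,x)$ with $i$ an object of $I$ and $x$ an object of $X(i)$; morphisms $$\operatorname{Gr}(X)((i,x),(j,y)):=\bigoplus_{a\in I(i,j)}X(j)(X(a)x,y);$$ and composition, for $f=(f_a)_{a\in I(i,j)}\colon(i,x)\to(j,y)$ and $g=(g_b)_{b\in I(j,k)}\colon(j,y)\to(k,z)$, $$g\circ f:=\Bigl(\sum_{c=ba,\ a\in I(i,j),\ b\in I(j,k)}g_b\circ X(b)(f_a)\Bigr)_{c\in I(i,k)}.$$ *)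

theory Defs
  imports
    "HOL-Algebra.Module"
    "HOL-Algebra.AbelCoset"
    "Graph_Theory.Arc_Walk"
begin

section \<open>Categories, quotients by relations\<close>

text \<open>
  Hom-sets are indexed by objects and are not required to be disjoint; identities and
  compositions are indexed accordingly, and \<open>cat_comp C x y z g f\<close> is the composite
  of \<open>f : x \<rightarrow> y\<close> followed by \<open>g : y \<rightarrow> z\<close>.
\<close>

record ('o, 'm) cat =
  cat_obj :: "'o set"
  cat_hom :: "'o \<Rightarrow> 'o \<Rightarrow> 'm set"
  cat_id :: "'o \<Rightarrow> 'm"
  cat_comp :: "'o \<Rightarrow> 'o \<Rightarrow> 'o \<Rightarrow> 'm \<Rightarrow> 'm \<Rightarrow> 'm"

locale category =
  fixes C :: "('o, 'm) cat"
  assumes id_hom: "x \<in> cat_obj C \<Longrightarrow> cat_id C x \<in> cat_hom C x x"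
    and comp_hom: "\<lbrakk>x \<in> cat_obj C; y \<in> cat_obj C; z \<in> cat_obj C;
        f \<in> cat_hom C x y; g \<in> cat_hom C y z\<rbrakk> \<Longrightarrow> cat_comp C x y z g f \<in> cat_hom C x z"
    and comp_id_left: "\<lbrakk>x \<in> cat_obj C; y \<in> cat_obj C; f \<in> cat_hom C x y\<rbrakk>
        \<Longrightarrow> cat_comp C x y y (cat_id C y) f = f"
    and comp_id_right: "\<lbrakk>x \<in> cat_obj C; y \<in> cat_obj C; f \<in> cat_hom C x y\<rbrakk>
        \<Longrightarrow> cat_comp C x x y f (cat_id C x) = f"
    and comp_assoc: "\<lbrakk>w \<in> cat_obj C; x \<in> cat_obj C; y \<in> cat_obj C; z \<in> cat_obj C;
        f \<in> cat_hom C w x; g \<in> cat_hom C x y; h \<in> cat_hom C y z\<rbrakk>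
        \<Longrightarrow> cat_comp C w y z h (cat_comp C w x y g f) = cat_comp C w x z (cat_comp C x y z h g) f"

definition cat_relations :: "('o, 'm) cat \<Rightarrow> ('m \<times> 'm) set" where
  "cat_relations C = (\<Union>x\<in>cat_obj C. \<Union>y\<in>cat_obj C. cat_hom C x y \<times> cat_hom C x y)"

definition relations_at :: "('o, 'm) cat \<Rightarrow> ('m \<times> 'm) set \<Rightarrow> 'o \<Rightarrow> 'o \<Rightarrow> ('m \<times> 'm) set" where
  "relations_at C R x y = R \<inter> (cat_hom C x y \<times> cat_hom C x y)"

text \<open>The component of \<open>R\<^sup>c\<close> at \<open>(w, z)\<close>.\<close>

definition context_closure :: "('o, 'm) cat \<Rightarrow> ('m \<times> 'm) set \<Rightarrow> 'o \<Rightarrow> 'o \<Rightarrow> ('m \<times> 'm) set" where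
  "context_closure C R w z =
    {(cat_comp C w y z d (cat_comp C w x y a c), cat_comp C w y z d (cat_comp C w x y b c)) | x y a b c d.
      x \<in> cat_obj C \<and> y \<in> cat_obj C \<and> c \<in> cat_hom C w x \<and> d \<in> cat_hom C y z \<and>
      (a, b) \<in> relations_at C R x y}"

text \<open>The component of \<open>R\<^sup>#\<close> at \<open>(x, y)\<close>.\<close>

definition generated_equiv :: "('o, 'm) cat \<Rightarrow> ('m \<times> 'm) set \<Rightarrow> 'o \<Rightarrow> 'o \<Rightarrow> ('m \<times> 'm) set" where
  "generated_equiv C R x y =
    \<Inter>{E. equiv (cat_hom C x y) E \<and> context_closure C R x y \<subseteq> E}"

definition quotient_cat :: "('o, 'm) cat \<Rightarrow> ('m \<times> 'm) set \<Rightarrow> ('o, 'm set) cat" where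
  "quotient_cat C R =
    \<lparr>cat_obj = cat_obj C,
     cat_hom = (\<lambda>x y. cat_hom C x y // generated_equiv C R x y),
     cat_id = (\<lambda>x. generated_equiv C R x x `` {cat_id C x}),
     cat_comp = (\<lambda>x y z G F. \<Union>g\<in>G. \<Union>f\<in>F. generated_equiv C R x z `` {cat_comp C x y z g f})\<rparr>"


section \<open>Quivers and path categories\<close>

text \<open>
  A quiver is a \<^const>\<open>wf_digraph\<close> (loops,
  multiple arcs and infinitely many vertices or arcs are allowed).  A path is its source
  together with the list of its arrows in order of traversal, so the path written
  \<open>\<alpha>\<^sub>n \<cdots> \<alpha>\<^sub>1\<close> from right to left is \<open>(u, [\<alpha>\<^sub>1, \<dots>, \<alpha>\<^sub>n])\<close>.
\<close>

type_synonym ('v, 'e) path = "'v \<times> 'e list"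

definition path_category :: "('v, 'e) pre_digraph \<Rightarrow> ('v, ('v, 'e) path) cat" where
  "path_category Q =
    \<lparr>cat_obj = verts Q,
     cat_hom = (\<lambda>u v. {(u, p) | p. pre_digraph.awalk Q u p v}),
     cat_id = (\<lambda>u. (u, [])),
     cat_comp = (\<lambda>u v w q p. (fst p, snd p @ snd q))\<rparr>"

definition presented_category ::
  "('v, 'e) pre_digraph \<Rightarrow> (('v, 'e) path \<times> ('v, 'e) path) set \<Rightarrow> ('v, ('v, 'e) path set) cat" where
  "presented_category Q R = quotient_cat (path_category Q) R"

definition path_class ::
  "('v, 'e) pre_digraph \<Rightarrow> (('v, 'e) path \<times> ('v, 'e) path) set \<Rightarrow> 'v \<Rightarrow> 'v \<Rightarrow> ('v, 'e) path
    \<Rightarrow> ('v, 'e) path set" where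
  "path_class Q R i j p = generated_equiv (path_category Q) R i j `` {p}"

definition arrow_path :: "('v, 'e) pre_digraph \<Rightarrow> 'e \<Rightarrow> ('v, 'e) path" where
  "arrow_path Q a = (tail Q a, [a])"


section \<open>Linear categories and functors\<close>

text \<open>
  The ring fields \<^const>\<open>monoid.mult\<close> and \<^const>\<open>monoid.one\<close> of a
  \<open>module\<close> record play no role and are left undefined below.
\<close>

record ('o, 'm, 'k) kcat =
  kcat_obj :: "'o set"
  kcat_hom :: "'o \<Rightarrow> 'o \<Rightarrow> ('k, 'm) module"
  kcat_id :: "'o \<Rightarrow> 'm"
  kcat_comp :: "'o \<Rightarrow> 'o \<Rightarrow> 'o \<Rightarrow> 'm \<Rightarrow> 'm \<Rightarrow> 'm"

definition underlying_cat :: "('o, 'm, 'k) kcat \<Rightarrow> ('o, 'm) cat" where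
  "underlying_cat C =
    \<lparr>cat_obj = kcat_obj C,
     cat_hom = (\<lambda>x y. carrier (kcat_hom C x y)),
     cat_id = kcat_id C,
     cat_comp = kcat_comp C\<rparr>"

definition kcat_morphisms :: "('o, 'm, 'k) kcat \<Rightarrow> 'm set" where
  "kcat_morphisms C = (\<Union>x\<in>kcat_obj C. \<Union>y\<in>kcat_obj C. carrier (kcat_hom C x y))"

definition linear_map :: "'k ring \<Rightarrow> ('k, 'm) module \<Rightarrow> ('k, 'n) module \<Rightarrow> ('m \<Rightarrow> 'n) \<Rightarrow> bool" where
  "linear_map K M N h \<longleftrightarrow>
    h \<in> carrier M \<rightarrow> carrier N \<and>
    (\<forall>f\<in>carrier M. \<forall>g\<in>carrier M. h (f \<oplus>\<^bsub>M\<^esub> g) = h f \<oplus>\<^bsub>N\<^esub> h g) \<and>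
    (\<forall>c\<in>carrier K. \<forall>f\<in>carrier M. h (c \<odot>\<^bsub>M\<^esub> f) = c \<odot>\<^bsub>N\<^esub> h f)"

locale k_category = category "underlying_cat C"
  for K :: "'k ring" and C :: "('o, 'm, 'k) kcat" +
  assumes hom_module: "\<lbrakk>x \<in> kcat_obj C; y \<in> kcat_obj C\<rbrakk> \<Longrightarrow> Module.module K (kcat_hom C x y)"
    and comp_linear_right: "\<lbrakk>x \<in> kcat_obj C; y \<in> kcat_obj C; z \<in> kcat_obj C;
        g \<in> carrier (kcat_hom C y z)\<rbrakk>
        \<Longrightarrow> linear_map K (kcat_hom C x y) (kcat_hom C x z) (\<lambda>f. kcat_comp C x y z g f)"
    and comp_linear_left: "\<lbrakk>x \<in> kcat_obj C; y \<in> kcat_obj C; z \<in> kcat_obj C;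
        f \<in> carrier (kcat_hom C x y)\<rbrakk>
        \<Longrightarrow> linear_map K (kcat_hom C y z) (kcat_hom C x z) (\<lambda>g. kcat_comp C x y z g f)"

record ('o, 'm, 'p, 'n) functor_data =
  fun_obj :: "'o \<Rightarrow> 'p"
  fun_mor :: "'o \<Rightarrow> 'o \<Rightarrow> 'm \<Rightarrow> 'n"

definition k_functor ::
  "'k ring \<Rightarrow> ('o, 'm, 'k) kcat \<Rightarrow> ('p, 'n, 'k) kcat \<Rightarrow> ('o, 'm, 'p, 'n) functor_data \<Rightarrow> bool" where
  "k_functor K C D F \<longleftrightarrow>
    k_category K C \<and> k_category K D \<and>
    fun_obj F \<in> kcat_obj C \<rightarrow> kcat_obj D \<and>
    (\<forall>x\<in>kcat_obj C. \<forall>y\<in>kcat_obj C.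
      linear_map K (kcat_hom C x y) (kcat_hom D (fun_obj F x) (fun_obj F y)) (fun_mor F x y)) \<and>
    (\<forall>x\<in>kcat_obj C. fun_mor F x x (kcat_id C x) = kcat_id D (fun_obj F x)) \<and>
    (\<forall>x\<in>kcat_obj C. \<forall>y\<in>kcat_obj C. \<forall>z\<in>kcat_obj C.
      \<forall>f\<in>carrier (kcat_hom C x y). \<forall>g\<in>carrier (kcat_hom C y z).
        fun_mor F x z (kcat_comp C x y z g f) =
          kcat_comp D (fun_obj F x) (fun_obj F y) (fun_obj F z) (fun_mor F y z g) (fun_mor F x y f))"

definition id_functor :: "('o, 'm, 'o, 'm) functor_data" where
  "id_functor = \<lparr>fun_obj = (\<lambda>x. x), fun_mor = (\<lambda>x y f. f)\<rparr>"

definition comp_functor ::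
  "('p, 'n, 'q, 'r) functor_data \<Rightarrow> ('o, 'm, 'p, 'n) functor_data \<Rightarrow> ('o, 'm, 'q, 'r) functor_data" where
  "comp_functor G F =
    \<lparr>fun_obj = (\<lambda>x. fun_obj G (fun_obj F x)),
     fun_mor = (\<lambda>x y f. fun_mor G (fun_obj F x) (fun_obj F y) (fun_mor F x y f))\<rparr>"

text \<open>Functors are total functions in HOL; they are compared on their domain only.\<close>

definition functor_eq ::
  "('o, 'm, 'k) kcat \<Rightarrow> ('o, 'm, 'p, 'n) functor_data \<Rightarrow> ('o, 'm, 'p, 'n) functor_data \<Rightarrow> bool" where
  "functor_eq C F G \<longleftrightarrow>
    (\<forall>x\<in>kcat_obj C. fun_obj F x = fun_obj G x) \<and>
    (\<forall>x\<in>kcat_obj C. \<forall>y\<in>kcat_obj C. \<forall>f\<in>carrier (kcat_hom C x y). fun_mor F x y f = fun_mor G x y f)"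

definition k_isomorphic :: "'k ring \<Rightarrow> ('o, 'm, 'k) kcat \<Rightarrow> ('p, 'n, 'k) kcat \<Rightarrow> bool" where
  "k_isomorphic K C D \<longleftrightarrow>
    (\<exists>F G. k_functor K C D F \<and> k_functor K D C G \<and>
      functor_eq C (comp_functor G F) id_functor \<and> functor_eq D (comp_functor F G) id_functor)"


section \<open>Direct sums and linearization\<close>

text \<open>
  Families indexed by \<open>A\<close> are total functions that vanish outside \<open>A\<close>.  (Extensionality with
  \<^const>\<open>undefined\<close> instead of zero would not do: the value \<^const>\<open>undefined\<close> may be a nonzero
  scalar, and a nonzero function could then belong to the free modules on two disjoint sets.)
\<close>

definition extend_by_zero :: "'i set \<Rightarrow> ('i \<Rightarrow> ('k, 'm) module) \<Rightarrow> ('i \<Rightarrow> 'm) \<Rightarrow> 'i \<Rightarrow> 'm" where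
  "extend_by_zero A M f = (\<lambda>a. if a \<in> A then f a else \<zero>\<^bsub>M a\<^esub>)"

definition direct_sum :: "'i set \<Rightarrow> ('i \<Rightarrow> ('k, 'm) module) \<Rightarrow> ('k, 'i \<Rightarrow> 'm) module" where
  "direct_sum A M =
    \<lparr>carrier = {f. (\<forall>a\<in>A. f a \<in> carrier (M a)) \<and> (\<forall>a. a \<notin> A \<longrightarrow> f a = \<zero>\<^bsub>M a\<^esub>) \<and>
                   finite {a \<in> A. f a \<noteq> \<zero>\<^bsub>M a\<^esub>}},
     mult = undefined,
     one = undefined,
     zero = (\<lambda>a. \<zero>\<^bsub>M a\<^esub>),
     add = (\<lambda>f g. extend_by_zero A M (\<lambda>a. f a \<oplus>\<^bsub>M a\<^esub> g a)),
     smult = (\<lambda>c f. extend_by_zero A M (\<lambda>a. c \<odot>\<^bsub>M a\<^esub> f a))\<rparr>"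

definition regular_module :: "'k ring \<Rightarrow> ('k, 'k) module" where
  "regular_module K =
    \<lparr>carrier = carrier K, mult = mult K, one = one K, zero = zero K, add = add K, smult = mult K\<rparr>"

definition free_module :: "'k ring \<Rightarrow> 'a set \<Rightarrow> ('k, 'a \<Rightarrow> 'k) module" where
  "free_module K A = direct_sum A (\<lambda>_. regular_module K)"

definition basis_vector :: "'k ring \<Rightarrow> 'a \<Rightarrow> 'a \<Rightarrow> 'k" where
  "basis_vector K a = (\<lambda>b. if b = a then \<one>\<^bsub>K\<^esub> else \<zero>\<^bsub>K\<^esub>)"

text \<open>
  Composition is the bilinear extension of the composition of \<open>C\<close>.  The sum is restricted to
  pairs with nonzero coefficients, because \<^const>\<open>finsum\<close> is only meaningful over finite sets.
\<close>

definition linearization :: "'k ring \<Rightarrow> ('o, 'm) cat \<Rightarrow> ('o, 'm \<Rightarrow> 'k, 'k) kcat" where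
  "linearization K C =
    \<lparr>kcat_obj = cat_obj C,
     kcat_hom = (\<lambda>x y. free_module K (cat_hom C x y)),
     kcat_id = (\<lambda>x. basis_vector K (cat_id C x)),
     kcat_comp = (\<lambda>x y z g f. extend_by_zero (cat_hom C x z) (\<lambda>_. regular_module K) (\<lambda>c.
       finsum K (\<lambda>(a, b). g b \<otimes>\<^bsub>K\<^esub> f a)
         {(a, b). a \<in> cat_hom C x y \<and> b \<in> cat_hom C y z \<and> cat_comp C x y z b a = c \<and>
                  f a \<noteq> \<zero>\<^bsub>K\<^esub> \<and> g b \<noteq> \<zero>\<^bsub>K\<^esub>}))\<rparr>"

definition path_kcategory ::
  "'k ring \<Rightarrow> ('v, 'e) pre_digraph \<Rightarrow> ('v, ('v, 'e) path \<Rightarrow> 'k, 'k) kcat" where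
  "path_kcategory K Q = linearization K (path_category Q)"

definition path_morphism :: "'k ring \<Rightarrow> ('v, 'e) path \<Rightarrow> ('v, 'e) path \<Rightarrow> 'k" where
  "path_morphism K p = basis_vector K p"


section \<open>Ideals and quotients of linear categories\<close>

definition kcat_ideal :: "'k ring \<Rightarrow> ('o, 'm, 'k) kcat \<Rightarrow> ('o \<Rightarrow> 'o \<Rightarrow> 'm set) \<Rightarrow> bool" where
  "kcat_ideal K C J \<longleftrightarrow>
    (\<forall>x\<in>kcat_obj C. \<forall>y\<in>kcat_obj C. submodule (J x y) K (kcat_hom C x y)) \<and>
    (\<forall>x\<in>kcat_obj C. \<forall>y\<in>kcat_obj C. \<forall>z\<in>kcat_obj C.
      \<forall>f\<in>J x y. \<forall>g\<in>carrier (kcat_hom C y z). kcat_comp C x y z g f \<in> J x z) \<and>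
    (\<forall>x\<in>kcat_obj C. \<forall>y\<in>kcat_obj C. \<forall>z\<in>kcat_obj C.
      \<forall>f\<in>carrier (kcat_hom C x y). \<forall>g\<in>J y z. kcat_comp C x y z g f \<in> J x z)"

text \<open>
  A set of morphisms is a plain set; an element lying in several hom-sets is regarded as an
  element of each of them.  In a path category distinct hom-sets share only the
  zero morphism, so nothing is gained or lost.
\<close>

definition ideal_generated ::
  "'k ring \<Rightarrow> ('o, 'm, 'k) kcat \<Rightarrow> 'm set \<Rightarrow> 'o \<Rightarrow> 'o \<Rightarrow> 'm set" where
  "ideal_generated K C S x y =
    \<Inter>{J x y | J. kcat_ideal K C J \<and>
      (\<forall>u\<in>kcat_obj C. \<forall>v\<in>kcat_obj C. S \<inter> carrier (kcat_hom C u v) \<subseteq> J u v)}"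

definition quotient_module :: "('k, 'm) module \<Rightarrow> 'm set \<Rightarrow> ('k, 'm set) module" where
  "quotient_module M H =
    \<lparr>carrier = a_rcosets\<^bsub>M\<^esub> H,
     mult = undefined,
     one = undefined,
     zero = H,
     add = set_add M,
     smult = (\<lambda>c F. \<Union>f\<in>F. H +>\<^bsub>M\<^esub> (c \<odot>\<^bsub>M\<^esub> f))\<rparr>"

definition quotient_kcat ::
  "('o, 'm, 'k) kcat \<Rightarrow> ('o \<Rightarrow> 'o \<Rightarrow> 'm set) \<Rightarrow> ('o, 'm set, 'k) kcat" where
  "quotient_kcat C J =
    \<lparr>kcat_obj = kcat_obj C,
     kcat_hom = (\<lambda>x y. quotient_module (kcat_hom C x y) (J x y)),
     kcat_id = (\<lambda>x. J x x +>\<^bsub>kcat_hom C x x\<^esub> kcat_id C x),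
     kcat_comp = (\<lambda>x y z G F.
       \<Union>g\<in>G. \<Union>f\<in>F. J x z +>\<^bsub>kcat_hom C x z\<^esub> kcat_comp C x y z g f)\<rparr>"

definition quotient_functor ::
  "('o, 'm, 'k) kcat \<Rightarrow> ('o \<Rightarrow> 'o \<Rightarrow> 'm set) \<Rightarrow> ('o, 'm, 'o, 'm set) functor_data" where
  "quotient_functor C J =
    \<lparr>fun_obj = (\<lambda>x. x), fun_mor = (\<lambda>x y f. J x y +>\<^bsub>kcat_hom C x y\<^esub> f)\<rparr>"

definition quiver_quotient ::
  "'k ring \<Rightarrow> ('v, 'e) pre_digraph \<Rightarrow> (('v, 'e) path \<Rightarrow> 'k) set
    \<Rightarrow> ('v, (('v, 'e) path \<Rightarrow> 'k) set, 'k) kcat" where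
  "quiver_quotient K Q S =
    quotient_kcat (path_kcategory K Q) (ideal_generated K (path_kcategory K Q) S)"

definition canonical_morphism ::
  "'k ring \<Rightarrow> ('v, 'e) pre_digraph \<Rightarrow> (('v, 'e) path \<Rightarrow> 'k) set
    \<Rightarrow> ('v, ('v, 'e) path \<Rightarrow> 'k, 'v, (('v, 'e) path \<Rightarrow> 'k) set) functor_data" where
  "canonical_morphism K Q S =
    quotient_functor (path_kcategory K Q) (ideal_generated K (path_kcategory K Q) S)"

definition presented_by_quiver ::
  "'k ring \<Rightarrow> ('o, 'm, 'k) kcat \<Rightarrow> ('v, 'e) pre_digraph \<Rightarrow> (('v, 'e) path \<Rightarrow> 'k) set \<Rightarrow> bool" where
  "presented_by_quiver K C Q S \<longleftrightarrow>
    wf_digraph Q \<and> S \<subseteq> kcat_morphisms (path_kcategory K Q) \<and>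
    k_isomorphic K C (quiver_quotient K Q S)"


section \<open>Diagrams of linear categories and the Grothendieck construction\<close>

record ('i, 'a, 'o, 'm, 'k) diagram =
  dia_obj :: "'i \<Rightarrow> ('o, 'm, 'k) kcat"
  dia_mor :: "'i \<Rightarrow> 'i \<Rightarrow> 'a \<Rightarrow> ('o, 'm, 'o, 'm) functor_data"

definition functor_to_kCat :: "'k ring \<Rightarrow> ('i, 'a) cat \<Rightarrow> ('i, 'a, 'o, 'm, 'k) diagram \<Rightarrow> bool" where
  "functor_to_kCat K I X \<longleftrightarrow>
    category I \<and>
    (\<forall>i\<in>cat_obj I. k_category K (dia_obj X i)) \<and>
    (\<forall>i\<in>cat_obj I. \<forall>j\<in>cat_obj I. \<forall>a\<in>cat_hom I i j.
      k_functor K (dia_obj X i) (dia_obj X j) (dia_mor X i j a)) \<and>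
    (\<forall>i\<in>cat_obj I. functor_eq (dia_obj X i) (dia_mor X i i (cat_id I i)) id_functor) \<and>
    (\<forall>i\<in>cat_obj I. \<forall>j\<in>cat_obj I. \<forall>k\<in>cat_obj I. \<forall>a\<in>cat_hom I i j. \<forall>b\<in>cat_hom I j k.
      functor_eq (dia_obj X i) (dia_mor X i k (cat_comp I i j k b a))
        (comp_functor (dia_mor X j k b) (dia_mor X i j a)))"

definition gr_component ::
  "('i, 'a, 'o, 'm, 'k) diagram \<Rightarrow> 'i \<times> 'o \<Rightarrow> 'i \<times> 'o \<Rightarrow> 'a \<Rightarrow> ('k, 'm) module" where
  "gr_component X = (\<lambda>(i, x) (j, y) a. kcat_hom (dia_obj X j) (fun_obj (dia_mor X i j a) x) y)"

text \<open>
  As in the linearization, the sum defining a component of a composite is restricted to the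
  (finitely many) pairs at which both factors are nonzero; all other summands vanish.
\<close>

definition grothendieck ::
  "('i, 'a) cat \<Rightarrow> ('i, 'a, 'o, 'm, 'k) diagram \<Rightarrow> ('i \<times> 'o, 'a \<Rightarrow> 'm, 'k) kcat" where
  "grothendieck I X =
    \<lparr>kcat_obj = (SIGMA i:cat_obj I. kcat_obj (dia_obj X i)),
     kcat_hom = (\<lambda>u v. direct_sum (cat_hom I (fst u) (fst v)) (gr_component X u v)),
     kcat_id = (\<lambda>(i, x). \<lambda>a.
       if a = cat_id I i then kcat_id (dia_obj X i) x else \<zero>\<^bsub>gr_component X (i, x) (i, x) a\<^esub>),
     kcat_comp = (\<lambda>(i, x) (j, y) (k, z) g f. extend_by_zero (cat_hom I i k) (gr_component X (i, x) (k, z)) (\<lambda>c.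
       finsum (gr_component X (i, x) (k, z) c)
         (\<lambda>(a, b).
           kcat_comp (dia_obj X k)
             (fun_obj (dia_mor X j k b) (fun_obj (dia_mor X i j a) x)) (fun_obj (dia_mor X j k b) y) z
             (g b)
             (fun_mor (dia_mor X j k b) (fun_obj (dia_mor X i j a) x) y (f a)))
         {(a, b). a \<in> cat_hom I i j \<and> b \<in> cat_hom I j k \<and> cat_comp I i j k b a = c \<and>
                  f a \<noteq> \<zero>\<^bsub>gr_component X (i, x) (j, y) a\<^esub> \<and>
                  g b \<noteq> \<zero>\<^bsub>gr_component X (j, y) (k, z) b\<^esub>}))\<rparr>"


section \<open>The quiver with relations of the Grothendieck construction\<close>

text \<open>
  \<open>Q\<close>, \<open>R\<close> present the index category, \<open>X\<close> is a diagram on it, and \<open>Qs\<close>, \<open>Rs\<close> are the families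
  of quivers and relations presenting the values of \<open>X\<close>.  The vertex \<open>x\<close> of the \<open>i\<close>-th quiver
  becomes \<open>(i, x)\<close>, its arrow \<open>\<alpha>\<close> becomes \<open>Inner i \<alpha>\<close>, and \<open>Cross a i x\<close> is the arrow
  \<open>(a, \<^sub>ix)\<close>.
\<close>

datatype ('q, 'a, 'v, 'e) gr_arrow = Inner 'q 'e | Cross 'a 'q 'v

text \<open>\<open>act Q R X i j p x\<close> is the vertex \<open>px\<close>, for a path \<open>p\<close> from \<open>i\<close> to \<open>j\<close>.\<close>

definition act ::
  "('q, 'a) pre_digraph \<Rightarrow> (('q, 'a) path \<times> ('q, 'a) path) set
    \<Rightarrow> ('q, ('q, 'a) path set, 'v, 'm, 'k) diagram \<Rightarrow> 'q \<Rightarrow> 'q \<Rightarrow> ('q, 'a) path \<Rightarrow> 'v \<Rightarrow> 'v" where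
  "act Q R X i j p x = fun_obj (dia_mor X i j (path_class Q R i j p)) x"

abbreviation arrow_act ::
  "('q, 'a) pre_digraph \<Rightarrow> (('q, 'a) path \<times> ('q, 'a) path) set
    \<Rightarrow> ('q, ('q, 'a) path set, 'v, 'm, 'k) diagram \<Rightarrow> 'a \<Rightarrow> 'v \<Rightarrow> 'v" where
  "arrow_act Q R X a x \<equiv> act Q R X (tail Q a) (head Q a) (arrow_path Q a) x"

definition gr_quiver ::
  "('q, 'a) pre_digraph \<Rightarrow> (('q, 'a) path \<times> ('q, 'a) path) set
    \<Rightarrow> ('q, ('q, 'a) path set, 'v, 'm, 'k) diagram \<Rightarrow> ('q \<Rightarrow> ('v, 'e) pre_digraph)
    \<Rightarrow> ('q \<times> 'v, ('q, 'a, 'v, 'e) gr_arrow) pre_digraph" where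
  "gr_quiver Q R X Qs =
    \<lparr>verts = {(i, x) | i x. i \<in> verts Q \<and> x \<in> verts (Qs i)},
     arcs = {Inner i \<alpha> | i \<alpha>. i \<in> verts Q \<and> \<alpha> \<in> arcs (Qs i)} \<union>
            {Cross a i x | a i x. i \<in> verts Q \<and> a \<in> arcs Q \<and> tail Q a = i \<and> x \<in> verts (Qs i)},
     tail = (\<lambda>e. case e of Inner i \<alpha> \<Rightarrow> (i, tail (Qs i) \<alpha>) | Cross a i x \<Rightarrow> (i, x)),
     head = (\<lambda>e. case e of Inner i \<alpha> \<Rightarrow> (i, head (Qs i) \<alpha>)
                         | Cross a i x \<Rightarrow> (head Q a, arrow_act Q R X a x))\<rparr>"

definition inner_path :: "'q \<Rightarrow> ('v, 'e) path \<Rightarrow> ('q \<times> 'v, ('q, 'a, 'v, 'e) gr_arrow) path" where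
  "inner_path i p = ((i, fst p), map (Inner i) (snd p))"

text \<open>
  The linear extension of \<open>inner_path i\<close> to the morphisms \<open>f : x \<rightarrow> y\<close> of the path category of
  \<open>Qi\<close>, with values in the path category of \<open>Q'\<close>.
\<close>

definition sigma ::
  "'k ring \<Rightarrow> ('v, 'e) pre_digraph \<Rightarrow> ('q \<times> 'v, ('q, 'a, 'v, 'e) gr_arrow) pre_digraph
    \<Rightarrow> 'q \<Rightarrow> 'v \<Rightarrow> 'v \<Rightarrow> (('v, 'e) path \<Rightarrow> 'k)
    \<Rightarrow> ('q \<times> 'v, ('q, 'a, 'v, 'e) gr_arrow) path \<Rightarrow> 'k" where
  "sigma K Qi Q' i x y f =
    finsum (kcat_hom (path_kcategory K Q') (i, x) (i, y))
      (\<lambda>p. f p \<odot>\<^bsub>kcat_hom (path_kcategory K Q') (i, x) (i, y)\<^esub>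
             path_morphism K (inner_path i p))
      {p \<in> cat_hom (path_category Qi) x y. f p \<noteq> \<zero>\<^bsub>K\<^esub>}"

text \<open>
  For \<open>a = a\<^sub>n \<cdots> a\<^sub>1\<close> with arrow list \<open>[a\<^sub>1, \<dots>, a\<^sub>n]\<close>, the entry at (zero-based) position \<open>k\<close> is the
  arrow of \<open>Q'\<close> attached to \<open>a!k\<close> and the vertex obtained by applying the first \<open>k\<close> arrows to \<open>x\<close>.
\<close>

definition cross_path ::
  "('q, 'a) pre_digraph \<Rightarrow> (('q, 'a) path \<times> ('q, 'a) path) set
    \<Rightarrow> ('q, ('q, 'a) path set, 'v, 'm, 'k) diagram \<Rightarrow> ('q, 'a) path \<Rightarrow> 'v
    \<Rightarrow> ('q \<times> 'v, ('q, 'a, 'v, 'e) gr_arrow) path" where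
  "cross_path Q R X = (\<lambda>(i, as) x. ((i, x),
    map (\<lambda>k. let p = take k as; ik = pre_digraph.awlast Q i p
              in Cross (as ! k) ik (act Q R X i ik (i, p) x))
      [0..<length as]))"

definition gr_relations1 ::
  "'k ring \<Rightarrow> ('q, 'a) pre_digraph \<Rightarrow> (('q, 'a) path \<times> ('q, 'a) path) set
    \<Rightarrow> ('q, ('q, 'a) path set, 'v, 'm, 'k) diagram \<Rightarrow> ('q \<Rightarrow> ('v, 'e) pre_digraph)
    \<Rightarrow> ('q \<Rightarrow> (('v, 'e) path \<Rightarrow> 'k) set)
    \<Rightarrow> (('q \<times> 'v, ('q, 'a, 'v, 'e) gr_arrow) path \<Rightarrow> 'k) set" where
  "gr_relations1 K Q R X Qs Rs =
    {sigma K (Qs i) (gr_quiver Q R X Qs) i x y \<mu> | i x y \<mu>.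
      i \<in> verts Q \<and> x \<in> verts (Qs i) \<and> y \<in> verts (Qs i) \<and>
      \<mu> \<in> Rs i \<inter> carrier (kcat_hom (path_kcategory K (Qs i)) x y)}"

definition gr_relations2 ::
  "'k ring \<Rightarrow> ('q, 'a) pre_digraph \<Rightarrow> (('q, 'a) path \<times> ('q, 'a) path) set
    \<Rightarrow> ('q, ('q, 'a) path set, 'v, 'm, 'k) diagram \<Rightarrow> ('q \<Rightarrow> ('v, 'e) pre_digraph)
    \<Rightarrow> (('q \<times> 'v, ('q, 'a, 'v, 'e) gr_arrow) path \<Rightarrow> 'k) set" where
  "gr_relations2 K Q R X Qs =
    (let Q' = gr_quiver Q R X Qs in
     {path_morphism K (cross_path Q R X g x)
        \<ominus>\<^bsub>kcat_hom (path_kcategory K Q') (i, x) (j, act Q R X i j g x)\<^esub>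
      path_morphism K (cross_path Q R X h x) | i j g h x.
      i \<in> verts Q \<and> j \<in> verts Q \<and> (g, h) \<in> relations_at (path_category Q) R i j \<and>
      x \<in> verts (Qs i)})"

text \<open>
  \<open>lift a \<alpha>\<close> is the chosen morphism \<open>a\<alpha>\<close> lifting the value of \<open>X\<close> at the class of \<open>a\<close> on the
  class of \<open>\<alpha>\<close>.
\<close>

definition admissible_choice ::
  "'k ring \<Rightarrow> ('q, 'a) pre_digraph \<Rightarrow> (('q, 'a) path \<times> ('q, 'a) path) set
    \<Rightarrow> ('q, ('q, 'a) path set, 'v, (('v, 'e) path \<Rightarrow> 'k) set, 'k) diagram
    \<Rightarrow> ('q \<Rightarrow> ('v, 'e) pre_digraph) \<Rightarrow> ('q \<Rightarrow> (('v, 'e) path \<Rightarrow> 'k) set)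
    \<Rightarrow> ('a \<Rightarrow> 'e \<Rightarrow> ('v, 'e) path \<Rightarrow> 'k) \<Rightarrow> bool" where
  "admissible_choice K Q R X Qs Rs lift \<longleftrightarrow>
    (\<forall>a\<in>arcs Q. \<forall>\<alpha>\<in>arcs (Qs (tail Q a)).
      let i = tail Q a; j = head Q a; x = tail (Qs i) \<alpha>; y = head (Qs i) \<alpha>;
          ax = arrow_act Q R X a x; ay = arrow_act Q R X a y
      in lift a \<alpha> \<in> carrier (kcat_hom (path_kcategory K (Qs j)) ax ay) \<and>
         fun_mor (canonical_morphism K (Qs j) (Rs j)) ax ay (lift a \<alpha>) =
           fun_mor (dia_mor X i j (path_class Q R i j (arrow_path Q a))) x y
             (fun_mor (canonical_morphism K (Qs i) (Rs i)) x y
               (path_morphism K (arrow_path (Qs i) \<alpha>))))"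

definition gr_relation3 ::
  "'k ring \<Rightarrow> ('q, 'a) pre_digraph \<Rightarrow> (('q, 'a) path \<times> ('q, 'a) path) set
    \<Rightarrow> ('q, ('q, 'a) path set, 'v, 'm, 'k) diagram \<Rightarrow> ('q \<Rightarrow> ('v, 'e) pre_digraph)
    \<Rightarrow> ('a \<Rightarrow> 'e \<Rightarrow> ('v, 'e) path \<Rightarrow> 'k) \<Rightarrow> 'a \<Rightarrow> 'e
    \<Rightarrow> ('q \<times> 'v, ('q, 'a, 'v, 'e) gr_arrow) path \<Rightarrow> 'k" where
  "gr_relation3 K Q R X Qs lift a \<alpha> =
    (let Q' = gr_quiver Q R X Qs; P = path_kcategory K Q';
         i = tail Q a; j = head Q a; x = tail (Qs i) \<alpha>; y = head (Qs i) \<alpha>;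
         ax = arrow_act Q R X a x; ay = arrow_act Q R X a y
     in kcat_comp P (i, x) (i, y) (j, ay)
          (path_morphism K (arrow_path Q' (Cross a i y)))
          (path_morphism K (arrow_path Q' (Inner i \<alpha>)))
        \<ominus>\<^bsub>kcat_hom P (i, x) (j, ay)\<^esub>
        kcat_comp P (i, x) (j, ax) (j, ay)
          (sigma K (Qs j) Q' j ax ay (lift a \<alpha>))
          (path_morphism K (arrow_path Q' (Cross a i x))))"

definition gr_relations3 ::
  "'k ring \<Rightarrow> ('q, 'a) pre_digraph \<Rightarrow> (('q, 'a) path \<times> ('q, 'a) path) set
    \<Rightarrow> ('q, ('q, 'a) path set, 'v, 'm, 'k) diagram \<Rightarrow> ('q \<Rightarrow> ('v, 'e) pre_digraph)
    \<Rightarrow> ('a \<Rightarrow> 'e \<Rightarrow> ('v, 'e) path \<Rightarrow> 'k)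
    \<Rightarrow> (('q \<times> 'v, ('q, 'a, 'v, 'e) gr_arrow) path \<Rightarrow> 'k) set" where
  "gr_relations3 K Q R X Qs lift =
    {gr_relation3 K Q R X Qs lift a \<alpha> | a \<alpha>. a \<in> arcs Q \<and> \<alpha> \<in> arcs (Qs (tail Q a))}"

definition gr_relations ::
  "'k ring \<Rightarrow> ('q, 'a) pre_digraph \<Rightarrow> (('q, 'a) path \<times> ('q, 'a) path) set
    \<Rightarrow> ('q, ('q, 'a) path set, 'v, 'm, 'k) diagram \<Rightarrow> ('q \<Rightarrow> ('v, 'e) pre_digraph)
    \<Rightarrow> ('q \<Rightarrow> (('v, 'e) path \<Rightarrow> 'k) set) \<Rightarrow> ('a \<Rightarrow> 'e \<Rightarrow> ('v, 'e) path \<Rightarrow> 'k)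
    \<Rightarrow> (('q \<times> 'v, ('q, 'a, 'v, 'e) gr_arrow) path \<Rightarrow> 'k) set" where
  "gr_relations K Q R X Qs Rs lift =
    gr_relations1 K Q R X Qs Rs \<union> gr_relations2 K Q R X Qs \<union> gr_relations3 K Q R X Qs lift"

end

theory Submission
  imports Defs
begin

text \<open>Write \<open>E\<close> for the quotient of the path category of \<open>Q'\<close> by the ideal of the relations \<open>R'\<close>.
The Grothendieck construction \<open>Gr\<close> and \<open>E\<close> both have a universal property describing the functors
out of them; each category carries the data that the universal property of the other one asks for, and the
two functors obtained in this way are mutually inverse.

A linear functor out of \<open>Gr\<close> amounts to functors \<open>S i\<close> on the fibres \<open>X i\<close> together with
morphisms \<open>\<xi> a x : S i x \<rightarrow> S j (a x)\<close>, natural in \<open>x\<close>, that are identities for identities \<open>a\<close> and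
multiplicative in \<open>a\<close>.  This is the locale \<open>lax_cocone\<close>.  The reason is that a morphism \<open>m\<close> of
degree \<open>a\<close> is the composite of an identity placed in degree \<open>a\<close> and of \<open>m\<close> placed in the degree of
an identity, and that the composition law of \<open>Gr\<close> encodes precisely the naturality of the former.

The three families of relations say that \<open>E\<close> carries such data.  By the first family the
inclusions \<open>\<sigma> i\<close> of the path categories descend to functors on the fibres.  The class in \<open>E\<close> of the path
\<open>\<pi>(p, x)\<close> is a candidate for \<open>\<xi>\<close>; by the second family it depends on the class of \<open>p\<close> in the index
category only (\<open>crossing_cls\<close>), and by the third family it is natural on arrows, hence on all morphisms
(\<open>crossing_natural\<close>).  So there is a functor \<open>\<Theta> : Gr \<rightarrow> E\<close>.

In the other direction, \<open>\<Psi>\<close> sends an inner arrow to its class placed in the degree of an identity and a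
crossing arrow \<open>(a, x)\<close> to the identity of \<open>a x\<close> in the degree of \<open>a\<close>.  It kills \<open>R'\<close>
(\<open>relation_killed\<close>) and therefore factors through \<open>E\<close>.  The composite \<open>\<Theta> \<circ> \<Psi>\<close> agrees
with the canonical functor on arrows, hence everywhere (\<open>\<Theta>_\<Psi>\<close>), and the other composite is the identity on
morphisms concentrated in one degree, hence everywhere (\<open>\<Psi>_\<Theta>\<close>).

The independence of the chosen lifts is a by-product.  The functor \<open>\<Psi>\<close> involves no choice, and
it kills the third relation formed with any admissible lift.  Since \<open>\<Theta> \<circ> \<Psi>\<close> is the canonical functor,
whatever \<open>\<Psi>\<close> kills lies in the ideal, for whichever choice the ideal was formed
(\<open>cross_relation_in_ideal\<close>).\<close>

section \<open>Linear maps, direct sums and quotient modules\<close>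

lemma linear_map_closed: "linear_map K M N h \<Longrightarrow> f \<in> carrier M \<Longrightarrow> h f \<in> carrier N"
  by (auto simp: linear_map_def)

lemma linear_map_add:
  "linear_map K M N h \<Longrightarrow> f \<in> carrier M \<Longrightarrow> g \<in> carrier M \<Longrightarrow> h (f \<oplus>\<^bsub>M\<^esub> g) = h f \<oplus>\<^bsub>N\<^esub> h g"
  by (auto simp: linear_map_def)

lemma linear_map_smult:
  "linear_map K M N h \<Longrightarrow> c \<in> carrier K \<Longrightarrow> f \<in> carrier M \<Longrightarrow> h (c \<odot>\<^bsub>M\<^esub> f) = c \<odot>\<^bsub>N\<^esub> h f"
  by (auto simp: linear_map_def)

lemma linear_mapI:
  assumes "\<And>f. f \<in> carrier M \<Longrightarrow> h f \<in> carrier N"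
    and "\<And>f g. f \<in> carrier M \<Longrightarrow> g \<in> carrier M \<Longrightarrow> h (f \<oplus>\<^bsub>M\<^esub> g) = h f \<oplus>\<^bsub>N\<^esub> h g"
    and "\<And>c f. c \<in> carrier K \<Longrightarrow> f \<in> carrier M \<Longrightarrow> h (c \<odot>\<^bsub>M\<^esub> f) = c \<odot>\<^bsub>N\<^esub> h f"
  shows "linear_map K M N h"
  using assms by (auto simp: linear_map_def)

lemma linear_map_comp:
  "linear_map K M N g \<Longrightarrow> linear_map K N P h \<Longrightarrow> linear_map K M P (\<lambda>x. h (g x))"
  by (rule linear_mapI) (simp_all add: linear_map_closed linear_map_add linear_map_smult)

lemma linear_map_cong:
  assumes "Module.module K M" "\<And>f. f \<in> carrier M \<Longrightarrow> h f = h' f"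
  shows "linear_map K M N h = linear_map K M N h'"
proof -
  interpret Module.module K M by fact
  show ?thesis using assms(2) by (auto simp: linear_map_def Pi_iff)
qed

lemma linear_map_zero:
  assumes "Module.module K M" "Module.module K N" "linear_map K M N h"
  shows "h \<zero>\<^bsub>M\<^esub> = \<zero>\<^bsub>N\<^esub>"
proof -
  interpret M: Module.module K M by fact
  interpret N: Module.module K N by fact
  have "h (\<zero>\<^bsub>K\<^esub> \<odot>\<^bsub>M\<^esub> \<zero>\<^bsub>M\<^esub>) = \<zero>\<^bsub>K\<^esub> \<odot>\<^bsub>N\<^esub> h \<zero>\<^bsub>M\<^esub>"
    using assms(3) by (intro linear_map_smult) auto
  then show ?thesis
    using linear_map_closed[OF assms(3)] by simp
qed

lemma linear_map_diff:
  assumes "Module.module K M" "Module.module K N" "linear_map K M N h" "f \<in> carrier M" "g \<in> carrier M"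
  shows "h (f \<ominus>\<^bsub>M\<^esub> g) = h f \<ominus>\<^bsub>N\<^esub> h g"
proof -
  interpret M: Module.module K M by fact
  interpret N: Module.module K N by fact
  note hc = linear_map_closed[OF assms(3)]
  have "h (\<ominus>\<^bsub>M\<^esub> g) \<oplus>\<^bsub>N\<^esub> h g = h (\<ominus>\<^bsub>M\<^esub> g \<oplus>\<^bsub>M\<^esub> g)"
    using assms by (subst linear_map_add[OF assms(3)]) auto
  also have "\<dots> = \<zero>\<^bsub>N\<^esub>"
    using assms by (simp add: M.l_neg linear_map_zero)
  finally have "h (\<ominus>\<^bsub>M\<^esub> g) = \<ominus>\<^bsub>N\<^esub> h g"
    using assms hc by (intro N.minus_equality[symmetric]) (auto simp: N.a_comm)
  then show ?thesis
    using assms hc by (simp add: a_minus_def linear_map_add[OF assms(3)])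
qed

lemma (in Module.module) diff_eq_zero_iff:
  "x \<in> carrier M \<Longrightarrow> y \<in> carrier M \<Longrightarrow> x \<ominus>\<^bsub>M\<^esub> y = \<zero>\<^bsub>M\<^esub> \<longleftrightarrow> x = y"
  by (metis M.r_neg M.minus_equality M.a_comm a_minus_def M.add.inv_closed M.minus_minus)

lemma zero_add_zero:
  assumes "Module.module K M"
  shows "\<zero>\<^bsub>M\<^esub> \<oplus>\<^bsub>M\<^esub> \<zero>\<^bsub>M\<^esub> = \<zero>\<^bsub>M\<^esub>"
proof -
  interpret Module.module K M by fact
  show ?thesis by simp
qed

lemma direct_sum_simps:
  "f \<in> carrier (direct_sum A M) \<longleftrightarrow> (\<forall>a\<in>A. f a \<in> carrier (M a)) \<and>
     (\<forall>a. a \<notin> A \<longrightarrow> f a = \<zero>\<^bsub>M a\<^esub>) \<and> finite {a \<in> A. f a \<noteq> \<zero>\<^bsub>M a\<^esub>}"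
  "\<zero>\<^bsub>direct_sum A M\<^esub> = (\<lambda>a. \<zero>\<^bsub>M a\<^esub>)"
  "f \<oplus>\<^bsub>direct_sum A M\<^esub> g = (\<lambda>a. if a \<in> A then f a \<oplus>\<^bsub>M a\<^esub> g a else \<zero>\<^bsub>M a\<^esub>)"
  "c \<odot>\<^bsub>direct_sum A M\<^esub> f = (\<lambda>a. if a \<in> A then c \<odot>\<^bsub>M a\<^esub> f a else \<zero>\<^bsub>M a\<^esub>)"
  by (auto simp: direct_sum_def extend_by_zero_def fun_eq_iff)

lemma regular_module_simps [simp]:
  "carrier (regular_module K) = carrier K" "\<zero>\<^bsub>regular_module K\<^esub> = \<zero>\<^bsub>K\<^esub>"
  "x \<oplus>\<^bsub>regular_module K\<^esub> y = x \<oplus>\<^bsub>K\<^esub> y" "x \<odot>\<^bsub>regular_module K\<^esub> y = x \<otimes>\<^bsub>K\<^esub> y"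
  by (simp_all add: regular_module_def)

lemma finsum_regular_module: "finsum (regular_module K) f A = finsum K f A"
  by (simp add: finsum_def finprod_def regular_module_def)

lemma module_regular_module:
  assumes "cring K"
  shows "Module.module K (regular_module K)"
proof -
  interpret cring K by fact
  show ?thesis
    by (intro moduleI abelian_groupI)
      (auto intro: assms a_assoc a_comm l_distr r_distr m_assoc l_neg)
qed

lemma finite_support_mono:
  assumes "finite {a \<in> A. f a \<noteq> z a}" "finite {a \<in> A. g a \<noteq> z a}"
    "\<And>a. a \<in> A \<Longrightarrow> f a = z a \<Longrightarrow> g a = z a \<Longrightarrow> h a = z a"
  shows "finite {a \<in> A. h a \<noteq> z a}"
  by (rule finite_subset[of _ "{a \<in> A. f a \<noteq> z a} \<union> {a \<in> A. g a \<noteq> z a}"]) (use assms in auto)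

lemma module_direct_sum:
  assumes K: "cring K" and M: "\<And>a. a \<in> A \<Longrightarrow> Module.module K (M a)"
  shows "Module.module K (direct_sum A M)"
proof -
  have ag: "abelian_group (M a)" if "a \<in> A" for a
    using M[OF that] by (simp add: Module.module_def)
  have minus_zero: "\<ominus>\<^bsub>M a\<^esub> \<zero>\<^bsub>M a\<^esub> = \<zero>\<^bsub>M a\<^esub>" if "a \<in> A" for a
    using monoid.inv_one[OF group.is_monoid[OF abelian_group.a_group[OF ag[OF that]]]] by (simp add: a_inv_def)
  note ab = abelian_groupE[OF ag]
  note r0 = abelian_monoid.r_zero[OF abelian_group.axioms(1)[OF ag]]
  note l0 = abelian_monoid.l_zero[OF abelian_group.axioms(1)[OF ag]]
  have fin1: "finite {a \<in> A. (if a \<in> A then f a \<oplus>\<^bsub>M a\<^esub> g a else \<zero>\<^bsub>M a\<^esub>) \<noteq> \<zero>\<^bsub>M a\<^esub>}"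
    if "f \<in> carrier (direct_sum A M)" "g \<in> carrier (direct_sum A M)" for f g
    by (rule finite_support_mono[of _ f _ g]) (use that r0 ab in \<open>auto simp: direct_sum_simps\<close>)
  have fin2: "finite {a \<in> A. (if a \<in> A then c \<odot>\<^bsub>M a\<^esub> f a else \<zero>\<^bsub>M a\<^esub>) \<noteq> \<zero>\<^bsub>M a\<^esub>}"
    if "f \<in> carrier (direct_sum A M)" "c \<in> carrier K" for f c
    by (rule finite_support_mono[of _ f _ f])
      (use that Module.module.smult_r_null[OF M] in \<open>auto simp: direct_sum_simps\<close>)
  show ?thesis
  proof (intro moduleI abelian_groupI)
    fix f assume f: "f \<in> carrier (direct_sum A M)"
    define g where "g = (\<lambda>a. if a \<in> A then \<ominus>\<^bsub>M a\<^esub> f a else \<zero>\<^bsub>M a\<^esub>)"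
    have "finite {a \<in> A. g a \<noteq> \<zero>\<^bsub>M a\<^esub>}"
      by (rule finite_support_mono[of _ f _ f])
        (use f minus_zero in \<open>auto simp: direct_sum_simps g_def\<close>)
    then have "g \<in> carrier (direct_sum A M)"
      using f abelian_group.a_inv_closed[OF ag] by (auto simp: direct_sum_simps g_def)
    moreover have "g \<oplus>\<^bsub>direct_sum A M\<^esub> f = \<zero>\<^bsub>direct_sum A M\<^esub>"
      using f abelian_group.l_neg[OF ag] by (auto simp: direct_sum_simps g_def fun_eq_iff)
    ultimately show "\<exists>y\<in>carrier (direct_sum A M). y \<oplus>\<^bsub>direct_sum A M\<^esub> f = \<zero>\<^bsub>direct_sum A M\<^esub>"
      by blast
  next
    fix f g assume *: "f \<in> carrier (direct_sum A M)" "g \<in> carrier (direct_sum A M)"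
    show "f \<oplus>\<^bsub>direct_sum A M\<^esub> g \<in> carrier (direct_sum A M)"
      using * fin1[OF *] ab by (auto simp: direct_sum_simps)
    show "f \<oplus>\<^bsub>direct_sum A M\<^esub> g = g \<oplus>\<^bsub>direct_sum A M\<^esub> f"
      using * ab by (auto simp: direct_sum_simps)
  next
    fix c f assume *: "c \<in> carrier K" "f \<in> carrier (direct_sum A M)"
    show "c \<odot>\<^bsub>direct_sum A M\<^esub> f \<in> carrier (direct_sum A M)"
      using * fin2[OF *(2,1)] Module.module.smult_closed[OF M] by (auto simp: direct_sum_simps)
  qed (use ab l0 Module.module.smult_l_distr[OF M] Module.module.smult_r_distr[OF M] Module.module.smult_assoc1[OF M]
        Module.module.smult_one[OF M] K in \<open>auto simp: direct_sum_simps fun_eq_iff\<close>)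
qed

definition single :: "('i \<Rightarrow> ('k, 'm) module) \<Rightarrow> 'i \<Rightarrow> 'm \<Rightarrow> 'i \<Rightarrow> 'm" where
  "single M a m = (\<lambda>b. if b = a then m else \<zero>\<^bsub>M b\<^esub>)"

lemma single_apply: "single M a m b = (if b = a then m else \<zero>\<^bsub>M b\<^esub>)"
  by (simp add: single_def)

lemma single_closed:
  assumes "a \<in> A" "m \<in> carrier (M a)" "\<And>a. a \<in> A \<Longrightarrow> Module.module K (M a)"
  shows "single M a m \<in> carrier (direct_sum A M)"
proof -
  have "finite {b \<in> A. single M a m b \<noteq> \<zero>\<^bsub>M b\<^esub>}"
    by (rule finite_subset[of _ "{a}"]) (auto simp: single_def)
  moreover have "\<zero>\<^bsub>M b\<^esub> \<in> carrier (M b)" if "b \<in> A" for b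
    using abelian_groupE(2) assms(3)[OF that] by (auto simp: Module.module_def)
  ultimately show ?thesis using assms by (auto simp: direct_sum_simps single_def)
qed

lemma single_linear:
  assumes "a \<in> A" "\<And>a. a \<in> A \<Longrightarrow> Module.module K (M a)"
  shows "linear_map K (M a) (direct_sum A M) (single M a)"
proof (rule linear_mapI)
  show "single M a (f \<oplus>\<^bsub>M a\<^esub> g) = single M a f \<oplus>\<^bsub>direct_sum A M\<^esub> single M a g" for f g
    using assms zero_add_zero[OF assms(2)] by (auto simp: direct_sum_simps single_def)
  show "single M a (c \<odot>\<^bsub>M a\<^esub> f) = c \<odot>\<^bsub>direct_sum A M\<^esub> single M a f"
    if "c \<in> carrier K" for c f
    using assms that Module.module.smult_r_null[OF assms(2)] by (auto simp: direct_sum_simps single_def)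
  show "single M a f \<in> carrier (direct_sum A M)" if "f \<in> carrier (M a)" for f
    using assms(1) that assms(2) by (rule single_closed)
qed

lemma direct_sum_induct [consumes 1, case_names module zero single add]:
  assumes f: "f \<in> carrier (direct_sum A M)" and M: "\<And>a. a \<in> A \<Longrightarrow> Module.module K (M a)"
    and zero: "P \<zero>\<^bsub>direct_sum A M\<^esub>"
    and single: "\<And>a m. a \<in> A \<Longrightarrow> m \<in> carrier (M a) \<Longrightarrow> P (single M a m)"
    and add: "\<And>f g. f \<in> carrier (direct_sum A M) \<Longrightarrow> g \<in> carrier (direct_sum A M) \<Longrightarrow>
      P f \<Longrightarrow> P g \<Longrightarrow> P (f \<oplus>\<^bsub>direct_sum A M\<^esub> g)"
  shows "P f"
proof -
  have "finite B \<Longrightarrow> f \<in> carrier (direct_sum A M) \<Longrightarrow> {a \<in> A. f a \<noteq> \<zero>\<^bsub>M a\<^esub>} \<subseteq> B \<Longrightarrow> P f" for B f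
  proof (induction B arbitrary: f rule: finite_induct)
    case empty
    then have "f = \<zero>\<^bsub>direct_sum A M\<^esub>" by (auto simp: direct_sum_simps fun_eq_iff)
    then show ?case using zero by simp
  next
    case (insert b B)
    show ?case
    proof (cases "b \<in> A")
      case False
      then show ?thesis using insert.prems insert.IH[of f] by blast
    next
      case True
      define g where "g = (\<lambda>a. if a = b then \<zero>\<^bsub>M a\<^esub> else f a)"
      have ag: "abelian_group (M a)" if "a \<in> A" for a
        using M[OF that] by (simp add: Module.module_def)
      have fb: "f b \<in> carrier (M b)" using insert.prems True by (auto simp: direct_sum_simps)
      have fin: "finite {a \<in> A. g a \<noteq> \<zero>\<^bsub>M a\<^esub>}"
        by (rule finite_support_mono[of _ f _ f])
          (use insert.prems in \<open>auto simp: direct_sum_simps g_def\<close>)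
      have g: "g \<in> carrier (direct_sum A M)"
        using fin insert.prems abelian_groupE(2)[OF ag] by (auto simp: direct_sum_simps g_def)
      have "P g"
        by (rule insert.IH[OF g]) (use insert.prems in \<open>auto simp: g_def\<close>)
      moreover have "single M b (f b) \<in> carrier (direct_sum A M)"
        using True fb M by (rule single_closed)
      ultimately have "P (single M b (f b) \<oplus>\<^bsub>direct_sum A M\<^esub> g)"
        using single[OF True fb] g add by blast
      moreover have "single M b (f b) \<oplus>\<^bsub>direct_sum A M\<^esub> g = f"
        using insert.prems abelian_groupE(5)[OF ag]
          abelian_monoid.r_zero[OF abelian_group.axioms(1)[OF ag]]
        by (auto simp: direct_sum_simps g_def single_def fun_eq_iff)
      ultimately show ?thesis by simp
    qed
  qed
  then show ?thesis using f by (auto simp: direct_sum_simps)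
qed

text \<open>This is how identities between composites of morphisms are proved below: they are multilinear, so it
  suffices to compare them on elements concentrated in one degree.\<close>

lemma linear_map_direct_sum_ext:
  assumes M: "\<And>a. a \<in> A \<Longrightarrow> Module.module K (M a)" and K: "cring K" and N: "Module.module K N"
    and h: "linear_map K (direct_sum A M) N h" and h': "linear_map K (direct_sum A M) N h'"
    and eq: "\<And>a m. a \<in> A \<Longrightarrow> m \<in> carrier (M a) \<Longrightarrow> h (single M a m) = h' (single M a m)"
    and f: "f \<in> carrier (direct_sum A M)"
  shows "h f = h' f"
  using f
proof (induction rule: direct_sum_induct[where K = K])
  case (module a)
  then show ?case by (rule M)
next
  case zero
  show ?case
    using linear_map_zero[OF module_direct_sum[of K A M] N h] linear_map_zero[OF module_direct_sum[of K A M] N h']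
      K M by simp
next
  case (single a m)
  then show ?case by (rule eq)
next
  case (add f g)
  then show ?case by (simp add: linear_map_add[OF h] linear_map_add[OF h'])
qed

definition direct_sum_lift ::
  "('k, 'n) module \<Rightarrow> 'i set \<Rightarrow> ('i \<Rightarrow> ('k, 'm) module) \<Rightarrow> ('i \<Rightarrow> 'm \<Rightarrow> 'n) \<Rightarrow> ('i \<Rightarrow> 'm) \<Rightarrow> 'n"
  where "direct_sum_lift N A M h f = finsum N (\<lambda>a. h a (f a)) {a \<in> A. f a \<noteq> \<zero>\<^bsub>M a\<^esub>}"

context
  fixes K :: "'k ring" and M :: "'i \<Rightarrow> ('k, 'm) module" and A :: "'i set"
    and N :: "('k, 'n) module" and h :: "'i \<Rightarrow> 'm \<Rightarrow> 'n"
  assumes M: "\<And>a. a \<in> A \<Longrightarrow> Module.module K (M a)" and N: "Module.module K N"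
    and h: "\<And>a. a \<in> A \<Longrightarrow> linear_map K (M a) N (h a)"
begin

interpretation N: Module.module K N by (rule N)

lemma direct_sum_lift_eval:
  assumes "f \<in> carrier (direct_sum A M)" "finite B" "{a \<in> A. f a \<noteq> \<zero>\<^bsub>M a\<^esub>} \<subseteq> B" "B \<subseteq> A"
  shows "direct_sum_lift N A M h f = finsum N (\<lambda>a. h a (f a)) B"
  unfolding direct_sum_lift_def
  by (rule N.add.finprod_mono_neutral_cong_left)
    (use assms linear_map_closed[OF h] linear_map_zero[OF M N h] in \<open>auto simp: direct_sum_simps Pi_iff\<close>)

lemma direct_sum_lift_linear: "linear_map K (direct_sum A M) N (direct_sum_lift N A M h)"
proof (rule linear_mapI)
  interpret S: Module.module K "direct_sum A M" by (rule module_direct_sum[OF N.is_cring M])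
  fix f assume f: "f \<in> carrier (direct_sum A M)"
  then show "direct_sum_lift N A M h f \<in> carrier N"
    unfolding direct_sum_lift_def
    by (intro N.finsum_closed) (auto simp: direct_sum_simps linear_map_closed[OF h])
  {
    fix g assume g: "g \<in> carrier (direct_sum A M)"
    define B where "B = {a \<in> A. f a \<noteq> \<zero>\<^bsub>M a\<^esub>} \<union> {a \<in> A. g a \<noteq> \<zero>\<^bsub>M a\<^esub>}"
    have B: "finite B" "B \<subseteq> A" using f g by (auto simp: B_def direct_sum_simps)
    have "h a ((f \<oplus>\<^bsub>direct_sum A M\<^esub> g) a) = h a (f a) \<oplus>\<^bsub>N\<^esub> h a (g a)" if "a \<in> B" for a
      using that B f g linear_map_add[OF h] by (auto simp: direct_sum_simps)
    moreover have "h a (f a) \<in> carrier N" "h a (g a) \<in> carrier N" if "a \<in> B" for a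
      using that B f g linear_map_closed[OF h] by (auto simp: direct_sum_simps)
    ultimately have "finsum N (\<lambda>a. h a ((f \<oplus>\<^bsub>direct_sum A M\<^esub> g) a)) B =
        finsum N (\<lambda>a. h a (f a)) B \<oplus>\<^bsub>N\<^esub> finsum N (\<lambda>a. h a (g a)) B"
      using N.finsum_addf[of "\<lambda>a. h a (f a)" B "\<lambda>a. h a (g a)"]
      by (subst N.finsum_cong'[OF refl, where g = "\<lambda>a. h a (f a) \<oplus>\<^bsub>N\<^esub> h a (g a)"]) auto
    moreover have "(f \<oplus>\<^bsub>direct_sum A M\<^esub> g) a = \<zero>\<^bsub>M a\<^esub>" if "a \<in> A" "a \<notin> B" for a
      using that zero_add_zero[OF M] by (auto simp: direct_sum_simps B_def)
    ultimately show "direct_sum_lift N A M h (f \<oplus>\<^bsub>direct_sum A M\<^esub> g) =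
        direct_sum_lift N A M h f \<oplus>\<^bsub>N\<^esub> direct_sum_lift N A M h g"
      using f g B by (subst (1 2 3) direct_sum_lift_eval[of _ B]) (auto simp: B_def)
  }
  fix c assume c: "c \<in> carrier K"
  define B where "B = {a \<in> A. f a \<noteq> \<zero>\<^bsub>M a\<^esub>}"
  have B: "finite B" "B \<subseteq> A" using f by (auto simp: B_def direct_sum_simps)
  have "finsum N (\<lambda>a. h a ((c \<odot>\<^bsub>direct_sum A M\<^esub> f) a)) B = c \<odot>\<^bsub>N\<^esub> finsum N (\<lambda>a. h a (f a)) B"
    using B f c linear_map_closed[OF h] linear_map_smult[OF h]
    by (subst N.finsum_smult_ldistr) (auto simp: direct_sum_simps intro!: N.finsum_cong')
  moreover have "{a \<in> A. (c \<odot>\<^bsub>direct_sum A M\<^esub> f) a \<noteq> \<zero>\<^bsub>M a\<^esub>} \<subseteq> B"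
    using Module.module.smult_r_null[OF M] c by (auto simp: direct_sum_simps B_def)
  ultimately show "direct_sum_lift N A M h (c \<odot>\<^bsub>direct_sum A M\<^esub> f) =
      c \<odot>\<^bsub>N\<^esub> direct_sum_lift N A M h f"
    using f c B by (subst (1 2) direct_sum_lift_eval[of _ B]) (auto simp: B_def)
qed

lemma direct_sum_lift_single:
  assumes "a \<in> A" "m \<in> carrier (M a)"
  shows "direct_sum_lift N A M h (single M a m) = h a m"
proof -
  have "direct_sum_lift N A M h (single M a m) = finsum N (\<lambda>b. h b (single M a m b)) {a}"
    by (rule direct_sum_lift_eval) (use assms M in \<open>auto simp: single_apply intro!: single_closed\<close>)
  then show ?thesis
    using assms linear_map_closed[OF h] by (simp add: single_apply)
qed

end

text \<open>
  Composition in a linearization and in a Grothendieck construction have the same shape: for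
  families \<open>M\<close>, \<open>N\<close>, \<open>L\<close> indexed by sets \<open>A\<close>, \<open>B\<close>, \<open>C\<close> and an index composition
  \<open>A \<times> B \<rightarrow> C\<close>, bilinear maps between the components add up to a bilinear map of direct sums.
  It is determined by its values on pairs of elements concentrated in one degree.
\<close>

definition graded_product ::
  "'i set \<Rightarrow> ('i \<Rightarrow> ('k, 'm) module) \<Rightarrow> 'j set \<Rightarrow> ('j \<Rightarrow> ('k, 'n) module) \<Rightarrow> 'c set \<Rightarrow>
    ('c \<Rightarrow> ('k, 'l) module) \<Rightarrow> ('j \<Rightarrow> 'i \<Rightarrow> 'c) \<Rightarrow> ('i \<Rightarrow> 'j \<Rightarrow> 'n \<Rightarrow> 'm \<Rightarrow> 'l) \<Rightarrow>
    ('j \<Rightarrow> 'n) \<Rightarrow> ('i \<Rightarrow> 'm) \<Rightarrow> 'c \<Rightarrow> 'l" where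
  "graded_product A M B N C L cp \<beta> g f = extend_by_zero C L (\<lambda>c. finsum (L c)
     (\<lambda>(a, b). \<beta> a b (g b) (f a))
     {(a, b). a \<in> A \<and> b \<in> B \<and> cp b a = c \<and> f a \<noteq> \<zero>\<^bsub>M a\<^esub> \<and> g b \<noteq> \<zero>\<^bsub>N b\<^esub>})"

locale graded_pairing =
  fixes K :: "'k ring" and A :: "'i set" and M :: "'i \<Rightarrow> ('k, 'm) module"
    and B :: "'j set" and N :: "'j \<Rightarrow> ('k, 'n) module"
    and C :: "'c set" and L :: "'c \<Rightarrow> ('k, 'l) module"
    and cp :: "'j \<Rightarrow> 'i \<Rightarrow> 'c" and \<beta> :: "'i \<Rightarrow> 'j \<Rightarrow> 'n \<Rightarrow> 'm \<Rightarrow> 'l"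
  assumes K: "cring K"
    and M: "\<And>a. a \<in> A \<Longrightarrow> Module.module K (M a)"
    and N: "\<And>b. b \<in> B \<Longrightarrow> Module.module K (N b)"
    and L: "\<And>c. c \<in> C \<Longrightarrow> Module.module K (L c)"
    and cp: "\<And>a b. a \<in> A \<Longrightarrow> b \<in> B \<Longrightarrow> cp b a \<in> C"
    and right: "\<And>a b n. a \<in> A \<Longrightarrow> b \<in> B \<Longrightarrow> n \<in> carrier (N b) \<Longrightarrow>
      linear_map K (M a) (L (cp b a)) (\<lambda>m. \<beta> a b n m)"
    and left: "\<And>a b m. a \<in> A \<Longrightarrow> b \<in> B \<Longrightarrow> m \<in> carrier (M a) \<Longrightarrow>
      linear_map K (N b) (L (cp b a)) (\<lambda>n. \<beta> a b n m)"
begin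

abbreviation "product \<equiv> graded_product A M B N C L cp \<beta>"

lemma pairing_closed:
  "a \<in> A \<Longrightarrow> b \<in> B \<Longrightarrow> m \<in> carrier (M a) \<Longrightarrow> n \<in> carrier (N b) \<Longrightarrow> \<beta> a b n m \<in> carrier (L (cp b a))"
  using right linear_map_closed by fastforce

lemma pairing_zero:
  assumes "a \<in> A" "b \<in> B"
  shows "m \<in> carrier (M a) \<Longrightarrow> \<beta> a b \<zero>\<^bsub>N b\<^esub> m = \<zero>\<^bsub>L (cp b a)\<^esub>"
    and "n \<in> carrier (N b) \<Longrightarrow> \<beta> a b n \<zero>\<^bsub>M a\<^esub> = \<zero>\<^bsub>L (cp b a)\<^esub>"
  using linear_map_zero[OF N L[OF cp] left] linear_map_zero[OF M L[OF cp] right] assms by blast+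

text \<open>The index sets may be enlarged beyond the supports, since the additional summands vanish.  Values at
  several arguments can thus be compared over one common finite index set.\<close>

lemma graded_product_eval:
  assumes f: "f \<in> carrier (direct_sum A M)" and g: "g \<in> carrier (direct_sum B N)"
    and A': "finite A'" "A' \<subseteq> A" "{a \<in> A. f a \<noteq> \<zero>\<^bsub>M a\<^esub>} \<subseteq> A'"
    and B': "finite B'" "B' \<subseteq> B" "{b \<in> B. g b \<noteq> \<zero>\<^bsub>N b\<^esub>} \<subseteq> B'"
    and c: "c \<in> C"
  shows "product g f c =
    finsum (L c) (\<lambda>p. \<beta> (fst p) (snd p) (g (snd p)) (f (fst p))) {p \<in> A' \<times> B'. cp (snd p) (fst p) = c}"
proof -
  interpret L: Module.module K "L c" using L c .
  have *: "f a \<in> carrier (M a)" "g b \<in> carrier (N b)" if "a \<in> A" "b \<in> B" for a b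
    using that f g by (auto simp: direct_sum_simps)
  have "finsum (L c) (\<lambda>(a, b). \<beta> a b (g b) (f a))
      {(a, b). a \<in> A \<and> b \<in> B \<and> cp b a = c \<and> f a \<noteq> \<zero>\<^bsub>M a\<^esub> \<and> g b \<noteq> \<zero>\<^bsub>N b\<^esub>} =
    finsum (L c) (\<lambda>p. \<beta> (fst p) (snd p) (g (snd p)) (f (fst p)))
      {p \<in> A' \<times> B'. cp (snd p) (fst p) = c}"
  proof (rule L.add.finprod_mono_neutral_cong_left)
    show "finite {p \<in> A' \<times> B'. cp (snd p) (fst p) = c}" using A' B' by auto
    show "\<beta> (fst p) (snd p) (g (snd p)) (f (fst p)) = \<zero>\<^bsub>L c\<^esub>"
      if p: "p \<in> {p \<in> A' \<times> B'. cp (snd p) (fst p) = c} -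
        {(a, b). a \<in> A \<and> b \<in> B \<and> cp b a = c \<and> f a \<noteq> \<zero>\<^bsub>M a\<^esub> \<and> g b \<noteq> \<zero>\<^bsub>N b\<^esub>}" for p
    proof -
      obtain a b where ab: "p = (a, b)" "a \<in> A" "b \<in> B" "cp b a = c" "f a = \<zero>\<^bsub>M a\<^esub> \<or> g b = \<zero>\<^bsub>N b\<^esub>"
        using p A' B' by (cases p) auto
      then show ?thesis using pairing_zero[OF ab(2,3)] *[OF ab(2,3)] by auto
    qed
    show "(\<lambda>p. \<beta> (fst p) (snd p) (g (snd p)) (f (fst p)))
        \<in> {p \<in> A' \<times> B'. cp (snd p) (fst p) = c} \<rightarrow> carrier (L c)"
      using A' B' * pairing_closed by fastforce
  qed (use A' B' in auto)
  then show ?thesis using c by (simp add: graded_product_def extend_by_zero_def)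
qed

lemma graded_product_closed:
  assumes f: "f \<in> carrier (direct_sum A M)" and g: "g \<in> carrier (direct_sum B N)"
  shows "product g f \<in> carrier (direct_sum C L)"
proof -
  define A' B' where "A' = {a \<in> A. f a \<noteq> \<zero>\<^bsub>M a\<^esub>}" and "B' = {b \<in> B. g b \<noteq> \<zero>\<^bsub>N b\<^esub>}"
  have fin: "finite A'" "A' \<subseteq> A" "finite B'" "B' \<subseteq> B" using f g by (auto simp: A'_def B'_def direct_sum_simps)
  have *: "f a \<in> carrier (M a)" "g b \<in> carrier (N b)" if "a \<in> A" "b \<in> B" for a b
    using that f g by (auto simp: direct_sum_simps)
  have eval: "product g f c = finsum (L c) (\<lambda>p. \<beta> (fst p) (snd p) (g (snd p)) (f (fst p)))
      {p \<in> A' \<times> B'. cp (snd p) (fst p) = c}" if "c \<in> C" for c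
    by (rule graded_product_eval) (use f g fin that in \<open>auto simp: A'_def B'_def\<close>)
  have "product g f c \<in> carrier (L c)" if "c \<in> C" for c
  proof -
    interpret L: Module.module K "L c" using L that .
    show ?thesis
      unfolding eval[OF that] using fin * pairing_closed by (intro L.finsum_closed) fastforce
  qed
  moreover have "product g f c = \<zero>\<^bsub>L c\<^esub>" if "c \<notin> C" for c
    using that by (simp add: graded_product_def extend_by_zero_def)
  moreover have "finite {c \<in> C. product g f c \<noteq> \<zero>\<^bsub>L c\<^esub>}"
  proof (rule finite_subset[of _ "(\<lambda>p. cp (snd p) (fst p)) ` (A' \<times> B')"])
    show "{c \<in> C. product g f c \<noteq> \<zero>\<^bsub>L c\<^esub>} \<subseteq> (\<lambda>p. cp (snd p) (fst p)) ` (A' \<times> B')"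
    proof
      fix c assume c: "c \<in> {c \<in> C. product g f c \<noteq> \<zero>\<^bsub>L c\<^esub>}"
      interpret L: Module.module K "L c" using L c by auto
      have "{p \<in> A' \<times> B'. cp (snd p) (fst p) = c} \<noteq> {}"
      proof
        assume "{p \<in> A' \<times> B'. cp (snd p) (fst p) = c} = {}"
        then show False using c eval[of c] by (simp only: L.finsum_empty) simp
      qed
      then show "c \<in> (\<lambda>p. cp (snd p) (fst p)) ` (A' \<times> B')" by blast
    qed
  qed (use fin in simp)
  ultimately show ?thesis by (simp add: direct_sum_simps)
qed

lemma graded_product_linear_right:
  assumes g: "g \<in> carrier (direct_sum B N)"
  shows "linear_map K (direct_sum A M) (direct_sum C L) (\<lambda>f. product g f)"
proof (rule linear_mapI)
  interpret S: Module.module K "direct_sum A M" by (rule module_direct_sum[OF K M])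
  define B' where "B' = {b \<in> B. g b \<noteq> \<zero>\<^bsub>N b\<^esub>}"
  have B': "finite B'" "B' \<subseteq> B" using g by (auto simp: B'_def direct_sum_simps)
  fix f assume f: "f \<in> carrier (direct_sum A M)"
  show "product g f \<in> carrier (direct_sum C L)" using f g by (rule graded_product_closed)
  have fa: "f a \<in> carrier (M a)" if "a \<in> A" for a
    using that f by (auto simp: direct_sum_simps)
  have gb: "g b \<in> carrier (N b)" if "b \<in> B" for b
    using that g by (auto simp: direct_sum_simps)
  {
    fix f' assume f': "f' \<in> carrier (direct_sum A M)"
    have fa': "f' a \<in> carrier (M a)" if "a \<in> A" for a
      using that f' by (auto simp: direct_sum_simps)
    define A' where "A' = {a \<in> A. f a \<noteq> \<zero>\<^bsub>M a\<^esub>} \<union> {a \<in> A. f' a \<noteq> \<zero>\<^bsub>M a\<^esub>} \<union>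
      {a \<in> A. (f \<oplus>\<^bsub>direct_sum A M\<^esub> f') a \<noteq> \<zero>\<^bsub>M a\<^esub>}"
    have ff': "f \<oplus>\<^bsub>direct_sum A M\<^esub> f' \<in> carrier (direct_sum A M)" using f f' by simp
    then have A': "finite A'" "A' \<subseteq> A"
      using f f' unfolding A'_def direct_sum_simps(1) by auto
    have "product g (f \<oplus>\<^bsub>direct_sum A M\<^esub> f') c = product g f c \<oplus>\<^bsub>L c\<^esub> product g f' c" if c: "c \<in> C" for c
    proof -
      interpret L: Module.module K "L c" using L c .
      show ?thesis
        using f f' ff' A' B' g c fa fa' gb pairing_closed linear_map_add[OF right]
        by (subst (1 2 3) graded_product_eval[of _ _ A' B']; (subst L.finsum_addf[symmetric])?)
          (fastforce simp: A'_def B'_def direct_sum_simps intro!: L.finsum_cong')+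
    qed
    then show "product g (f \<oplus>\<^bsub>direct_sum A M\<^esub> f') = product g f \<oplus>\<^bsub>direct_sum C L\<^esub> product g f'"
      by (auto simp: fun_eq_iff direct_sum_simps(3) graded_product_def extend_by_zero_def)
  }
  fix k assume k: "k \<in> carrier K"
  define A' where "A' = {a \<in> A. f a \<noteq> \<zero>\<^bsub>M a\<^esub>} \<union> {a \<in> A. (k \<odot>\<^bsub>direct_sum A M\<^esub> f) a \<noteq> \<zero>\<^bsub>M a\<^esub>}"
  have kf: "k \<odot>\<^bsub>direct_sum A M\<^esub> f \<in> carrier (direct_sum A M)" using f k by simp
  then have A': "finite A'" "A' \<subseteq> A"
    using f unfolding A'_def direct_sum_simps(1) by auto
  have "product g (k \<odot>\<^bsub>direct_sum A M\<^esub> f) c = k \<odot>\<^bsub>L c\<^esub> product g f c" if c: "c \<in> C" for c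
  proof -
    interpret L: Module.module K "L c" using L c .
    show ?thesis
      using f k kf A' B' g c fa gb pairing_closed linear_map_smult[OF right]
      by (subst (1 2) graded_product_eval[of _ _ A' B']; (subst L.finsum_smult_ldistr)?)
        (fastforce simp: A'_def B'_def direct_sum_simps intro!: L.finsum_cong')+
  qed
  then show "product g (k \<odot>\<^bsub>direct_sum A M\<^esub> f) = k \<odot>\<^bsub>direct_sum C L\<^esub> product g f"
    by (auto simp: fun_eq_iff direct_sum_simps(4) graded_product_def extend_by_zero_def)
qed

lemma graded_product_linear_left:
  assumes f: "f \<in> carrier (direct_sum A M)"
  shows "linear_map K (direct_sum B N) (direct_sum C L) (\<lambda>g. product g f)"
proof (rule linear_mapI)
  interpret S: Module.module K "direct_sum B N" by (rule module_direct_sum[OF K N])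
  define A' where "A' = {a \<in> A. f a \<noteq> \<zero>\<^bsub>M a\<^esub>}"
  have A': "finite A'" "A' \<subseteq> A" using f by (auto simp: A'_def direct_sum_simps)
  fix g assume g: "g \<in> carrier (direct_sum B N)"
  show "product g f \<in> carrier (direct_sum C L)" using f g by (rule graded_product_closed)
  have fa: "f a \<in> carrier (M a)" if "a \<in> A" for a
    using that f by (auto simp: direct_sum_simps)
  have gb: "g b \<in> carrier (N b)" if "b \<in> B" for b
    using that g by (auto simp: direct_sum_simps)
  {
    fix g' assume g': "g' \<in> carrier (direct_sum B N)"
    have gb': "g' b \<in> carrier (N b)" if "b \<in> B" for b
      using that g' by (auto simp: direct_sum_simps)
    define B' where "B' = {b \<in> B. g b \<noteq> \<zero>\<^bsub>N b\<^esub>} \<union> {b \<in> B. g' b \<noteq> \<zero>\<^bsub>N b\<^esub>} \<union>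
      {b \<in> B. (g \<oplus>\<^bsub>direct_sum B N\<^esub> g') b \<noteq> \<zero>\<^bsub>N b\<^esub>}"
    have gg': "g \<oplus>\<^bsub>direct_sum B N\<^esub> g' \<in> carrier (direct_sum B N)" using g g' by simp
    then have B': "finite B'" "B' \<subseteq> B"
      using g g' unfolding B'_def direct_sum_simps(1) by auto
    have "product (g \<oplus>\<^bsub>direct_sum B N\<^esub> g') f c = product g f c \<oplus>\<^bsub>L c\<^esub> product g' f c" if c: "c \<in> C" for c
    proof -
      interpret L: Module.module K "L c" using L c .
      show ?thesis
        using f g' gg' A' B' g c fa gb' gb pairing_closed linear_map_add[OF left]
        by (subst (1 2 3) graded_product_eval[of _ _ A' B']; (subst L.finsum_addf[symmetric])?)
          (fastforce simp: A'_def B'_def direct_sum_simps intro!: L.finsum_cong')+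
    qed
    then show "product (g \<oplus>\<^bsub>direct_sum B N\<^esub> g') f = product g f \<oplus>\<^bsub>direct_sum C L\<^esub> product g' f"
      by (auto simp: fun_eq_iff direct_sum_simps(3) graded_product_def extend_by_zero_def)
  }
  fix k assume k: "k \<in> carrier K"
  define B' where "B' = {b \<in> B. g b \<noteq> \<zero>\<^bsub>N b\<^esub>} \<union> {b \<in> B. (k \<odot>\<^bsub>direct_sum B N\<^esub> g) b \<noteq> \<zero>\<^bsub>N b\<^esub>}"
  have kg: "k \<odot>\<^bsub>direct_sum B N\<^esub> g \<in> carrier (direct_sum B N)" using g k by simp
  then have B': "finite B'" "B' \<subseteq> B"
    using g unfolding B'_def direct_sum_simps(1) by auto
  have "product (k \<odot>\<^bsub>direct_sum B N\<^esub> g) f c = k \<odot>\<^bsub>L c\<^esub> product g f c" if c: "c \<in> C" for c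
  proof -
    interpret L: Module.module K "L c" using L c .
    show ?thesis
      using f k kg A' B' g c fa gb pairing_closed linear_map_smult[OF left]
      by (subst (1 2) graded_product_eval[of _ _ A' B']; (subst L.finsum_smult_ldistr)?)
        (fastforce simp: A'_def B'_def direct_sum_simps intro!: L.finsum_cong')+
  qed
  then show "product (k \<odot>\<^bsub>direct_sum B N\<^esub> g) f = k \<odot>\<^bsub>direct_sum C L\<^esub> product g f"
    by (auto simp: fun_eq_iff direct_sum_simps(4) graded_product_def extend_by_zero_def)
qed

lemma graded_product_single:
  assumes a: "a \<in> A" "m \<in> carrier (M a)" and b: "b \<in> B" "n \<in> carrier (N b)"
  shows "product (single N b n) (single M a m) = single L (cp b a) (\<beta> a b n m)"
proof
  fix c
  show "product (single N b n) (single M a m) c = single L (cp b a) (\<beta> a b n m) c"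
  proof (cases "c \<in> C")
    case True
    interpret L: Module.module K "L c" using L True .
    have "product (single N b n) (single M a m) c =
      finsum (L c) (\<lambda>p. \<beta> (fst p) (snd p) (single N b n (snd p)) (single M a m (fst p)))
        {p \<in> {a} \<times> {b}. cp (snd p) (fst p) = c}"
      by (rule graded_product_eval)
        (use assms True M N in \<open>auto simp: single_apply intro!: single_closed\<close>)
    moreover have "{p \<in> {a} \<times> {b}. cp (snd p) (fst p) = c} = (if c = cp b a then {(a, b)} else {})"
      by auto
    moreover have "finsum (L c) (\<lambda>p. \<beta> (fst p) (snd p) (single N b n (snd p)) (single M a m (fst p)))
      (if c = cp b a then {(a, b)} else {}) = single L (cp b a) (\<beta> a b n m) c"
    proof (cases "c = cp b a")
      case eq: True
      have v: "\<beta> (fst (a, b)) (snd (a, b)) (single N b n (snd (a, b))) (single M a m (fst (a, b))) = \<beta> a b n m"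
        by (simp add: single_apply)
      have mem: "\<beta> a b n m \<in> carrier (L c)" unfolding eq using pairing_closed assms by blast
      have "finsum (L c) (\<lambda>p. \<beta> (fst p) (snd p) (single N b n (snd p)) (single M a m (fst p))) {(a, b)} =
          \<beta> a b n m"
        by (subst L.finsum_insert) (simp_all only: v mem, simp_all add: mem)
      then show ?thesis
        unfolding if_P[OF eq] by (simp add: single_apply eq[symmetric])
    qed (simp add: single_apply)
    ultimately show ?thesis by simp
  next
    case False
    then show ?thesis using cp[of a b] assms
      by (auto simp: single_apply graded_product_def extend_by_zero_def)
  qed
qed

end

lemma submodule_coset_facts:
  assumes M: "Module.module K M" and H: "submodule H K M"
  shows quotient_module_carrier: "carrier (quotient_module M H) = (\<lambda>f. H +>\<^bsub>M\<^esub> f) ` carrier M"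
    and quotient_module_zero: "\<zero>\<^bsub>quotient_module M H\<^esub> = H"
    and coset_zero: "H +>\<^bsub>M\<^esub> \<zero>\<^bsub>M\<^esub> = H"
    and coset_self: "f \<in> carrier M \<Longrightarrow> f \<in> H +>\<^bsub>M\<^esub> f"
    and coset_closed: "f \<in> carrier M \<Longrightarrow> f' \<in> H +>\<^bsub>M\<^esub> f \<Longrightarrow> f' \<in> carrier M"
    and coset_eq: "f \<in> carrier M \<Longrightarrow> f' \<in> H +>\<^bsub>M\<^esub> f \<Longrightarrow> H +>\<^bsub>M\<^esub> f' = H +>\<^bsub>M\<^esub> f"
    and coset_eq_iff: "f \<in> carrier M \<Longrightarrow> g \<in> carrier M \<Longrightarrow>
      H +>\<^bsub>M\<^esub> f = H +>\<^bsub>M\<^esub> g \<longleftrightarrow> f \<ominus>\<^bsub>M\<^esub> g \<in> H"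
    and quotient_module_add: "f \<in> carrier M \<Longrightarrow> g \<in> carrier M \<Longrightarrow>
      (H +>\<^bsub>M\<^esub> f) \<oplus>\<^bsub>quotient_module M H\<^esub> (H +>\<^bsub>M\<^esub> g) = H +>\<^bsub>M\<^esub> (f \<oplus>\<^bsub>M\<^esub> g)"
    and quotient_module_smult: "c \<in> carrier K \<Longrightarrow> f \<in> carrier M \<Longrightarrow>
      c \<odot>\<^bsub>quotient_module M H\<^esub> (H +>\<^bsub>M\<^esub> f) = H +>\<^bsub>M\<^esub> (c \<odot>\<^bsub>M\<^esub> f)"
proof -
  interpret M: Module.module K M by fact
  interpret H: abelian_subgroup H M
    by (rule abelian_subgroupI3)
      (use H M.abelian_group_axioms in \<open>auto simp: submodule_def intro: additive_subgroupI\<close>)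
  note HE = M.submoduleE[OF H]
  show "carrier (quotient_module M H) = (\<lambda>f. H +>\<^bsub>M\<^esub> f) ` carrier M"
    by (auto simp: quotient_module_def A_RCOSETS_def')
  show "\<zero>\<^bsub>quotient_module M H\<^esub> = H" by (simp add: quotient_module_def)
  show "H +>\<^bsub>M\<^esub> \<zero>\<^bsub>M\<^esub> = H" using HE(1) by (rule M.a_coset_add_zero)
  show self: "f \<in> H +>\<^bsub>M\<^esub> f" if "f \<in> carrier M" for f
    using that by (rule H.a_rcos_self)
  show closed: "f' \<in> carrier M" if "f \<in> carrier M" "f' \<in> H +>\<^bsub>M\<^esub> f" for f f'
    using that M.a_r_coset_subset_G[OF HE(1)] by blast
  show eq: "H +>\<^bsub>M\<^esub> f' = H +>\<^bsub>M\<^esub> f" if "f \<in> carrier M" "f' \<in> H +>\<^bsub>M\<^esub> f" for f f'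
    using M.a_repr_independence[OF that(2,1) H.a_subgroup] by simp
  show iff: "H +>\<^bsub>M\<^esub> f = H +>\<^bsub>M\<^esub> g \<longleftrightarrow> f \<ominus>\<^bsub>M\<^esub> g \<in> H" if "f \<in> carrier M" "g \<in> carrier M" for f g
    using that H.a_rcos_module[of g f] self[of f] eq[of g f] unfolding a_minus_def by blast
  show "(H +>\<^bsub>M\<^esub> f) \<oplus>\<^bsub>quotient_module M H\<^esub> (H +>\<^bsub>M\<^esub> g) = H +>\<^bsub>M\<^esub> (f \<oplus>\<^bsub>M\<^esub> g)"
    if "f \<in> carrier M" "g \<in> carrier M" for f g
    using H.a_rcos_sum[OF that] by (simp add: quotient_module_def)
  show "c \<odot>\<^bsub>quotient_module M H\<^esub> (H +>\<^bsub>M\<^esub> f) = H +>\<^bsub>M\<^esub> (c \<odot>\<^bsub>M\<^esub> f)"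
    if c: "c \<in> carrier K" and f: "f \<in> carrier M" for c f
  proof -
    have "H +>\<^bsub>M\<^esub> (c \<odot>\<^bsub>M\<^esub> f') = H +>\<^bsub>M\<^esub> (c \<odot>\<^bsub>M\<^esub> f)" if f': "f' \<in> H +>\<^bsub>M\<^esub> f" for f'
    proof -
      have f'c: "f' \<in> carrier M" using closed f f' by blast
      have "f' \<ominus>\<^bsub>M\<^esub> f \<in> H" using iff[OF f'c f] eq[OF f f'] by simp
      then have "c \<odot>\<^bsub>M\<^esub> (f' \<ominus>\<^bsub>M\<^esub> f) \<in> H" using HE(4) c by blast
      then have "c \<odot>\<^bsub>M\<^esub> f' \<ominus>\<^bsub>M\<^esub> c \<odot>\<^bsub>M\<^esub> f \<in> H"
        using c f f'c by (simp add: a_minus_def M.smult_r_distr M.smult_r_minus)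
      then show ?thesis using iff c f f'c by simp
    qed
    then have "(\<Union>f'\<in>H +>\<^bsub>M\<^esub> f. H +>\<^bsub>M\<^esub> (c \<odot>\<^bsub>M\<^esub> f')) = H +>\<^bsub>M\<^esub> (c \<odot>\<^bsub>M\<^esub> f)"
      using self[OF f] by (intro SUP_eq_const) blast+
    then show ?thesis by (simp add: quotient_module_def)
  qed
qed

lemma module_quotient_module:
  assumes M: "Module.module K M" and H: "submodule H K M"
  shows "Module.module K (quotient_module M H)"
proof -
  interpret M: Module.module K M by fact
  note q = quotient_module_carrier[OF assms] quotient_module_add[OF assms]
    quotient_module_smult[OF assms]
  have z: "\<zero>\<^bsub>quotient_module M H\<^esub> = H +>\<^bsub>M\<^esub> \<zero>\<^bsub>M\<^esub>"
    by (simp add: quotient_module_zero[OF assms] coset_zero[OF assms])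
  have "\<exists>y\<in>carrier (quotient_module M H). y \<oplus>\<^bsub>quotient_module M H\<^esub> x = \<zero>\<^bsub>quotient_module M H\<^esub>"
    if x: "x \<in> carrier (quotient_module M H)" for x
  proof -
    obtain f where "f \<in> carrier M" "x = H +>\<^bsub>M\<^esub> f" using x q(1) by auto
    then show ?thesis
      by (intro bexI[of _ "H +>\<^bsub>M\<^esub> (\<ominus>\<^bsub>M\<^esub> f)"]) (simp_all add: q z M.l_neg)
  qed
  then show ?thesis
    by (intro moduleI abelian_groupI)
      (auto simp: q z M.a_ac M.smult_l_distr M.smult_r_distr M.smult_assoc1
        intro: M.is_cring)
qed

lemma quotient_projection_linear:
  assumes "Module.module K M" "submodule H K M"
  shows "linear_map K M (quotient_module M H) (\<lambda>f. H +>\<^bsub>M\<^esub> f)"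
  by (rule linear_mapI)
    (auto simp: quotient_module_carrier[OF assms] quotient_module_add[OF assms]
      quotient_module_smult[OF assms])


section \<open>Linear categories, functors and ideals\<close>

abbreviation "Hom C x y \<equiv> carrier (kcat_hom C x y)"

lemma k_categoryI:
  assumes "\<And>x. x \<in> kcat_obj C \<Longrightarrow> kcat_id C x \<in> Hom C x x"
    and "\<And>x y. x \<in> kcat_obj C \<Longrightarrow> y \<in> kcat_obj C \<Longrightarrow> Module.module K (kcat_hom C x y)"
    and "\<And>x y z g. x \<in> kcat_obj C \<Longrightarrow> y \<in> kcat_obj C \<Longrightarrow> z \<in> kcat_obj C \<Longrightarrow>
      g \<in> Hom C y z \<Longrightarrow>
      linear_map K (kcat_hom C x y) (kcat_hom C x z) (\<lambda>f. kcat_comp C x y z g f)"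
    and "\<And>x y z f. x \<in> kcat_obj C \<Longrightarrow> y \<in> kcat_obj C \<Longrightarrow> z \<in> kcat_obj C \<Longrightarrow>
      f \<in> Hom C x y \<Longrightarrow>
      linear_map K (kcat_hom C y z) (kcat_hom C x z) (\<lambda>g. kcat_comp C x y z g f)"
    and "\<And>x y f. x \<in> kcat_obj C \<Longrightarrow> y \<in> kcat_obj C \<Longrightarrow> f \<in> Hom C x y \<Longrightarrow>
      kcat_comp C x y y (kcat_id C y) f = f"
    and "\<And>x y f. x \<in> kcat_obj C \<Longrightarrow> y \<in> kcat_obj C \<Longrightarrow> f \<in> Hom C x y \<Longrightarrow>
      kcat_comp C x x y f (kcat_id C x) = f"
    and "\<And>w x y z f g h. w \<in> kcat_obj C \<Longrightarrow> x \<in> kcat_obj C \<Longrightarrow> y \<in> kcat_obj C \<Longrightarrow>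
      z \<in> kcat_obj C \<Longrightarrow> f \<in> Hom C w x \<Longrightarrow> g \<in> Hom C x y \<Longrightarrow>
      h \<in> Hom C y z \<Longrightarrow>
      kcat_comp C w y z h (kcat_comp C w x y g f) = kcat_comp C w x z (kcat_comp C x y z h g) f"
  shows "k_category K C"
proof (intro k_category.intro category.intro k_category_axioms.intro)
  have "kcat_comp C x y z g f \<in> Hom C x z"
    if "x \<in> kcat_obj C" "y \<in> kcat_obj C" "z \<in> kcat_obj C" "f \<in> Hom C x y"
      "g \<in> Hom C y z" for x y z f g
    using linear_map_closed[OF assms(3)] that by blast
  then show "cat_comp (underlying_cat C) x y z g f \<in> cat_hom (underlying_cat C) x z"
    if "x \<in> cat_obj (underlying_cat C)" "y \<in> cat_obj (underlying_cat C)"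
      "z \<in> cat_obj (underlying_cat C)" "f \<in> cat_hom (underlying_cat C) x y"
      "g \<in> cat_hom (underlying_cat C) y z" for x y z f g
    using that by (simp add: underlying_cat_def)
qed (simp_all add: underlying_cat_def assms)

context k_category
begin

lemma k_id: "x \<in> kcat_obj C \<Longrightarrow> kcat_id C x \<in> Hom C x x"
  using id_hom by (simp add: underlying_cat_def)

lemma k_comp_closed: "x \<in> kcat_obj C \<Longrightarrow> y \<in> kcat_obj C \<Longrightarrow> z \<in> kcat_obj C \<Longrightarrow>
    f \<in> Hom C x y \<Longrightarrow> g \<in> Hom C y z \<Longrightarrow>
    kcat_comp C x y z g f \<in> Hom C x z"
  using comp_hom by (simp add: underlying_cat_def)

lemma k_id_left: "x \<in> kcat_obj C \<Longrightarrow> y \<in> kcat_obj C \<Longrightarrow> f \<in> Hom C x y \<Longrightarrow>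
    kcat_comp C x y y (kcat_id C y) f = f"
  using comp_id_left by (simp add: underlying_cat_def)

lemma k_id_right: "x \<in> kcat_obj C \<Longrightarrow> y \<in> kcat_obj C \<Longrightarrow> f \<in> Hom C x y \<Longrightarrow>
    kcat_comp C x x y f (kcat_id C x) = f"
  using comp_id_right by (simp add: underlying_cat_def)

lemma k_assoc: "w \<in> kcat_obj C \<Longrightarrow> x \<in> kcat_obj C \<Longrightarrow> y \<in> kcat_obj C \<Longrightarrow> z \<in> kcat_obj C \<Longrightarrow>
    f \<in> Hom C w x \<Longrightarrow> g \<in> Hom C x y \<Longrightarrow>
    h \<in> Hom C y z \<Longrightarrow>
    kcat_comp C w y z h (kcat_comp C w x y g f) = kcat_comp C w x z (kcat_comp C x y z h g) f"
  using comp_assoc by (simp add: underlying_cat_def)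

text \<open>Two commutative squares side by side form a commutative rectangle.  Naturality on a path is
  obtained from naturality on its arrows in this way.\<close>

lemma paste_squares:
  assumes "a \<in> kcat_obj C" "b \<in> kcat_obj C" "c \<in> kcat_obj C" "a' \<in> kcat_obj C" "b' \<in> kcat_obj C" "c' \<in> kcat_obj C"
    and "f \<in> Hom C a b" "g \<in> Hom C b c"
    and "f' \<in> Hom C a' b'" "g' \<in> Hom C b' c'"
    and "r \<in> Hom C a a'" "s \<in> Hom C b b'" "t \<in> Hom C c c'"
    and left: "kcat_comp C a b b' s f = kcat_comp C a a' b' f' r"
    and right: "kcat_comp C b c c' t g = kcat_comp C b b' c' g' s"
  shows "kcat_comp C a c c' t (kcat_comp C a b c g f) = kcat_comp C a a' c' (kcat_comp C a' b' c' g' f') r"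
proof -
  have "kcat_comp C a c c' t (kcat_comp C a b c g f) = kcat_comp C a b c' (kcat_comp C b b' c' g' s) f"
    using assms(1-13) by (simp add: k_assoc right)
  also have "\<dots> = kcat_comp C a a' c' (kcat_comp C a' b' c' g' f') r"
    using assms(1-13) by (simp add: k_assoc[symmetric] left)
  finally show ?thesis .
qed

text \<open>The two inner factors of a fourfold composite are replaced along a commutative square.  In the
  Grothendieck construction the square is a naturality square.\<close>

lemma comp_exchange_middle:
  assumes "p0 \<in> kcat_obj C" "p1 \<in> kcat_obj C" "p2 \<in> kcat_obj C" "q \<in> kcat_obj C" "p3 \<in> kcat_obj C" "p4 \<in> kcat_obj C"
    and "v \<in> Hom C p0 p1" "s \<in> Hom C p3 p4"
    and "u \<in> Hom C p1 p2" "t \<in> Hom C p2 p3"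
    and "t' \<in> Hom C p1 q" "u' \<in> Hom C q p3"
    and "kcat_comp C p1 p2 p3 t u = kcat_comp C p1 q p3 u' t'"
  shows "kcat_comp C p0 p2 p4 (kcat_comp C p2 p3 p4 s t) (kcat_comp C p0 p1 p2 u v) =
    kcat_comp C p0 q p4 (kcat_comp C q p3 p4 s u') (kcat_comp C p0 p1 q t' v)"
proof -
  have "kcat_comp C p0 p2 p4 (kcat_comp C p2 p3 p4 s t) (kcat_comp C p0 p1 p2 u v) =
      kcat_comp C p0 p3 p4 s (kcat_comp C p0 p1 p3 (kcat_comp C p1 p2 p3 t u) v)"
    using assms(1-12) k_comp_closed[OF assms(1-3,7,9)] by (simp add: k_assoc[symmetric])
  also have "\<dots> = kcat_comp C p0 q p4 (kcat_comp C q p3 p4 s u') (kcat_comp C p0 p1 q t' v)"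
    unfolding assms(13) using assms(1-12) k_comp_closed[OF assms(1,2,4,7,11)] by (simp add: k_assoc[symmetric])
  finally show ?thesis .
qed

end

lemma k_functorI:
  assumes "k_category K C" "k_category K D"
    and "\<And>x. x \<in> kcat_obj C \<Longrightarrow> fun_obj F x \<in> kcat_obj D"
    and "\<And>x y. x \<in> kcat_obj C \<Longrightarrow> y \<in> kcat_obj C \<Longrightarrow>
      linear_map K (kcat_hom C x y) (kcat_hom D (fun_obj F x) (fun_obj F y)) (fun_mor F x y)"
    and "\<And>x. x \<in> kcat_obj C \<Longrightarrow> fun_mor F x x (kcat_id C x) = kcat_id D (fun_obj F x)"
    and "\<And>x y z f g. x \<in> kcat_obj C \<Longrightarrow> y \<in> kcat_obj C \<Longrightarrow> z \<in> kcat_obj C \<Longrightarrow>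
      f \<in> Hom C x y \<Longrightarrow> g \<in> Hom C y z \<Longrightarrow>
      fun_mor F x z (kcat_comp C x y z g f) =
        kcat_comp D (fun_obj F x) (fun_obj F y) (fun_obj F z) (fun_mor F y z g) (fun_mor F x y f)"
  shows "k_functor K C D F"
  using assms by (auto simp: k_functor_def)

lemma k_functorD:
  assumes "k_functor K C D F"
  shows k_functor_source: "k_category K C" and k_functor_target: "k_category K D"
    and k_functor_obj: "x \<in> kcat_obj C \<Longrightarrow> fun_obj F x \<in> kcat_obj D"
    and k_functor_linear: "x \<in> kcat_obj C \<Longrightarrow> y \<in> kcat_obj C \<Longrightarrow>
      linear_map K (kcat_hom C x y) (kcat_hom D (fun_obj F x) (fun_obj F y)) (fun_mor F x y)"
    and k_functor_id: "x \<in> kcat_obj C \<Longrightarrow> fun_mor F x x (kcat_id C x) = kcat_id D (fun_obj F x)"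
    and k_functor_comp: "x \<in> kcat_obj C \<Longrightarrow> y \<in> kcat_obj C \<Longrightarrow> z \<in> kcat_obj C \<Longrightarrow>
      f \<in> Hom C x y \<Longrightarrow> g \<in> Hom C y z \<Longrightarrow>
      fun_mor F x z (kcat_comp C x y z g f) =
        kcat_comp D (fun_obj F x) (fun_obj F y) (fun_obj F z) (fun_mor F y z g) (fun_mor F x y f)"
  using assms by (auto simp: k_functor_def)

lemma k_functor_mor:
  "k_functor K C D F \<Longrightarrow> x \<in> kcat_obj C \<Longrightarrow> y \<in> kcat_obj C \<Longrightarrow> f \<in> Hom C x y \<Longrightarrow>
    fun_mor F x y f \<in> Hom D (fun_obj F x) (fun_obj F y)"
  by (rule linear_map_closed[OF k_functor_linear])

lemma k_functor_zero:
  assumes "k_functor K C D F" "x \<in> kcat_obj C" "y \<in> kcat_obj C"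
  shows "fun_mor F x y \<zero>\<^bsub>kcat_hom C x y\<^esub> = \<zero>\<^bsub>kcat_hom D (fun_obj F x) (fun_obj F y)\<^esub>"
  by (rule linear_map_zero[OF _ _ k_functor_linear[OF assms]])
    (intro k_category.hom_module[OF k_functor_source[OF assms(1)]]
      k_category.hom_module[OF k_functor_target[OF assms(1)]] k_functor_obj[OF assms(1)] assms)+

lemma comp_functor_simps [simp]:
  "fun_obj (comp_functor G F) x = fun_obj G (fun_obj F x)"
  "fun_mor (comp_functor G F) x y f = fun_mor G (fun_obj F x) (fun_obj F y) (fun_mor F x y f)"
  by (simp_all add: comp_functor_def)

lemma id_functor_simps [simp]: "fun_obj id_functor x = x" "fun_mor id_functor x y f = f"
  by (simp_all add: id_functor_def)

lemma k_functor_comp_functor: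
  assumes "k_functor K C D F" "k_functor K D E G"
  shows "k_functor K C E (comp_functor G F)"
proof (rule k_functorI)
  fix x y assume "x \<in> kcat_obj C" "y \<in> kcat_obj C"
  then show "linear_map K (kcat_hom C x y)
      (kcat_hom E (fun_obj (comp_functor G F) x) (fun_obj (comp_functor G F) y))
      (fun_mor (comp_functor G F) x y)"
    unfolding comp_functor_def functor_data.simps
    by (intro linear_map_comp[OF k_functor_linear[OF assms(1)] k_functor_linear[OF assms(2)]]
        k_functor_obj[OF assms(1)])
qed (use assms in \<open>auto simp: k_functorD k_functor_mor\<close>)

lemma kcat_idealD:
  assumes "kcat_ideal K C J"
  shows ideal_submodule: "x \<in> kcat_obj C \<Longrightarrow> y \<in> kcat_obj C \<Longrightarrow> submodule (J x y) K (kcat_hom C x y)"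
    and ideal_comp_left: "x \<in> kcat_obj C \<Longrightarrow> y \<in> kcat_obj C \<Longrightarrow> z \<in> kcat_obj C \<Longrightarrow>
      f \<in> J x y \<Longrightarrow> g \<in> Hom C y z \<Longrightarrow> kcat_comp C x y z g f \<in> J x z"
    and ideal_comp_right: "x \<in> kcat_obj C \<Longrightarrow> y \<in> kcat_obj C \<Longrightarrow> z \<in> kcat_obj C \<Longrightarrow>
      f \<in> Hom C x y \<Longrightarrow> g \<in> J y z \<Longrightarrow> kcat_comp C x y z g f \<in> J x z"
  using assms by (auto simp: kcat_ideal_def)

lemma quotient_kcat_simps:
  "kcat_obj (quotient_kcat C J) = kcat_obj C"
  "kcat_hom (quotient_kcat C J) x y = quotient_module (kcat_hom C x y) (J x y)"
  "kcat_id (quotient_kcat C J) x = J x x +>\<^bsub>kcat_hom C x x\<^esub> kcat_id C x"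
  by (simp_all add: quotient_kcat_def)

lemma quotient_functor_simps:
  "fun_obj (quotient_functor C J) x = x"
  "fun_mor (quotient_functor C J) x y f = J x y +>\<^bsub>kcat_hom C x y\<^esub> f"
  by (simp_all add: quotient_functor_def)

context
  fixes K :: "'k ring" and C :: "('o, 'm, 'k) kcat" and J :: "'o \<Rightarrow> 'o \<Rightarrow> 'm set"
  assumes C: "k_category K C" and J: "kcat_ideal K C J"
begin

interpretation k_category K C by (rule C)

text \<open>Changing representatives one factor at a time, \<open>g'f' - gf = g'(f' - f) + (g' - g)f\<close> stays in
  the ideal.\<close>

lemma quotient_kcat_comp:
  assumes obj: "x \<in> kcat_obj C" "y \<in> kcat_obj C" "z \<in> kcat_obj C"
    and f: "f \<in> Hom C x y" and g: "g \<in> Hom C y z"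
  shows "kcat_comp (quotient_kcat C J) x y z (J y z +>\<^bsub>kcat_hom C y z\<^esub> g) (J x y +>\<^bsub>kcat_hom C x y\<^esub> f) =
    J x z +>\<^bsub>kcat_hom C x z\<^esub> kcat_comp C x y z g f"
proof -
  interpret XY: Module.module K "kcat_hom C x y" using obj by (intro hom_module)
  interpret YZ: Module.module K "kcat_hom C y z" using obj by (intro hom_module)
  interpret XZ: Module.module K "kcat_hom C x z" using obj by (intro hom_module)
  note sub = ideal_submodule[OF J]
  note xy = hom_module[OF obj(1,2)] sub[OF obj(1,2)]
  note yz = hom_module[OF obj(2,3)] sub[OF obj(2,3)]
  note xz = hom_module[OF obj(1,3)] sub[OF obj(1,3)]
  have eq: "J x z +>\<^bsub>kcat_hom C x z\<^esub> kcat_comp C x y z g' f' = J x z +>\<^bsub>kcat_hom C x z\<^esub> kcat_comp C x y z g f"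
    if f': "f' \<in> J x y +>\<^bsub>kcat_hom C x y\<^esub> f" and g': "g' \<in> J y z +>\<^bsub>kcat_hom C y z\<^esub> g" for f' g'
  proof -
    have c: "f' \<in> Hom C x y" "g' \<in> Hom C y z"
      using coset_closed[OF xy f f'] coset_closed[OF yz g g'] .
    have d: "f' \<ominus>\<^bsub>kcat_hom C x y\<^esub> f \<in> J x y" "g' \<ominus>\<^bsub>kcat_hom C y z\<^esub> g \<in> J y z"
      using coset_eq_iff[OF xy c(1) f] coset_eq[OF xy f f']
        coset_eq_iff[OF yz c(2) g] coset_eq[OF yz g g'] by auto
    have "kcat_comp C x y z g' f' \<ominus>\<^bsub>kcat_hom C x z\<^esub> kcat_comp C x y z g' f \<in> J x z"
      using ideal_comp_left[OF J obj d(1) c(2)]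
        linear_map_diff[OF xy(1) xz(1) comp_linear_right[OF obj c(2)] c(1) f] by simp
    moreover have "kcat_comp C x y z g' f \<ominus>\<^bsub>kcat_hom C x z\<^esub> kcat_comp C x y z g f \<in> J x z"
      using ideal_comp_right[OF J obj f d(2)]
        linear_map_diff[OF yz(1) xz(1) comp_linear_left[OF obj f] c(2) g] by simp
    ultimately show ?thesis
      using coset_eq_iff[OF xz] k_comp_closed[OF obj] f g c by metis
  qed
  show ?thesis
    using eq coset_self[OF xy f] coset_self[OF yz g]
    unfolding quotient_kcat_def kcat.simps by (intro SUP_eq_const) blast+
qed

lemma quotient_kcat_homE:
  assumes "F \<in> Hom (quotient_kcat C J) x y" "x \<in> kcat_obj C" "y \<in> kcat_obj C"
  obtains f where "f \<in> Hom C x y" "F = J x y +>\<^bsub>kcat_hom C x y\<^esub> f"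
  using assms quotient_module_carrier[OF hom_module ideal_submodule[OF J]]
  by (auto simp: quotient_kcat_simps)

lemma quotient_kcat_linear:
  assumes "x \<in> kcat_obj C" "y \<in> kcat_obj C"
  shows "linear_map K (kcat_hom C x y) (kcat_hom (quotient_kcat C J) x y) (\<lambda>f. J x y +>\<^bsub>kcat_hom C x y\<^esub> f)"
  unfolding quotient_kcat_simps
  by (rule quotient_projection_linear[OF hom_module ideal_submodule[OF J]]) (use assms in auto)

text \<open>Every element of the quotient is a coset of a representative, so linearity can be tested upstairs.\<close>

lemma linear_from_quotientI:
  assumes obj: "x \<in> kcat_obj C" "y \<in> kcat_obj C"
    and h: "linear_map K (kcat_hom C x y) N (\<lambda>f. h (J x y +>\<^bsub>kcat_hom C x y\<^esub> f))"
  shows "linear_map K (kcat_hom (quotient_kcat C J) x y) N h"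
proof -
  interpret M: Module.module K "kcat_hom C x y" using obj by (intro hom_module)
  note q = hom_module[OF obj] ideal_submodule[OF J obj]
  show ?thesis
    by (rule linear_mapI; unfold quotient_kcat_simps quotient_module_carrier[OF q])
      (auto simp: quotient_module_add[OF q] quotient_module_smult[OF q]
        linear_map_closed[OF h] linear_map_add[OF h] linear_map_smult[OF h])
qed

lemma k_category_quotient_kcat: "k_category K (quotient_kcat C J)"
proof (rule k_categoryI, unfold quotient_kcat_simps(1))
  note lin = quotient_kcat_linear
  show "kcat_id (quotient_kcat C J) x \<in> Hom (quotient_kcat C J) x x"
    if "x \<in> kcat_obj C" for x
    using linear_map_closed[OF lin k_id] that by (simp add: quotient_kcat_simps)
  show "Module.module K (kcat_hom (quotient_kcat C J) x y)" if "x \<in> kcat_obj C" "y \<in> kcat_obj C" for x y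
    using that module_quotient_module[OF hom_module ideal_submodule[OF J]]
    by (simp add: quotient_kcat_simps)
  fix x y assume xy: "x \<in> kcat_obj C" "y \<in> kcat_obj C"
  show "kcat_comp (quotient_kcat C J) x y y (kcat_id (quotient_kcat C J) y) F = F"
    "kcat_comp (quotient_kcat C J) x x y F (kcat_id (quotient_kcat C J) x) = F"
    if F: "F \<in> Hom (quotient_kcat C J) x y" for F
    using F xy k_id
    by (auto elim!: quotient_kcat_homE simp: quotient_kcat_simps(3) quotient_kcat_comp k_id_left k_id_right)
  fix z assume z: "z \<in> kcat_obj C"
  {
    fix G assume "G \<in> Hom (quotient_kcat C J) y z"
    then obtain g where g: "g \<in> Hom C y z" "G = J y z +>\<^bsub>kcat_hom C y z\<^esub> g"
      using xy z by (elim quotient_kcat_homE) auto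
    have "linear_map K (kcat_hom C x y) (kcat_hom (quotient_kcat C J) x z)
        (\<lambda>f. kcat_comp (quotient_kcat C J) x y z G (J x y +>\<^bsub>kcat_hom C x y\<^esub> f))"
      using linear_map_comp[OF comp_linear_right[OF xy z g(1)] lin[OF xy(1) z]]
      by (subst linear_map_cong[OF hom_module[OF xy]]) (use xy z g quotient_kcat_comp in auto)
    then show "linear_map K (kcat_hom (quotient_kcat C J) x y) (kcat_hom (quotient_kcat C J) x z)
        (\<lambda>F. kcat_comp (quotient_kcat C J) x y z G F)"
      by (rule linear_from_quotientI[OF xy])
  }
  {
    fix F assume "F \<in> Hom (quotient_kcat C J) x y"
    then obtain f where f: "f \<in> Hom C x y" "F = J x y +>\<^bsub>kcat_hom C x y\<^esub> f"
      using xy z by (elim quotient_kcat_homE) auto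
    have "linear_map K (kcat_hom C y z) (kcat_hom (quotient_kcat C J) x z)
        (\<lambda>g. kcat_comp (quotient_kcat C J) x y z (J y z +>\<^bsub>kcat_hom C y z\<^esub> g) F)"
      using linear_map_comp[OF comp_linear_left[OF xy z f(1)] lin[OF xy(1) z]]
      by (subst linear_map_cong[OF hom_module[OF xy(2) z]]) (use xy z f quotient_kcat_comp in auto)
    then show "linear_map K (kcat_hom (quotient_kcat C J) y z) (kcat_hom (quotient_kcat C J) x z)
        (\<lambda>G. kcat_comp (quotient_kcat C J) x y z G F)"
      by (rule linear_from_quotientI[OF xy(2) z])
  }
  fix w F G H
  assume w: "w \<in> kcat_obj C" and "F \<in> Hom (quotient_kcat C J) w x"
    "G \<in> Hom (quotient_kcat C J) x y" "H \<in> Hom (quotient_kcat C J) y z"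
  then obtain f g h where fgh: "f \<in> Hom C w x" "g \<in> Hom C x y"
      "h \<in> Hom C y z"
    and "F = J w x +>\<^bsub>kcat_hom C w x\<^esub> f" "G = J x y +>\<^bsub>kcat_hom C x y\<^esub> g" "H = J y z +>\<^bsub>kcat_hom C y z\<^esub> h"
    using xy z by (elim quotient_kcat_homE) auto
  then show "kcat_comp (quotient_kcat C J) w y z H (kcat_comp (quotient_kcat C J) w x y G F) =
      kcat_comp (quotient_kcat C J) w x z (kcat_comp (quotient_kcat C J) x y z H G) F"
    using w xy z by (simp add: quotient_kcat_comp k_comp_closed k_assoc)
qed

lemma k_functor_quotient_functor: "k_functor K C (quotient_kcat C J) (quotient_functor C J)"
  by (rule k_functorI)
    (auto simp: quotient_functor_simps quotient_kcat_simps(1,3) quotient_kcat_comp C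
      k_category_quotient_kcat quotient_kcat_linear quotient_functor_def)

lemma quotient_functor_eq_zero_iff:
  assumes "x \<in> kcat_obj C" "y \<in> kcat_obj C" "f \<in> Hom C x y"
  shows "J x y +>\<^bsub>kcat_hom C x y\<^esub> f = \<zero>\<^bsub>kcat_hom (quotient_kcat C J) x y\<^esub> \<longleftrightarrow> f \<in> J x y"
proof -
  interpret M: Module.module K "kcat_hom C x y" using assms by (intro hom_module)
  note q = hom_module[OF assms(1,2)] ideal_submodule[OF J assms(1,2)]
  have "f \<ominus>\<^bsub>kcat_hom C x y\<^esub> \<zero>\<^bsub>kcat_hom C x y\<^esub> = f"
    using assms(3) M.add.inv_one by (simp add: a_minus_def)
  then show ?thesis
    using coset_eq_iff[OF q assms(3) M.zero_closed] by (simp add: coset_zero[OF q] quotient_kcat_simps quotient_module_zero[OF q])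
qed

end

text \<open>For a functor that vanishes on the ideal the value does not depend on the representative picked.\<close>

definition quotient_lift :: "('o, 'm, 'p, 'n) functor_data \<Rightarrow> ('o, 'm set, 'p, 'n) functor_data" where
  "quotient_lift F = \<lparr>fun_obj = fun_obj F, fun_mor = (\<lambda>x y c. fun_mor F x y (SOME f. f \<in> c))\<rparr>"

context
  fixes K :: "'k ring" and C :: "('o, 'm, 'k) kcat" and J :: "'o \<Rightarrow> 'o \<Rightarrow> 'm set"
    and D :: "('p, 'n, 'k) kcat" and F
  assumes F: "k_functor K C D F" and J: "kcat_ideal K C J"
    and kill: "\<And>x y f. x \<in> kcat_obj C \<Longrightarrow> y \<in> kcat_obj C \<Longrightarrow> f \<in> J x y \<Longrightarrow>
      fun_mor F x y f = \<zero>\<^bsub>kcat_hom D (fun_obj F x) (fun_obj F y)\<^esub>"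
begin

interpretation C: k_category K C by (rule k_functor_source[OF F])
interpretation D: k_category K D by (rule k_functor_target[OF F])

lemma quotient_lift_obj: "fun_obj (quotient_lift F) = fun_obj F"
  by (simp add: quotient_lift_def)

lemma quotient_lift_mor:
  assumes obj: "x \<in> kcat_obj C" "y \<in> kcat_obj C" and f: "f \<in> Hom C x y"
  shows "fun_mor (quotient_lift F) x y (J x y +>\<^bsub>kcat_hom C x y\<^esub> f) = fun_mor F x y f"
proof -
  note q = C.hom_module[OF obj] ideal_submodule[OF J obj]
  note m = D.hom_module[OF k_functor_obj[OF F obj(1)] k_functor_obj[OF F obj(2)]]
  define f' where "f' = (SOME f'. f' \<in> J x y +>\<^bsub>kcat_hom C x y\<^esub> f)"
  have f': "f' \<in> J x y +>\<^bsub>kcat_hom C x y\<^esub> f"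
    unfolding f'_def using coset_self[OF q f] by (rule someI)
  have c: "f' \<in> Hom C x y" using coset_closed[OF q f f'] .
  have "f' \<ominus>\<^bsub>kcat_hom C x y\<^esub> f \<in> J x y" using coset_eq_iff[OF q c f] coset_eq[OF q f f'] by simp
  from kill[OF obj this] have "fun_mor F x y f' = fun_mor F x y f"
    using linear_map_diff[OF q(1) m k_functor_linear[OF F obj] c f]
      module.diff_eq_zero_iff[OF m k_functor_mor[OF F obj c] k_functor_mor[OF F obj f]] by simp
  then show ?thesis by (simp add: quotient_lift_def f'_def)
qed

lemma k_functor_quotient_lift: "k_functor K (quotient_kcat C J) D (quotient_lift F)"
proof (rule k_functorI)
  note Cc = k_functor_source[OF F]
  note s = quotient_kcat_simps(1,3)
  show "k_category K (quotient_kcat C J)" using Cc J by (rule k_category_quotient_kcat)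
  show "k_category K D" by (rule k_functor_target[OF F])
  show "fun_obj (quotient_lift F) x \<in> kcat_obj D" if "x \<in> kcat_obj (quotient_kcat C J)" for x
    using that k_functor_obj[OF F] by (simp add: quotient_lift_obj s)
  show "linear_map K (kcat_hom (quotient_kcat C J) x y)
      (kcat_hom D (fun_obj (quotient_lift F) x) (fun_obj (quotient_lift F) y)) (fun_mor (quotient_lift F) x y)"
    if "x \<in> kcat_obj (quotient_kcat C J)" "y \<in> kcat_obj (quotient_kcat C J)" for x y
  proof (rule linear_from_quotientI[OF Cc J])
    show xy: "x \<in> kcat_obj C" "y \<in> kcat_obj C" using that by (simp_all add: s)
    show "linear_map K (kcat_hom C x y) (kcat_hom D (fun_obj (quotient_lift F) x) (fun_obj (quotient_lift F) y))
        (\<lambda>f. fun_mor (quotient_lift F) x y (J x y +>\<^bsub>kcat_hom C x y\<^esub> f))"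
      using k_functor_linear[OF F xy]
      by (subst linear_map_cong[OF C.hom_module[OF xy] quotient_lift_mor[OF xy]]) (auto simp: quotient_lift_obj)
  qed
  show "fun_mor (quotient_lift F) x x (kcat_id (quotient_kcat C J) x) = kcat_id D (fun_obj (quotient_lift F) x)"
    if "x \<in> kcat_obj (quotient_kcat C J)" for x
    using that quotient_lift_mor[OF _ _ C.k_id] k_functor_id[OF F] by (simp add: quotient_lift_obj s)
  fix x y z f g
  assume obj: "x \<in> kcat_obj (quotient_kcat C J)" "y \<in> kcat_obj (quotient_kcat C J)" "z \<in> kcat_obj (quotient_kcat C J)"
    and "f \<in> Hom (quotient_kcat C J) x y" "g \<in> Hom (quotient_kcat C J) y z"
  then show "fun_mor (quotient_lift F) x z (kcat_comp (quotient_kcat C J) x y z g f) =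
      kcat_comp D (fun_obj (quotient_lift F) x) (fun_obj (quotient_lift F) y) (fun_obj (quotient_lift F) z)
        (fun_mor (quotient_lift F) y z g) (fun_mor (quotient_lift F) x y f)"
    by (auto elim!: quotient_kcat_homE[OF Cc J] simp: s quotient_lift_obj quotient_kcat_comp[OF Cc J]
        quotient_lift_mor C.k_comp_closed k_functor_comp[OF F])
qed

end

lemma kcat_idealI:
  assumes C: "k_category K C"
    and sub: "\<And>x y. x \<in> kcat_obj C \<Longrightarrow> y \<in> kcat_obj C \<Longrightarrow> J x y \<subseteq> Hom C x y"
    and zero: "\<And>x y. x \<in> kcat_obj C \<Longrightarrow> y \<in> kcat_obj C \<Longrightarrow> \<zero>\<^bsub>kcat_hom C x y\<^esub> \<in> J x y"
    and add: "\<And>x y f g. x \<in> kcat_obj C \<Longrightarrow> y \<in> kcat_obj C \<Longrightarrow> f \<in> J x y \<Longrightarrow> g \<in> J x y \<Longrightarrow>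
      f \<oplus>\<^bsub>kcat_hom C x y\<^esub> g \<in> J x y"
    and smult: "\<And>x y c f. x \<in> kcat_obj C \<Longrightarrow> y \<in> kcat_obj C \<Longrightarrow> c \<in> carrier K \<Longrightarrow> f \<in> J x y \<Longrightarrow>
      c \<odot>\<^bsub>kcat_hom C x y\<^esub> f \<in> J x y"
    and left: "\<And>x y z f g. x \<in> kcat_obj C \<Longrightarrow> y \<in> kcat_obj C \<Longrightarrow> z \<in> kcat_obj C \<Longrightarrow> f \<in> J x y \<Longrightarrow>
      g \<in> Hom C y z \<Longrightarrow> kcat_comp C x y z g f \<in> J x z"
    and right: "\<And>x y z f g. x \<in> kcat_obj C \<Longrightarrow> y \<in> kcat_obj C \<Longrightarrow> z \<in> kcat_obj C \<Longrightarrow>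
      f \<in> Hom C x y \<Longrightarrow> g \<in> J y z \<Longrightarrow> kcat_comp C x y z g f \<in> J x z"
  shows "kcat_ideal K C J"
proof -
  have "submodule (J x y) K (kcat_hom C x y)" if xy: "x \<in> kcat_obj C" "y \<in> kcat_obj C" for x y
  proof -
    interpret M: Module.module K "kcat_hom C x y" using C xy by (rule k_category.hom_module)
    have "\<ominus>\<^bsub>kcat_hom C x y\<^esub> f \<in> J x y" if f: "f \<in> J x y" for f
    proof -
      have "f \<in> Hom C x y" using sub xy f by blast
      then have "(\<ominus>\<^bsub>K\<^esub> \<one>\<^bsub>K\<^esub>) \<odot>\<^bsub>kcat_hom C x y\<^esub> f = \<ominus>\<^bsub>kcat_hom C x y\<^esub> f"
        by (simp add: M.smult_l_minus)
      then show ?thesis using smult[OF xy _ f, of "\<ominus>\<^bsub>K\<^esub> \<one>\<^bsub>K\<^esub>"] by simp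
    qed
    then show ?thesis
      using sub[OF xy] zero[OF xy] add[OF xy] smult[OF xy] by (intro M.submoduleI) auto
  qed
  then show ?thesis using left right by (auto simp: kcat_ideal_def)
qed

lemma kcat_ideal_closed:
  assumes "k_category K C" "kcat_ideal K C J" "x \<in> kcat_obj C" "y \<in> kcat_obj C"
  shows "J x y \<subseteq> Hom C x y" "\<zero>\<^bsub>kcat_hom C x y\<^esub> \<in> J x y"
    "f \<in> J x y \<Longrightarrow> g \<in> J x y \<Longrightarrow> f \<oplus>\<^bsub>kcat_hom C x y\<^esub> g \<in> J x y"
    "c \<in> carrier K \<Longrightarrow> f \<in> J x y \<Longrightarrow> c \<odot>\<^bsub>kcat_hom C x y\<^esub> f \<in> J x y"
proof -
  interpret M: Module.module K "kcat_hom C x y" using assms by (intro k_category.hom_module)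
  note s = ideal_submodule[OF assms(2-4)]
  show "J x y \<subseteq> Hom C x y" "f \<in> J x y \<Longrightarrow> g \<in> J x y \<Longrightarrow> f \<oplus>\<^bsub>kcat_hom C x y\<^esub> g \<in> J x y"
    "c \<in> carrier K \<Longrightarrow> f \<in> J x y \<Longrightarrow> c \<odot>\<^bsub>kcat_hom C x y\<^esub> f \<in> J x y"
    using M.submoduleE[OF s] by auto
  have "subgroup (J x y) (add_monoid (kcat_hom C x y))" using s by (simp add: submodule_def)
  from subgroup.one_closed[OF this] show "\<zero>\<^bsub>kcat_hom C x y\<^esub> \<in> J x y" by simp
qed

lemma kcat_ideal_full:
  assumes C: "k_category K C"
  shows "kcat_ideal K C (\<lambda>x y. Hom C x y)"
proof -
  interpret k_category K C by fact
  show ?thesis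
    by (rule kcat_idealI[OF C])
      (auto intro: k_comp_closed abelian_groupE Module.module.smult_closed[OF hom_module]
        Module.module.axioms(2)[OF hom_module])
qed

lemma ideal_generated_iff:
  "f \<in> ideal_generated K C S x y \<longleftrightarrow> (\<forall>J. kcat_ideal K C J \<and>
    (\<forall>u\<in>kcat_obj C. \<forall>v\<in>kcat_obj C. S \<inter> Hom C u v \<subseteq> J u v) \<longrightarrow> f \<in> J x y)"
  unfolding ideal_generated_def by blast

lemma ideal_generated_least:
  assumes "kcat_ideal K C J" "\<And>u v. u \<in> kcat_obj C \<Longrightarrow> v \<in> kcat_obj C \<Longrightarrow> S \<inter> Hom C u v \<subseteq> J u v"
  shows "ideal_generated K C S x y \<subseteq> J x y"
  using assms by (auto simp: ideal_generated_iff)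

lemma ideal_generated_superset:
  assumes "x \<in> kcat_obj C" "y \<in> kcat_obj C" "f \<in> S" "f \<in> Hom C x y"
  shows "f \<in> ideal_generated K C S x y"
  using assms by (auto simp: ideal_generated_iff)

lemma kcat_ideal_ideal_generated:
  assumes C: "k_category K C"
  shows "kcat_ideal K C (ideal_generated K C S)"
proof (rule kcat_idealI[OF C])
  fix x y assume xy: "x \<in> kcat_obj C" "y \<in> kcat_obj C"
  show "ideal_generated K C S x y \<subseteq> Hom C x y"
    by (rule ideal_generated_least[OF kcat_ideal_full[OF C]]) auto
  note c = kcat_ideal_closed[OF C _ xy]
  show "\<zero>\<^bsub>kcat_hom C x y\<^esub> \<in> ideal_generated K C S x y"
    using c(2) by (auto simp: ideal_generated_iff)
  show "f \<oplus>\<^bsub>kcat_hom C x y\<^esub> g \<in> ideal_generated K C S x y"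
    if "f \<in> ideal_generated K C S x y" "g \<in> ideal_generated K C S x y" for f g
    using that c(3) by (auto simp: ideal_generated_iff)
  show "k \<odot>\<^bsub>kcat_hom C x y\<^esub> f \<in> ideal_generated K C S x y"
    if "k \<in> carrier K" "f \<in> ideal_generated K C S x y" for k f
    using that c(4) by (auto simp: ideal_generated_iff)
  fix z assume z: "z \<in> kcat_obj C"
  show "kcat_comp C x y z g f \<in> ideal_generated K C S x z"
    if "f \<in> ideal_generated K C S x y" "g \<in> Hom C y z" for f g
    using that ideal_comp_left[OF _ xy z] by (auto simp: ideal_generated_iff)
  show "kcat_comp C x y z g f \<in> ideal_generated K C S x z"
    if "f \<in> Hom C x y" "g \<in> ideal_generated K C S y z" for f g
    using that ideal_comp_right[OF _ xy z] by (auto simp: ideal_generated_iff)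
qed

lemma kcat_ideal_kernel:
  assumes F: "k_functor K C D F"
  shows "kcat_ideal K C (\<lambda>x y. {f \<in> Hom C x y.
    fun_mor F x y f = \<zero>\<^bsub>kcat_hom D (fun_obj F x) (fun_obj F y)\<^esub>})"
proof -
  interpret C: k_category K C by (rule k_functor_source[OF F])
  interpret D: k_category K D by (rule k_functor_target[OF F])
  note o = k_functor_obj[OF F]
  let ?J = "\<lambda>x y. {f \<in> Hom C x y.
    fun_mor F x y f = \<zero>\<^bsub>kcat_hom D (fun_obj F x) (fun_obj F y)\<^esub>}"
  show ?thesis
  proof (rule kcat_idealI[OF k_functor_source[OF F]])
    fix x y assume xy: "x \<in> kcat_obj C" "y \<in> kcat_obj C"
    interpret CM: Module.module K "kcat_hom C x y" using xy by (rule C.hom_module)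
    interpret DM: Module.module K "kcat_hom D (fun_obj F x) (fun_obj F y)" using xy o by (intro D.hom_module)
    note l = k_functor_linear[OF F xy]
    show "\<zero>\<^bsub>kcat_hom C x y\<^esub> \<in> ?J x y"
      using k_functor_zero[OF F xy] by simp
    show "f \<oplus>\<^bsub>kcat_hom C x y\<^esub> g \<in> ?J x y"
      if "f \<in> ?J x y"
        "g \<in> ?J x y" for f g
      using that linear_map_add[OF l] by auto
    show "c \<odot>\<^bsub>kcat_hom C x y\<^esub> f \<in> ?J x y"
      if "c \<in> carrier K"
        "f \<in> ?J x y" for c f
      using that linear_map_smult[OF l] by auto
    fix z assume z: "z \<in> kcat_obj C"
    note fxyz = o[OF xy(1)] o[OF xy(2)] o[OF z]
    show "kcat_comp C x y z g f \<in> ?J x z"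
      if f: "f \<in> ?J x y"
        and g: "g \<in> Hom C y z" for f g
    proof -
      note gm = k_functor_mor[OF F xy(2) z g]
      have "kcat_comp D (fun_obj F x) (fun_obj F y) (fun_obj F z) (fun_mor F y z g)
          \<zero>\<^bsub>kcat_hom D (fun_obj F x) (fun_obj F y)\<^esub> = \<zero>\<^bsub>kcat_hom D (fun_obj F x) (fun_obj F z)\<^esub>"
        by (rule linear_map_zero[OF _ _ D.comp_linear_right[OF fxyz gm]]) (intro D.hom_module fxyz)+
      then show ?thesis
        using f g xy z by (auto simp: C.k_comp_closed k_functor_comp[OF F])
    qed
    show "kcat_comp C x y z g f \<in> ?J x z"
      if f: "f \<in> Hom C x y"
        and g: "g \<in> ?J y z" for f g
    proof -
      note fm = k_functor_mor[OF F xy f]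
      have "kcat_comp D (fun_obj F x) (fun_obj F y) (fun_obj F z)
          \<zero>\<^bsub>kcat_hom D (fun_obj F y) (fun_obj F z)\<^esub> (fun_mor F x y f) = \<zero>\<^bsub>kcat_hom D (fun_obj F x) (fun_obj F z)\<^esub>"
        by (rule linear_map_zero[OF _ _ D.comp_linear_left[OF fxyz fm]]) (intro D.hom_module fxyz)+
      then show ?thesis
        using f g xy z by (auto simp: C.k_comp_closed k_functor_comp[OF F])
    qed
  qed auto
qed

text \<open>The kernel of a functor is an ideal, and it contains the generators.\<close>

lemma ideal_generated_killed:
  assumes F: "k_functor K C D F"
    and S: "\<And>x y f. x \<in> kcat_obj C \<Longrightarrow> y \<in> kcat_obj C \<Longrightarrow> f \<in> S \<Longrightarrow> f \<in> Hom C x y \<Longrightarrow>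
      fun_mor F x y f = \<zero>\<^bsub>kcat_hom D (fun_obj F x) (fun_obj F y)\<^esub>"
    and f: "f \<in> ideal_generated K C S x y"
  shows "fun_mor F x y f = \<zero>\<^bsub>kcat_hom D (fun_obj F x) (fun_obj F y)\<^esub>"
  using ideal_generated_least[OF kcat_ideal_kernel[OF F], of S x y] S f by auto

section \<open>Linearizations\<close>

lemma basis_vector_single: "basis_vector K a = single (\<lambda>_. regular_module K) a \<one>\<^bsub>K\<^esub>"
  by (simp add: basis_vector_def single_def fun_eq_iff)

lemma module_free_module: "cring K \<Longrightarrow> Module.module K (free_module K A)"
  unfolding free_module_def by (rule module_direct_sum) (auto intro: module_regular_module)

lemma basis_vector_closed: "cring K \<Longrightarrow> a \<in> A \<Longrightarrow> basis_vector K a \<in> carrier (free_module K A)"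
  unfolding free_module_def basis_vector_single
  by (rule single_closed) (auto intro: module_regular_module simp: cring.cring_simprules)

lemma single_eq_smult_basis:
  assumes "cring K" "a \<in> A" "c \<in> carrier K"
  shows "single (\<lambda>_. regular_module K) a c = c \<odot>\<^bsub>free_module K A\<^esub> basis_vector K a"
proof -
  interpret cring K by fact
  show ?thesis
    using assms by (auto simp: single_def free_module_def direct_sum_simps basis_vector_def fun_eq_iff)
qed

lemma linear_map_free_ext:
  assumes K: "cring K" and N: "Module.module K N"
    and h: "linear_map K (free_module K A) N h" and h': "linear_map K (free_module K A) N h'"
    and eq: "\<And>a. a \<in> A \<Longrightarrow> h (basis_vector K a) = h' (basis_vector K a)"
    and f: "f \<in> carrier (free_module K A)"
  shows "h f = h' f"
proof (rule linear_map_direct_sum_ext[where K = K and A = A and M = "\<lambda>_. regular_module K" and N = N])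
  fix a c assume "a \<in> A" "c \<in> carrier (regular_module K)"
  then show "h (single (\<lambda>_. regular_module K) a c) = h' (single (\<lambda>_. regular_module K) a c)"
    using K eq[of a] basis_vector_closed[of K a A]
    by (simp add: single_eq_smult_basis linear_map_smult[OF h] linear_map_smult[OF h'])
qed (use assms module_regular_module in \<open>auto simp: free_module_def\<close>)

lemma linearization_simps:
  "kcat_obj (linearization K C) = cat_obj C"
  "kcat_hom (linearization K C) x y = free_module K (cat_hom C x y)"
  "kcat_id (linearization K C) x = basis_vector K (cat_id C x)"
  by (simp_all add: linearization_def)

lemma linearization_comp:
  "kcat_comp (linearization K C) x y z =
    graded_product (cat_hom C x y) (\<lambda>_. regular_module K) (cat_hom C y z) (\<lambda>_. regular_module K)
      (cat_hom C x z) (\<lambda>_. regular_module K) (\<lambda>b a. cat_comp C x y z b a) (\<lambda>a b n m. n \<otimes>\<^bsub>K\<^esub> m)"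
  by (simp add: linearization_def graded_product_def finsum_regular_module fun_eq_iff)

lemma linear_map_ident: "linear_map K M M (\<lambda>f. f)"
  by (simp add: linear_map_def)

context
  fixes K :: "'k ring" and C :: "('o, 'm) cat"
  assumes K: "cring K" and C: "category C"
begin

interpretation K: cring K by (rule K)
interpretation category C by (rule C)

lemma graded_pairing_linearization:
  assumes "x \<in> cat_obj C" "y \<in> cat_obj C" "z \<in> cat_obj C"
  shows "graded_pairing K (cat_hom C x y) (\<lambda>_. regular_module K) (cat_hom C y z) (\<lambda>_. regular_module K)
      (cat_hom C x z) (\<lambda>_. regular_module K) (\<lambda>b a. cat_comp C x y z b a) (\<lambda>a b n m. n \<otimes>\<^bsub>K\<^esub> m)"
proof (rule graded_pairing.intro)
  show "linear_map K (regular_module K) (regular_module K) (\<lambda>m. n \<otimes>\<^bsub>K\<^esub> m)"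
    if "n \<in> carrier (regular_module K)" for n
    using that by (intro linear_mapI) (simp_all add: K.r_distr K.m_lcomm)
  show "linear_map K (regular_module K) (regular_module K) (\<lambda>n. n \<otimes>\<^bsub>K\<^esub> m)"
    if "m \<in> carrier (regular_module K)" for m
    using that by (intro linear_mapI) (simp_all add: K.l_distr K.m_assoc)
qed (use assms K module_regular_module comp_hom in auto)

lemma linearization_comp_basis:
  assumes "x \<in> cat_obj C" "y \<in> cat_obj C" "z \<in> cat_obj C" "a \<in> cat_hom C x y" "b \<in> cat_hom C y z"
  shows "kcat_comp (linearization K C) x y z (basis_vector K b) (basis_vector K a) =
    basis_vector K (cat_comp C x y z b a)"
  unfolding linearization_comp basis_vector_single
  by (subst graded_pairing.graded_product_single[OF graded_pairing_linearization])
    (use assms in auto)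

lemma linearization_comp_linear:
  assumes "x \<in> cat_obj C" "y \<in> cat_obj C" "z \<in> cat_obj C"
  shows "g \<in> carrier (free_module K (cat_hom C y z)) \<Longrightarrow>
      linear_map K (free_module K (cat_hom C x y)) (free_module K (cat_hom C x z))
        (\<lambda>f. kcat_comp (linearization K C) x y z g f)"
    and "f \<in> carrier (free_module K (cat_hom C x y)) \<Longrightarrow>
      linear_map K (free_module K (cat_hom C y z)) (free_module K (cat_hom C x z))
        (\<lambda>g. kcat_comp (linearization K C) x y z g f)"
  using graded_pairing.graded_product_linear_right[OF graded_pairing_linearization[OF assms]]
    graded_pairing.graded_product_linear_left[OF graded_pairing_linearization[OF assms]]
  unfolding linearization_comp free_module_def by blast+

text \<open>The category laws are multilinear, and on basis vectors they are those of \<open>C\<close>.\<close>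

lemma k_category_linearization: "k_category K (linearization K C)"
proof (rule k_categoryI, unfold linearization_simps)
  note lin = linearization_comp_linear
  note b = linearization_comp_basis
  note M = module_free_module[OF K]
  note bc = basis_vector_closed[OF K]
  note ext = linear_map_free_ext[OF K M]
  show "basis_vector K (cat_id C x) \<in> carrier (free_module K (cat_hom C x x))" if "x \<in> cat_obj C" for x
    using that by (intro bc id_hom)
  show "Module.module K (free_module K (cat_hom C x y))" for x y by (rule M)
  fix x y assume xy: "x \<in> cat_obj C" "y \<in> cat_obj C"
  show "kcat_comp (linearization K C) x y y (basis_vector K (cat_id C y)) f = f"
    if "f \<in> carrier (free_module K (cat_hom C x y))" for f
    by (rule ext[OF lin(1) linear_map_ident _ that])
      (use xy in \<open>auto simp: b id_hom comp_id_left intro!: bc\<close>)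
  show "kcat_comp (linearization K C) x x y f (basis_vector K (cat_id C x)) = f"
    if "f \<in> carrier (free_module K (cat_hom C x y))" for f
    by (rule ext[OF lin(2) linear_map_ident _ that])
      (use xy in \<open>auto simp: b id_hom comp_id_right intro!: bc\<close>)
  fix z assume z: "z \<in> cat_obj C"
  show "linear_map K (free_module K (cat_hom C x y)) (free_module K (cat_hom C x z))
      (\<lambda>f. kcat_comp (linearization K C) x y z g f)"
    if "g \<in> carrier (free_module K (cat_hom C y z))" for g
    using xy z that by (rule lin)
  show "linear_map K (free_module K (cat_hom C y z)) (free_module K (cat_hom C x z))
      (\<lambda>g. kcat_comp (linearization K C) x y z g f)"
    if "f \<in> carrier (free_module K (cat_hom C x y))" for f
    using xy z that by (rule lin)
  fix w f g h
  assume w: "w \<in> cat_obj C" and f: "f \<in> carrier (free_module K (cat_hom C w x))"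
    and g: "g \<in> carrier (free_module K (cat_hom C x y))"
    and h: "h \<in> carrier (free_module K (cat_hom C y z))"
  let ?c = "kcat_comp (linearization K C)"
  note cl = linear_map_closed[OF lin(1)]
  have bbb: "?c w y z (basis_vector K c) (?c w x y (basis_vector K b) (basis_vector K a)) =
      ?c w x z (?c x y z (basis_vector K c) (basis_vector K b)) (basis_vector K a)"
    if "a \<in> cat_hom C w x" "b \<in> cat_hom C x y" "c \<in> cat_hom C y z" for a b c
    using that w xy z by (simp add: b comp_hom comp_assoc)
  have bb: "?c w y z (basis_vector K c) (?c w x y (basis_vector K b) f) =
      ?c w x z (?c x y z (basis_vector K c) (basis_vector K b)) f"
    if "b \<in> cat_hom C x y" "c \<in> cat_hom C y z" for b c
    by (rule ext[OF linear_map_comp[OF lin(1) lin(1)] lin(1) bbb f])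
      (use that w xy z in \<open>auto intro!: cl bc\<close>)
  have b: "?c w y z (basis_vector K c) (?c w x y g f) = ?c w x z (?c x y z (basis_vector K c) g) f"
    if "c \<in> cat_hom C y z" for c
    by (rule ext[OF linear_map_comp[OF lin(2) lin(1)] linear_map_comp[OF lin(1) lin(2)] bb g])
      (use that w xy z f in \<open>auto intro!: cl bc\<close>)
  show "?c w y z h (?c w x y g f) = ?c w x z (?c x y z h g) f"
    by (rule ext[OF lin(2) linear_map_comp[OF lin(2) lin(2)] b h])
      (use w xy z f g in \<open>auto intro!: cl bc\<close>)
qed

end

text \<open>The functor \<^const>\<open>sigma\<close> is the instance for the inclusion of the paths of a fibre.\<close>

definition linear_extension ::
  "'k ring \<Rightarrow> ('o, 'm) cat \<Rightarrow> ('p, 'n, 'k) kcat \<Rightarrow> ('o \<Rightarrow> 'p) \<Rightarrow> ('o \<Rightarrow> 'o \<Rightarrow> 'm \<Rightarrow> 'n) \<Rightarrow>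
    ('o, 'm \<Rightarrow> 'k, 'p, 'n) functor_data" where
  "linear_extension K C D fo fm = \<lparr>fun_obj = fo, fun_mor = (\<lambda>x y f.
     finsum (kcat_hom D (fo x) (fo y)) (\<lambda>p. f p \<odot>\<^bsub>kcat_hom D (fo x) (fo y)\<^esub> fm x y p)
       {p \<in> cat_hom C x y. f p \<noteq> \<zero>\<^bsub>K\<^esub>})\<rparr>"

context
  fixes K :: "'k ring" and C :: "('o, 'm) cat" and D :: "('p, 'n, 'k) kcat" and fo fm
  assumes K: "cring K" and C: "category C" and D: "k_category K D"
    and fo: "\<And>x. x \<in> cat_obj C \<Longrightarrow> fo x \<in> kcat_obj D"
    and fm: "\<And>x y p. x \<in> cat_obj C \<Longrightarrow> y \<in> cat_obj C \<Longrightarrow> p \<in> cat_hom C x y \<Longrightarrow>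
      fm x y p \<in> Hom D (fo x) (fo y)"
begin

interpretation K: cring K by (rule K)
interpretation C: category C by (rule C)
interpretation D: k_category K D by (rule D)

lemma linear_extension_lift:
  "fun_mor (linear_extension K C D fo fm) x y =
    direct_sum_lift (kcat_hom D (fo x) (fo y)) (cat_hom C x y) (\<lambda>_. regular_module K)
      (\<lambda>p c. c \<odot>\<^bsub>kcat_hom D (fo x) (fo y)\<^esub> fm x y p)"
  by (simp add: linear_extension_def direct_sum_lift_def fun_eq_iff)

lemma linear_extension_summand:
  assumes "x \<in> cat_obj C" "y \<in> cat_obj C" "p \<in> cat_hom C x y"
  shows "linear_map K (regular_module K) (kcat_hom D (fo x) (fo y))
    (\<lambda>c. c \<odot>\<^bsub>kcat_hom D (fo x) (fo y)\<^esub> fm x y p)"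
proof -
  interpret M: Module.module K "kcat_hom D (fo x) (fo y)" using assms by (intro D.hom_module fo)
  show ?thesis
    using fm[OF assms] by (auto simp: linear_map_def M.smult_l_distr M.smult_assoc1)
qed

lemma linear_extension_linear:
  assumes "x \<in> cat_obj C" "y \<in> cat_obj C"
  shows "linear_map K (free_module K (cat_hom C x y)) (kcat_hom D (fo x) (fo y))
    (fun_mor (linear_extension K C D fo fm) x y)"
  unfolding linear_extension_lift free_module_def
  by (rule direct_sum_lift_linear)
    (use assms linear_extension_summand in \<open>auto intro: module_regular_module K D.hom_module fo\<close>)

lemma linear_extension_basis:
  assumes "x \<in> cat_obj C" "y \<in> cat_obj C" "p \<in> cat_hom C x y"
  shows "fun_mor (linear_extension K C D fo fm) x y (basis_vector K p) = fm x y p"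
proof -
  interpret M: Module.module K "kcat_hom D (fo x) (fo y)" using assms by (intro D.hom_module fo)
  show ?thesis
    unfolding linear_extension_lift basis_vector_single
    by (subst direct_sum_lift_single)
      (use assms linear_extension_summand fm in \<open>auto intro: module_regular_module K M.module_axioms\<close>)
qed

lemma linear_extension_obj: "fun_obj (linear_extension K C D fo fm) = fo"
  by (simp add: linear_extension_def)

text \<open>Both sides of the multiplicativity law are bilinear, and on basis vectors it is the assumption.\<close>

lemma k_functor_linear_extension:
  assumes id: "\<And>x. x \<in> cat_obj C \<Longrightarrow> fm x x (cat_id C x) = kcat_id D (fo x)"
    and comp: "\<And>x y z p q. x \<in> cat_obj C \<Longrightarrow> y \<in> cat_obj C \<Longrightarrow> z \<in> cat_obj C \<Longrightarrow>
      p \<in> cat_hom C x y \<Longrightarrow> q \<in> cat_hom C y z \<Longrightarrow>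
      fm x z (cat_comp C x y z q p) = kcat_comp D (fo x) (fo y) (fo z) (fm y z q) (fm x y p)"
  shows "k_functor K (linearization K C) D (linear_extension K C D fo fm)"
proof (rule k_functorI, unfold linearization_simps linear_extension_obj)
  let ?F = "linear_extension K C D fo fm"
  note lin = linear_extension_linear
  note bc = basis_vector_closed[OF K]
  show "k_category K (linearization K C)" by (rule k_category_linearization[OF K C])
  show "k_category K D" by (rule D)
  show "fo x \<in> kcat_obj D" if "x \<in> cat_obj C" for x using that by (rule fo)
  show "fun_mor ?F x x (basis_vector K (cat_id C x)) = kcat_id D (fo x)" if "x \<in> cat_obj C" for x
    using that by (simp add: linear_extension_basis C.id_hom id)
  fix x y assume xy: "x \<in> cat_obj C" "y \<in> cat_obj C"
  show "linear_map K (free_module K (cat_hom C x y)) (kcat_hom D (fo x) (fo y)) (fun_mor ?F x y)"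
    using xy by (rule lin)
  fix z f g assume z: "z \<in> cat_obj C"
    and f: "f \<in> carrier (free_module K (cat_hom C x y))"
    and g: "g \<in> carrier (free_module K (cat_hom C y z))"
  let ?c = "kcat_comp (linearization K C) x y z"
  let ?d = "kcat_comp D (fo x) (fo y) (fo z)"
  note ext = linear_map_free_ext[OF K D.hom_module[OF fo[OF xy(1)] fo[OF z]]]
  note cl = linear_map_closed[OF lin]
  note lc = linearization_comp_linear[OF K C xy z]
  note lr = D.comp_linear_right[OF fo[OF xy(1)] fo[OF xy(2)] fo[OF z]]
  note ll = D.comp_linear_left[OF fo[OF xy(1)] fo[OF xy(2)] fo[OF z]]
  have bb: "fun_mor ?F x z (?c (basis_vector K q) (basis_vector K p)) =
      ?d (fun_mor ?F y z (basis_vector K q)) (fun_mor ?F x y (basis_vector K p))"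
    if "p \<in> cat_hom C x y" "q \<in> cat_hom C y z" for p q
    using that xy z by (simp add: linearization_comp_basis[OF K C] linear_extension_basis C.comp_hom comp)
  have b: "fun_mor ?F x z (?c (basis_vector K q) f) =
      ?d (fun_mor ?F y z (basis_vector K q)) (fun_mor ?F x y f)"
    if "q \<in> cat_hom C y z" for q
    by (rule ext[OF linear_map_comp[OF lc(1) lin] linear_map_comp[OF lin lr] bb f])
      (use that xy z in \<open>auto intro!: bc cl\<close>)
  show "fun_mor ?F x z (?c g f) = ?d (fun_mor ?F y z g) (fun_mor ?F x y f)"
    by (rule ext[OF linear_map_comp[OF lc(2) lin] linear_map_comp[OF lin ll] b g])
      (use xy z f in \<open>auto intro!: bc cl\<close>)
qed

end


section \<open>Path categories and presented categories\<close>

lemma path_category_simps: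
  "cat_obj (path_category Q) = verts Q"
  "p \<in> cat_hom (path_category Q) u v \<longleftrightarrow> (\<exists>es. p = (u, es) \<and> pre_digraph.awalk Q u es v)"
  "cat_id (path_category Q) u = (u, [])"
  "cat_comp (path_category Q) u v w q p = (fst p, snd p @ snd q)"
  by (auto simp: path_category_def)

lemma category_path_category:
  assumes "wf_digraph Q"
  shows "category (path_category Q)"
proof -
  interpret wf_digraph Q by fact
  show ?thesis
    by unfold_locales (auto simp: path_category_simps awalk_Nil_iff dest: awalk_appendI)
qed

abbreviation "arrow_mor K Q e \<equiv> path_morphism K (arrow_path Q e)"

lemma path_kcategory_simps:
  "kcat_obj (path_kcategory K Q) = verts Q"
  "kcat_hom (path_kcategory K Q) u v = free_module K (cat_hom (path_category Q) u v)"
  "kcat_id (path_kcategory K Q) u = path_morphism K (u, [])"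
  by (simp_all add: path_kcategory_def linearization_simps path_category_simps path_morphism_def)

lemma k_category_path_kcategory:
  "cring K \<Longrightarrow> wf_digraph Q \<Longrightarrow> k_category K (path_kcategory K Q)"
  unfolding path_kcategory_def by (intro k_category_linearization category_path_category)

lemma path_morphism_closed:
  "cring K \<Longrightarrow> pre_digraph.awalk Q u es v \<Longrightarrow>
    path_morphism K (u, es) \<in> Hom (path_kcategory K Q) u v"
  unfolding path_kcategory_simps path_morphism_def
  by (rule basis_vector_closed) (auto simp: path_category_simps)

lemma path_morphism_comp:
  assumes "cring K" "wf_digraph Q" "pre_digraph.awalk Q u p v" "pre_digraph.awalk Q v q w"
  shows "kcat_comp (path_kcategory K Q) u v w (path_morphism K (v, q)) (path_morphism K (u, p)) =
    path_morphism K (u, p @ q)"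
proof -
  interpret wf_digraph Q by fact
  have "u \<in> verts Q" "v \<in> verts Q" "w \<in> verts Q" using assms(3,4) by auto
  then show ?thesis
    using linearization_comp_basis[OF assms(1) category_path_category[OF assms(2)], of u v w "(u, p)" "(v, q)"] assms
    by (simp add: path_kcategory_def path_morphism_def path_category_simps)
qed

lemma arrow_path_closed:
  assumes "cring K" "wf_digraph Q" "e \<in> arcs Q"
  shows "arrow_mor K Q e \<in> Hom (path_kcategory K Q) (tail Q e) (head Q e)"
proof -
  interpret wf_digraph Q by fact
  show ?thesis
    unfolding arrow_path_def using assms arc_implies_awalk by (intro path_morphism_closed)
qed

primrec path_value ::
  "('p, 'n, 'k) kcat \<Rightarrow> ('v, 'e) pre_digraph \<Rightarrow> ('v \<Rightarrow> 'p) \<Rightarrow> ('e \<Rightarrow> 'n) \<Rightarrow> 'e list \<Rightarrow> 'v \<Rightarrow> 'n" where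
  "path_value D Q fo fe [] v = kcat_id D (fo v)"
| "path_value D Q fo fe (e # es) v =
    kcat_comp D (fo (tail Q e)) (fo (head Q e)) (fo v) (path_value D Q fo fe es v) (fe e)"

definition path_functor ::
  "'k ring \<Rightarrow> ('v, 'e) pre_digraph \<Rightarrow> ('p, 'n, 'k) kcat \<Rightarrow> ('v \<Rightarrow> 'p) \<Rightarrow> ('e \<Rightarrow> 'n) \<Rightarrow>
    ('v, ('v, 'e) path \<Rightarrow> 'k, 'p, 'n) functor_data" where
  "path_functor K Q D fo fe =
    linear_extension K (path_category Q) D fo (\<lambda>u v p. path_value D Q fo fe (snd p) v)"

context
  fixes K :: "'k ring" and Q :: "('v, 'e) pre_digraph" and D :: "('p, 'n, 'k) kcat" and fo fe
  assumes K: "cring K" and Q: "wf_digraph Q" and D: "k_category K D"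
    and fo: "\<And>u. u \<in> verts Q \<Longrightarrow> fo u \<in> kcat_obj D"
    and fe: "\<And>e. e \<in> arcs Q \<Longrightarrow> fe e \<in> Hom D (fo (tail Q e)) (fo (head Q e))"
begin

interpretation Q: wf_digraph Q by (rule Q)
interpretation D: k_category K D by (rule D)

lemma path_value_closed:
  "Q.awalk u es v \<Longrightarrow> path_value D Q fo fe es v \<in> Hom D (fo u) (fo v)"
proof (induction es arbitrary: u)
  case Nil
  then show ?case by (auto simp: Q.awalk_Nil_iff intro: D.k_id fo)
next
  case (Cons e es)
  then have "e \<in> arcs Q" "u = tail Q e" "Q.awalk (head Q e) es v" by (auto simp: Q.awalk_Cons_iff)
  then show ?case
    using Cons.IH fe Q.awalk_last_in_verts by (auto intro!: D.k_comp_closed fo)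
qed

lemma path_value_append:
  "Q.awalk u p v \<Longrightarrow> Q.awalk v q w \<Longrightarrow> path_value D Q fo fe (p @ q) w =
    kcat_comp D (fo u) (fo v) (fo w) (path_value D Q fo fe q w) (path_value D Q fo fe p v)"
proof (induction p arbitrary: u)
  case Nil
  then have "u = v" "v \<in> verts Q" "w \<in> verts Q" by (auto simp: Q.awalk_Nil_iff)
  then show ?case
    using path_value_closed[OF Nil.prems(2)] by (auto simp: D.k_id_right fo)
next
  case (Cons e es)
  then have e: "e \<in> arcs Q" "u = tail Q e" "Q.awalk (head Q e) es v" by (auto simp: Q.awalk_Cons_iff)
  have v: "v \<in> verts Q" "w \<in> verts Q" using Cons.prems by auto
  show ?case
    using e v Cons.IH[OF e(3) Cons.prems(2)] path_value_closed[OF e(3)] path_value_closed[OF Cons.prems(2)] fe[OF e(1)]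
    by (simp add: D.k_assoc fo)
qed

lemma k_functor_path_functor: "k_functor K (path_kcategory K Q) D (path_functor K Q D fo fe)"
  unfolding path_kcategory_def path_functor_def
  by (rule k_functor_linear_extension[OF K category_path_category[OF Q] D])
    (auto simp: path_category_simps fo path_value_closed path_value_append)

lemma path_functor_obj: "fun_obj (path_functor K Q D fo fe) u = fo u"
  by (simp add: path_functor_def linear_extension_def)

lemma path_functor_arrow:
  assumes "e \<in> arcs Q"
  shows "fun_mor (path_functor K Q D fo fe) (tail Q e) (head Q e) (arrow_mor K Q e) = fe e"
proof -
  have "fun_mor (path_functor K Q D fo fe) (tail Q e) (head Q e) (arrow_mor K Q e) =
      path_value D Q fo fe [e] (head Q e)"
    unfolding path_functor_def path_morphism_def arrow_path_def
    by (subst linear_extension_basis[OF K category_path_category[OF Q] D])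
      (use assms in \<open>auto simp: path_category_simps fo path_value_closed Q.arc_implies_awalk\<close>)
  then show ?thesis
    using assms fe by (simp add: D.k_id_left fo)
qed

end

text \<open>Naturality squares of the arrows are pasted along a path; both sides are linear in \<open>f\<close>, and the paths
  span.\<close>

lemma naturality_from_arrows:
  assumes K: "cring K" and Q: "wf_digraph Q"
    and F: "k_functor K (path_kcategory K Q) D F" and G: "k_functor K (path_kcategory K Q) D G"
    and \<eta>: "\<And>u. u \<in> verts Q \<Longrightarrow> \<eta> u \<in> Hom D (fun_obj F u) (fun_obj G u)"
    and arrows: "\<And>e. e \<in> arcs Q \<Longrightarrow>
      kcat_comp D (fun_obj F (tail Q e)) (fun_obj F (head Q e)) (fun_obj G (head Q e)) (\<eta> (head Q e))
        (fun_mor F (tail Q e) (head Q e) (arrow_mor K Q e)) =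
      kcat_comp D (fun_obj F (tail Q e)) (fun_obj G (tail Q e)) (fun_obj G (head Q e))
        (fun_mor G (tail Q e) (head Q e) (arrow_mor K Q e)) (\<eta> (tail Q e))"
    and uv: "u \<in> verts Q" "v \<in> verts Q" and f: "f \<in> Hom (path_kcategory K Q) u v"
  shows "kcat_comp D (fun_obj F u) (fun_obj F v) (fun_obj G v) (\<eta> v) (fun_mor F u v f) =
    kcat_comp D (fun_obj F u) (fun_obj G u) (fun_obj G v) (fun_mor G u v f) (\<eta> u)"
proof -
  interpret Q: wf_digraph Q by fact
  interpret D: k_category K D by (rule k_functor_target[OF F])
  note o = k_functor_obj[OF F, unfolded path_kcategory_simps] k_functor_obj[OF G, unfolded path_kcategory_simps]
  note m = k_functor_mor[OF F, unfolded path_kcategory_simps(1)] k_functor_mor[OF G, unfolded path_kcategory_simps(1)]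
  note c = k_functor_comp[OF F, unfolded path_kcategory_simps(1)] k_functor_comp[OF G, unfolded path_kcategory_simps(1)]
  note i = k_functor_id[OF F, unfolded path_kcategory_simps(1)] k_functor_id[OF G, unfolded path_kcategory_simps(1)]
  note l = k_functor_linear[OF F, unfolded path_kcategory_simps(1)] k_functor_linear[OF G, unfolded path_kcategory_simps(1)]
  have path: "kcat_comp D (fun_obj F u) (fun_obj F v) (fun_obj G v) (\<eta> v) (fun_mor F u v (path_morphism K (u, es))) =
      kcat_comp D (fun_obj F u) (fun_obj G u) (fun_obj G v) (fun_mor G u v (path_morphism K (u, es))) (\<eta> u)"
    if "Q.awalk u es v" for u es
    using that
  proof (induction es arbitrary: u)
    case Nil
    then have "u = v" "v \<in> verts Q" by (auto simp: Q.awalk_Nil_iff)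
    then show ?case
      using i[of v] \<eta>[of v] o by (simp add: path_kcategory_simps(3) D.k_id_left D.k_id_right)
  next
    case (Cons e es)
    let ?t = "tail Q e" and ?h = "head Q e"
    let ?a = "arrow_mor K Q e" and ?p = "path_morphism K (head Q e, es)"
    from Cons.prems have e: "e \<in> arcs Q" "u = ?t" "Q.awalk ?h es v" by (auto simp: Q.awalk_Cons_iff)
    have vs: "?t \<in> verts Q" "?h \<in> verts Q" "v \<in> verts Q" using e by auto
    have split: "path_morphism K (u, e # es) = kcat_comp (path_kcategory K Q) ?t ?h v ?p ?a"
      using path_morphism_comp[OF K Q Q.arc_implies_awalk[OF e(1)] e(3)] e(2) by (simp add: arrow_path_def)
    have a: "?a \<in> Hom (path_kcategory K Q) ?t ?h" using K Q e(1) by (rule arrow_path_closed)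
    have p: "?p \<in> Hom (path_kcategory K Q) ?h v" using K e(3) by (rule path_morphism_closed)
    show ?case
      unfolding split unfolding e(2) c[OF vs a p]
      by (rule D.paste_squares[OF _ _ _ _ _ _ _ _ _ _ _ _ _ arrows[OF e(1)] Cons.IH[OF e(3)]])
        (use vs a p m \<eta> o in auto)
  qed
  have l1: "linear_map K (free_module K (cat_hom (path_category Q) u v)) (kcat_hom D (fun_obj F u) (fun_obj G v))
      (\<lambda>f. kcat_comp D (fun_obj F u) (fun_obj F v) (fun_obj G v) (\<eta> v) (fun_mor F u v f))"
    using linear_map_comp[OF l(1)[OF uv] D.comp_linear_right[OF o(1)[OF uv(1)] o(1)[OF uv(2)] o(2)[OF uv(2)] \<eta>[OF uv(2)]]]
    by (simp add: path_kcategory_simps)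
  have l2: "linear_map K (free_module K (cat_hom (path_category Q) u v)) (kcat_hom D (fun_obj F u) (fun_obj G v))
      (\<lambda>f. kcat_comp D (fun_obj F u) (fun_obj G u) (fun_obj G v) (fun_mor G u v f) (\<eta> u))"
    using linear_map_comp[OF l(2)[OF uv] D.comp_linear_left[OF o(1)[OF uv(1)] o(2)[OF uv(1)] o(2)[OF uv(2)] \<eta>[OF uv(1)]]]
    by (simp add: path_kcategory_simps)
  show ?thesis
  proof (rule linear_map_free_ext[OF K D.hom_module[OF o(1)[OF uv(1)] o(2)[OF uv(2)]] l1 l2])
    show "f \<in> carrier (free_module K (cat_hom (path_category Q) u v))" using f by (simp add: path_kcategory_simps)
  qed (use path in \<open>auto simp: path_category_simps path_morphism_def\<close>)
qed

text \<open>This is naturality of the family of identities between the two functors.\<close>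

lemma path_functor_unique:
  assumes K: "cring K" and Q: "wf_digraph Q"
    and F: "k_functor K (path_kcategory K Q) D F" and G: "k_functor K (path_kcategory K Q) D G"
    and obj: "\<And>u. u \<in> verts Q \<Longrightarrow> fun_obj F u = fun_obj G u"
    and arrows: "\<And>e. e \<in> arcs Q \<Longrightarrow>
      fun_mor F (tail Q e) (head Q e) (arrow_mor K Q e) =
      fun_mor G (tail Q e) (head Q e) (arrow_mor K Q e)"
    and uv: "u \<in> verts Q" "v \<in> verts Q" and f: "f \<in> Hom (path_kcategory K Q) u v"
  shows "fun_mor F u v f = fun_mor G u v f"
proof -
  interpret Q: wf_digraph Q by fact
  interpret D: k_category K D by (rule k_functor_target[OF F])
  note o = k_functor_obj[OF G, unfolded path_kcategory_simps]
  note m = k_functor_mor[OF F, unfolded path_kcategory_simps(1)] k_functor_mor[OF G, unfolded path_kcategory_simps(1)]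
  have "kcat_comp D (fun_obj F u) (fun_obj F v) (fun_obj G v) (kcat_id D (fun_obj G v)) (fun_mor F u v f) =
    kcat_comp D (fun_obj F u) (fun_obj G u) (fun_obj G v) (fun_mor G u v f) (kcat_id D (fun_obj G u))"
  proof (rule naturality_from_arrows[OF K Q F G _ _ uv f, where \<eta> = "\<lambda>u. kcat_id D (fun_obj G u)"])
    fix e assume e: "e \<in> arcs Q"
    show "kcat_comp D (fun_obj F (tail Q e)) (fun_obj F (head Q e)) (fun_obj G (head Q e)) (kcat_id D (fun_obj G (head Q e)))
        (fun_mor F (tail Q e) (head Q e) (arrow_mor K Q e)) =
      kcat_comp D (fun_obj F (tail Q e)) (fun_obj G (tail Q e)) (fun_obj G (head Q e))
        (fun_mor G (tail Q e) (head Q e) (arrow_mor K Q e)) (kcat_id D (fun_obj G (tail Q e)))"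
      using e m(2)[OF _ _ arrow_path_closed[OF K Q e]] arrows[OF e] o
      by (simp add: obj D.k_id_left D.k_id_right)
  qed (use o in \<open>auto simp: obj intro: D.k_id\<close>)
  then show ?thesis
    using m(1)[OF uv f] m(2)[OF uv f] uv o by (simp add: obj D.k_id_left D.k_id_right)
qed

lemma equiv_pullback:
  assumes "equiv B r" "\<And>a. a \<in> A \<Longrightarrow> f a \<in> B"
  shows "equiv A {(a, b) \<in> A \<times> A. (f a, f b) \<in> r}"
  using assms by (intro equivI refl_onI symI transI) (auto simp: equiv_def refl_on_def dest: symD transD)

context category
begin

lemma context_closure_subset: 
  "w \<in> cat_obj C \<Longrightarrow> z \<in> cat_obj C \<Longrightarrow> context_closure C R w z \<subseteq> cat_hom C w z \<times> cat_hom C w z"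
  by (auto simp: context_closure_def relations_at_def intro!: comp_hom)

lemma generated_equiv_least:
  "equiv (cat_hom C x y) E \<Longrightarrow> context_closure C R x y \<subseteq> E \<Longrightarrow> generated_equiv C R x y \<subseteq> E"
  by (auto simp: generated_equiv_def)

lemma context_closure_generated: "context_closure C R x y \<subseteq> generated_equiv C R x y"
  by (auto simp: generated_equiv_def)

lemma generated_equiv_equiv:
  assumes "x \<in> cat_obj C" "y \<in> cat_obj C"
  shows "equiv (cat_hom C x y) (generated_equiv C R x y)"
proof (rule equivI)
  have "equiv (cat_hom C x y) (cat_hom C x y \<times> cat_hom C x y)"
    by (auto simp: equiv_def refl_on_def sym_def trans_def)
  then show "generated_equiv C R x y \<subseteq> cat_hom C x y \<times> cat_hom C x y"
    by (rule generated_equiv_least) (rule context_closure_subset[OF assms])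
  show "refl_on (cat_hom C x y) (generated_equiv C R x y)"
    by (auto simp: generated_equiv_def equiv_def refl_on_def)
  show "sym (generated_equiv C R x y)"
    unfolding generated_equiv_def equiv_def by (intro symI) (blast dest: symD)
  show "trans (generated_equiv C R x y)"
    unfolding generated_equiv_def equiv_def by (intro transI) (blast dest: transD)
qed

text \<open>The pairs that composition with \<open>q\<close> sends into \<open>R\<^sup>#\<close> form an equivalence relation containing \<open>R\<^sup>c\<close>,
  because \<open>R\<^sup>c\<close> is stable under composition.\<close>

lemma generated_equiv_comp_left:
  assumes obj: "x \<in> cat_obj C" "y \<in> cat_obj C" "z \<in> cat_obj C"
    and q: "q \<in> cat_hom C y z" and pp': "(p, p') \<in> generated_equiv C R x y"
  shows "(cat_comp C x y z q p, cat_comp C x y z q p') \<in> generated_equiv C R x z"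
proof -
  note e = generated_equiv_equiv[OF obj(1,3)]
  define E where "E = {(p, p') \<in> cat_hom C x y \<times> cat_hom C x y.
    (cat_comp C x y z q p, cat_comp C x y z q p') \<in> generated_equiv C R x z}"
  have "equiv (cat_hom C x y) E"
    unfolding E_def by (rule equiv_pullback[OF e]) (rule comp_hom[OF obj _ q])
  moreover have "context_closure C R x y \<subseteq> E"
  proof
    fix r assume r: "r \<in> context_closure C R x y"
    then obtain u v a b c d where r': "r = (cat_comp C x v y d (cat_comp C x u v a c), cat_comp C x v y d (cat_comp C x u v b c))"
      and *: "u \<in> cat_obj C" "v \<in> cat_obj C" "c \<in> cat_hom C x u" "d \<in> cat_hom C v y" "(a, b) \<in> relations_at C R u v"
      unfolding context_closure_def by blast
    have ab: "a \<in> cat_hom C u v" "b \<in> cat_hom C u v" using * by (auto simp: relations_at_def)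
    have "(cat_comp C x v z (cat_comp C v y z q d) (cat_comp C x u v a c),
        cat_comp C x v z (cat_comp C v y z q d) (cat_comp C x u v b c)) \<in> context_closure C R x z"
      using * obj q comp_hom unfolding context_closure_def by blast
    then show "r \<in> E"
      using context_closure_generated context_closure_subset[OF obj(1,2)] r * ab obj q
      by (auto simp: r' E_def comp_assoc comp_hom)
  qed
  ultimately show ?thesis using generated_equiv_least pp' by (fastforce simp: E_def)
qed

lemma generated_equiv_comp_right:
  assumes obj: "x \<in> cat_obj C" "y \<in> cat_obj C" "z \<in> cat_obj C"
    and p: "p \<in> cat_hom C x y" and qq': "(q, q') \<in> generated_equiv C R y z"
  shows "(cat_comp C x y z q p, cat_comp C x y z q' p) \<in> generated_equiv C R x z"
proof -
  note e = generated_equiv_equiv[OF obj(1,3)]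
  define E where "E = {(q, q') \<in> cat_hom C y z \<times> cat_hom C y z.
    (cat_comp C x y z q p, cat_comp C x y z q' p) \<in> generated_equiv C R x z}"
  have "equiv (cat_hom C y z) E"
    unfolding E_def by (rule equiv_pullback[OF e]) (rule comp_hom[OF obj p])
  moreover have "context_closure C R y z \<subseteq> E"
  proof
    fix r assume r: "r \<in> context_closure C R y z"
    then obtain u v a b c d where r': "r = (cat_comp C y v z d (cat_comp C y u v a c), cat_comp C y v z d (cat_comp C y u v b c))"
      and *: "u \<in> cat_obj C" "v \<in> cat_obj C" "c \<in> cat_hom C y u" "d \<in> cat_hom C v z" "(a, b) \<in> relations_at C R u v"
      unfolding context_closure_def by blast
    have ab: "a \<in> cat_hom C u v" "b \<in> cat_hom C u v" using * by (auto simp: relations_at_def)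
    have "(cat_comp C x v z d (cat_comp C x u v a (cat_comp C x y u c p)),
        cat_comp C x v z d (cat_comp C x u v b (cat_comp C x y u c p))) \<in> context_closure C R x z"
      using * obj p comp_hom unfolding context_closure_def by blast
    then show "r \<in> E"
      using context_closure_generated context_closure_subset[OF obj(2,3)] r * ab obj p
      by (auto simp: r' E_def comp_assoc comp_hom)
  qed
  ultimately show ?thesis using generated_equiv_least qq' by (fastforce simp: E_def)
qed

lemma quotient_cat_comp_class:
  assumes obj: "x \<in> cat_obj C" "y \<in> cat_obj C" "z \<in> cat_obj C"
    and p: "p \<in> cat_hom C x y" and q: "q \<in> cat_hom C y z"
  shows "cat_comp (quotient_cat C R) x y z (generated_equiv C R y z `` {q}) (generated_equiv C R x y `` {p}) =
    generated_equiv C R x z `` {cat_comp C x y z q p}"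
proof -
  note e = generated_equiv_equiv[OF obj(1,3)]
  note exy = generated_equiv_equiv[OF obj(1,2)] and eyz = generated_equiv_equiv[OF obj(2,3)]
  have "generated_equiv C R x z `` {cat_comp C x y z q' p'} = generated_equiv C R x z `` {cat_comp C x y z q p}"
    if "(q, q') \<in> generated_equiv C R y z" "(p, p') \<in> generated_equiv C R x y" for p' q'
  proof -
    have "q' \<in> cat_hom C y z" using that eyz by (auto simp: equiv_def)
    then have "(cat_comp C x y z q p, cat_comp C x y z q' p') \<in> generated_equiv C R x z"
      using generated_equiv_comp_right[OF obj p that(1)] generated_equiv_comp_left[OF obj _ that(2)] e
      by (meson equiv_def transD)
    then show ?thesis using equiv_class_eq[OF e] by blast
  qed
  moreover have "(q, q) \<in> generated_equiv C R y z" "(p, p) \<in> generated_equiv C R x y"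
    using p q exy eyz by (auto simp: equiv_def refl_on_def)
  ultimately show ?thesis
    unfolding quotient_cat_def cat.simps by (intro SUP_eq_const) blast+
qed

end

section \<open>The Grothendieck construction and its universal property\<close>

locale linear_diagram =
  fixes K :: "'k ring" and I :: "('i, 'a) cat" and X :: "('i, 'a, 'o, 'm, 'k) diagram"
  assumes K: "cring K" and X: "functor_to_kCat K I X"
begin

sublocale I: category I using X by (simp add: functor_to_kCat_def)

text \<open>\<open>push_ob\<close> and \<open>push_mor\<close> are the action of an index morphism on the objects and morphisms of a fibre.\<close>

abbreviation "Gr \<equiv> grothendieck I X"
abbreviation "fib_ob i \<equiv> kcat_obj (dia_obj X i)"
abbreviation "fib_hom i \<equiv> kcat_hom (dia_obj X i)"
abbreviation "push_ob i j a \<equiv> fun_obj (dia_mor X i j a)"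
abbreviation "push_mor i j a \<equiv> fun_mor (dia_mor X i j a)"

lemma dia_cat: "i \<in> cat_obj I \<Longrightarrow> k_category K (dia_obj X i)"
  using X by (simp add: functor_to_kCat_def)

lemma dia_functor:
  "i \<in> cat_obj I \<Longrightarrow> j \<in> cat_obj I \<Longrightarrow> a \<in> cat_hom I i j \<Longrightarrow>
    k_functor K (dia_obj X i) (dia_obj X j) (dia_mor X i j a)"
  using X by (simp add: functor_to_kCat_def)

lemma dia_id:
  assumes "i \<in> cat_obj I"
  shows "x \<in> fib_ob i \<Longrightarrow> push_ob i i (cat_id I i) x = x"
    and "x \<in> fib_ob i \<Longrightarrow> y \<in> fib_ob i \<Longrightarrow> f \<in> carrier (fib_hom i x y) \<Longrightarrow> push_mor i i (cat_id I i) x y f = f"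
  using X assms by (auto simp: functor_to_kCat_def functor_eq_def)

lemma dia_comp:
  assumes "i \<in> cat_obj I" "j \<in> cat_obj I" "k \<in> cat_obj I" "a \<in> cat_hom I i j" "b \<in> cat_hom I j k"
  shows "x \<in> fib_ob i \<Longrightarrow> push_ob i k (cat_comp I i j k b a) x = push_ob j k b (push_ob i j a x)"
    and "x \<in> fib_ob i \<Longrightarrow> y \<in> fib_ob i \<Longrightarrow> f \<in> carrier (fib_hom i x y) \<Longrightarrow>
      push_mor i k (cat_comp I i j k b a) x y f = push_mor j k b (push_ob i j a x) (push_ob i j a y) (push_mor i j a x y f)"
  using X assms by (auto simp: functor_to_kCat_def functor_eq_def comp_functor_def)

lemma dia_obj_closed:
  "i \<in> cat_obj I \<Longrightarrow> j \<in> cat_obj I \<Longrightarrow> a \<in> cat_hom I i j \<Longrightarrow> x \<in> fib_ob i \<Longrightarrow> push_ob i j a x \<in> fib_ob j"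
  using k_functor_obj[OF dia_functor] .

lemma dia_mor_closed:
  "i \<in> cat_obj I \<Longrightarrow> j \<in> cat_obj I \<Longrightarrow> a \<in> cat_hom I i j \<Longrightarrow> x \<in> fib_ob i \<Longrightarrow> y \<in> fib_ob i \<Longrightarrow>
    f \<in> carrier (fib_hom i x y) \<Longrightarrow> push_mor i j a x y f \<in> carrier (fib_hom j (push_ob i j a x) (push_ob i j a y))"
  using k_functor_mor[OF dia_functor] .

lemma gr_component_apply: "gr_component X (i, x) (j, y) a = fib_hom j (push_ob i j a x) y"
  by (simp add: gr_component_def)

lemma module_gr_component:
  "i \<in> cat_obj I \<Longrightarrow> x \<in> fib_ob i \<Longrightarrow> j \<in> cat_obj I \<Longrightarrow> y \<in> fib_ob j \<Longrightarrow> a \<in> cat_hom I i j \<Longrightarrow>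
    Module.module K (gr_component X (i, x) (j, y) a)"
  unfolding gr_component_apply by (intro k_category.hom_module dia_cat dia_obj_closed)

lemma grothendieck_simps:
  "(i, x) \<in> kcat_obj Gr \<longleftrightarrow> i \<in> cat_obj I \<and> x \<in> fib_ob i"
  "kcat_hom Gr (i, x) (j, y) = direct_sum (cat_hom I i j) (gr_component X (i, x) (j, y))"
  "kcat_id Gr (i, x) = single (gr_component X (i, x) (i, x)) (cat_id I i) (kcat_id (dia_obj X i) x)"
  "kcat_comp Gr (i, x) (j, y) (k, z) =
    graded_product (cat_hom I i j) (gr_component X (i, x) (j, y)) (cat_hom I j k) (gr_component X (j, y) (k, z))
      (cat_hom I i k) (gr_component X (i, x) (k, z)) (cat_comp I i j k)
      (\<lambda>a b n m. kcat_comp (dia_obj X k) (push_ob j k b (push_ob i j a x)) (push_ob j k b y) z n (push_mor j k b (push_ob i j a x) y m))"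
  by (simp_all add: grothendieck_def single_def graded_product_def fun_eq_iff)

lemma gr_single_closed:
  assumes "i \<in> cat_obj I" "x \<in> fib_ob i" "j \<in> cat_obj I" "y \<in> fib_ob j" "a \<in> cat_hom I i j"
    and "m \<in> carrier (fib_hom j (push_ob i j a x) y)"
  shows "single (gr_component X (i, x) (j, y)) a m \<in> Hom Gr (i, x) (j, y)"
  unfolding grothendieck_simps
  by (rule single_closed) (use assms in \<open>auto simp: gr_component_apply[symmetric] intro: module_gr_component\<close>)

lemma module_gr_hom:
  assumes "i \<in> cat_obj I" "x \<in> fib_ob i" "j \<in> cat_obj I" "y \<in> fib_ob j"
  shows "Module.module K (kcat_hom Gr (i, x) (j, y))"
  unfolding grothendieck_simps by (rule module_direct_sum[OF K]) (use assms in \<open>auto intro: module_gr_component\<close>)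

lemma gr_hom_ext:
  assumes "i \<in> cat_obj I" "x \<in> fib_ob i" "j \<in> cat_obj I" "y \<in> fib_ob j"
    and N: "Module.module K N"
    and h: "linear_map K (kcat_hom Gr (i, x) (j, y)) N h" and h': "linear_map K (kcat_hom Gr (i, x) (j, y)) N h'"
    and eq: "\<And>a m. a \<in> cat_hom I i j \<Longrightarrow> m \<in> carrier (fib_hom j (push_ob i j a x) y) \<Longrightarrow>
      h (single (gr_component X (i, x) (j, y)) a m) = h' (single (gr_component X (i, x) (j, y)) a m)"
    and f: "f \<in> Hom Gr (i, x) (j, y)"
  shows "h f = h' f"
  by (rule linear_map_direct_sum_ext[OF module_gr_component[OF assms(1-4)] K N
        h[unfolded grothendieck_simps] h'[unfolded grothendieck_simps] eq f[unfolded grothendieck_simps]])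
    (auto simp: gr_component_apply)

lemma graded_pairing_gr:
  assumes i: "i \<in> cat_obj I" "x \<in> fib_ob i" and j: "j \<in> cat_obj I" "y \<in> fib_ob j" and k: "k \<in> cat_obj I" "z \<in> fib_ob k"
  shows "graded_pairing K (cat_hom I i j) (gr_component X (i, x) (j, y)) (cat_hom I j k) (gr_component X (j, y) (k, z))
      (cat_hom I i k) (gr_component X (i, x) (k, z)) (cat_comp I i j k)
      (\<lambda>a b n m. kcat_comp (dia_obj X k) (push_ob j k b (push_ob i j a x)) (push_ob j k b y) z n (push_mor j k b (push_ob i j a x) y m))"
proof (rule graded_pairing.intro)
  interpret Xk: k_category K "dia_obj X k" using k by (intro dia_cat)
  fix a b assume ab: "a \<in> cat_hom I i j" "b \<in> cat_hom I j k"
  have o: "push_ob i j a x \<in> fib_ob j" "push_ob j k b (push_ob i j a x) \<in> fib_ob k" "push_ob j k b y \<in> fib_ob k"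
    using ab i j k by (auto intro!: dia_obj_closed)
  show "cat_comp I i j k b a \<in> cat_hom I i k" using ab i j k by (intro I.comp_hom)
  have L: "gr_component X (i, x) (k, z) (cat_comp I i j k b a) = fib_hom k (push_ob j k b (push_ob i j a x)) z"
    using ab i j k by (simp add: gr_component_apply dia_comp)
  show "linear_map K (gr_component X (i, x) (j, y) a) (gr_component X (i, x) (k, z) (cat_comp I i j k b a))
      (\<lambda>m. kcat_comp (dia_obj X k) (push_ob j k b (push_ob i j a x)) (push_ob j k b y) z n (push_mor j k b (push_ob i j a x) y m))"
    if "n \<in> carrier (gr_component X (j, y) (k, z) b)" for n
    using that unfolding L unfolding gr_component_apply
    by (intro linear_map_comp[OF k_functor_linear[OF dia_functor] Xk.comp_linear_right] o ab j k)
  show "linear_map K (gr_component X (j, y) (k, z) b) (gr_component X (i, x) (k, z) (cat_comp I i j k b a))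
      (\<lambda>n. kcat_comp (dia_obj X k) (push_ob j k b (push_ob i j a x)) (push_ob j k b y) z n (push_mor j k b (push_ob i j a x) y m))"
    if "m \<in> carrier (gr_component X (i, x) (j, y) a)" for m
    using that unfolding L unfolding gr_component_apply
    by (intro Xk.comp_linear_left o ab j k dia_mor_closed)
qed (use assms K module_gr_component in auto)

lemma gr_comp_single:
  assumes "i \<in> cat_obj I" "x \<in> fib_ob i" "j \<in> cat_obj I" "y \<in> fib_ob j" "k \<in> cat_obj I" "z \<in> fib_ob k"
    and "a \<in> cat_hom I i j" "m \<in> carrier (fib_hom j (push_ob i j a x) y)"
    and "b \<in> cat_hom I j k" "n \<in> carrier (fib_hom k (push_ob j k b y) z)"
  shows "kcat_comp Gr (i, x) (j, y) (k, z) (single (gr_component X (j, y) (k, z)) b n)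
      (single (gr_component X (i, x) (j, y)) a m) =
    single (gr_component X (i, x) (k, z)) (cat_comp I i j k b a)
      (kcat_comp (dia_obj X k) (push_ob j k b (push_ob i j a x)) (push_ob j k b y) z n (push_mor j k b (push_ob i j a x) y m))"
  unfolding grothendieck_simps
  by (rule graded_pairing.graded_product_single[OF graded_pairing_gr]) (use assms in \<open>auto simp: gr_component_apply\<close>)

lemma gr_comp_linear:
  assumes "i \<in> cat_obj I" "x \<in> fib_ob i" "j \<in> cat_obj I" "y \<in> fib_ob j" "k \<in> cat_obj I" "z \<in> fib_ob k"
  shows "g \<in> Hom Gr (j, y) (k, z) \<Longrightarrow>
      linear_map K (kcat_hom Gr (i, x) (j, y)) (kcat_hom Gr (i, x) (k, z)) (\<lambda>f. kcat_comp Gr (i, x) (j, y) (k, z) g f)"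
    and "f \<in> Hom Gr (i, x) (j, y) \<Longrightarrow>
      linear_map K (kcat_hom Gr (j, y) (k, z)) (kcat_hom Gr (i, x) (k, z)) (\<lambda>g. kcat_comp Gr (i, x) (j, y) (k, z) g f)"
  unfolding grothendieck_simps
  using graded_pairing.graded_product_linear_right[OF graded_pairing_gr[OF assms]]
    graded_pairing.graded_product_linear_left[OF graded_pairing_gr[OF assms]] by blast+

lemma gr_single_arrow_id:
  assumes "i \<in> cat_obj I" "x \<in> fib_ob i"
  shows "kcat_id (dia_obj X i) x \<in> carrier (fib_hom i (push_ob i i (cat_id I i) x) x)"
  using assms k_category.k_id[OF dia_cat] by (simp add: dia_id)

text \<open>On homogeneous morphisms \<open>m\<close>, \<open>n\<close>, \<open>p\<close> of degrees \<open>a\<close>, \<open>b\<close>, \<open>c\<close>, associativity compares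
  \<open>p \<circ> X(c)(n \<circ> X(b) m)\<close> with \<open>(p \<circ> X(c) n) \<circ> X(cb) m\<close>.  These agree since \<open>X(c)\<close> is a functor and
  \<open>X(cb) = X(c) X(b)\<close>.\<close>

lemma k_category_grothendieck: "k_category K Gr"
proof (rule k_categoryI)
  let ?c = "kcat_comp Gr"
  note lin = gr_comp_linear
  note cl = linear_map_closed[OF lin(1)]
  note ext = gr_hom_ext[OF _ _ _ _ module_gr_hom]
  note objs = grothendieck_simps(1)
  note ids = gr_single_arrow_id
  fix u assume "u \<in> kcat_obj Gr"
  then obtain i x where u: "u = (i, x)" "i \<in> cat_obj I" "x \<in> fib_ob i" by (cases u) (auto simp: objs)
  interpret Xi: k_category K "dia_obj X i" using u by (intro dia_cat)
  have id_u: "kcat_id Gr u \<in> Hom Gr u u"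
    unfolding u(1) grothendieck_simps(3) using u by (intro gr_single_closed I.id_hom ids)
  then show "kcat_id Gr u \<in> Hom Gr u u" .
  fix v assume "v \<in> kcat_obj Gr"
  then obtain j y where v: "v = (j, y)" "j \<in> cat_obj I" "y \<in> fib_ob j" by (cases v) (auto simp: objs)
  interpret Xj: k_category K "dia_obj X j" using v by (intro dia_cat)
  have id_v: "kcat_id Gr v \<in> Hom Gr v v"
    unfolding v(1) grothendieck_simps(3) using v by (intro gr_single_closed I.id_hom ids)
  show "Module.module K (kcat_hom Gr u v)" using u v by (simp add: module_gr_hom)
  show "?c u v v (kcat_id Gr v) f = f" if f: "f \<in> Hom Gr u v" for f
    unfolding u(1) v(1)
  proof (rule ext[OF u(2,3) v(2,3) u(2,3) v(2,3) lin(1)[OF u(2,3) v(2,3) v(2,3)] linear_map_ident _ f[unfolded u(1) v(1)]])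
    fix a m assume homog: "a \<in> cat_hom I i j" "m \<in> carrier (fib_hom j (push_ob i j a x) y)"
    have ax: "push_ob i j a x \<in> fib_ob j" using u v homog by (intro dia_obj_closed)
    have idm: "kcat_id (dia_obj X j) y \<in> carrier (fib_hom j (push_ob j j (cat_id I j) y) y)" using v by (intro ids)
    show "?c (i, x) (j, y) (j, y) (kcat_id Gr (j, y)) (single (gr_component X (i, x) (j, y)) a m) =
        single (gr_component X (i, x) (j, y)) a m"
      unfolding grothendieck_simps(3)
      by (subst gr_comp_single[OF u(2,3) v(2,3) v(2,3) homog I.id_hom[OF v(2)] idm])
        (use u v homog ax in \<open>simp add: dia_id I.comp_id_left Xj.k_id_left\<close>)
  qed (use id_v v in auto)
  show "?c u u v f (kcat_id Gr u) = f" if f: "f \<in> Hom Gr u v" for f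
    unfolding u(1) v(1)
  proof (rule ext[OF u(2,3) v(2,3) u(2,3) v(2,3) lin(2)[OF u(2,3) u(2,3) v(2,3)] linear_map_ident _ f[unfolded u(1) v(1)]])
    fix a m assume homog: "a \<in> cat_hom I i j" "m \<in> carrier (fib_hom j (push_ob i j a x) y)"
    have ax: "push_ob i j a x \<in> fib_ob j" using u v homog by (intro dia_obj_closed)
    have idm: "kcat_id (dia_obj X i) x \<in> carrier (fib_hom i (push_ob i i (cat_id I i) x) x)" using u by (intro ids)
    show "?c (i, x) (i, x) (j, y) (single (gr_component X (i, x) (j, y)) a m) (kcat_id Gr (i, x)) =
        single (gr_component X (i, x) (j, y)) a m"
      unfolding grothendieck_simps(3)
      by (subst gr_comp_single[OF u(2,3) u(2,3) v(2,3) I.id_hom[OF u(2)] idm homog])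
        (use u v homog ax in \<open>simp add: dia_id I.comp_id_right Xj.k_id_right k_functor_id[OF dia_functor]\<close>)
  qed (use id_u u in auto)
  fix w assume "w \<in> kcat_obj Gr"
  then obtain k z where w: "w = (k, z)" "k \<in> cat_obj I" "z \<in> fib_ob k" by (cases w) (auto simp: objs)
  interpret Xk: k_category K "dia_obj X k" using w by (intro dia_cat)
  show "linear_map K (kcat_hom Gr u v) (kcat_hom Gr u w) (\<lambda>f. ?c u v w g f)"
    if "g \<in> Hom Gr v w" for g
    using lin(1) that u v w by simp
  show "linear_map K (kcat_hom Gr v w) (kcat_hom Gr u w) (\<lambda>g. ?c u v w g f)"
    if "f \<in> Hom Gr u v" for f
    using lin(2) that u v w by simp
  fix t f g h assume "t \<in> kcat_obj Gr"
  then obtain l s where t: "t = (l, s)" "l \<in> cat_obj I" "s \<in> fib_ob l" by (cases t) (auto simp: objs)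
  interpret Xl: k_category K "dia_obj X l" using t by (intro dia_cat)
  let ?S = "\<lambda>u v. single (gr_component X u v)"
  assume "f \<in> Hom Gr t u" "g \<in> Hom Gr u v" "h \<in> Hom Gr v w"
  then have f: "f \<in> Hom Gr (l, s) (i, x)" and g: "g \<in> Hom Gr (i, x) (j, y)"
    and h: "h \<in> Hom Gr (j, y) (k, z)" using t u v w by simp_all
  note T = t(2,3) and U = u(2,3) and V = v(2,3) and W = w(2,3)
  (* Associativity for homogeneous morphisms; f1, g1 and the last step extend it, one argument at a time. *)
  have homog: "?c (l, s) (j, y) (k, z) (?S (j, y) (k, z) c p)
        (?c (l, s) (i, x) (j, y) (?S (i, x) (j, y) b n) (?S (l, s) (i, x) a m)) =
      ?c (l, s) (i, x) (k, z) (?c (i, x) (j, y) (k, z) (?S (j, y) (k, z) c p) (?S (i, x) (j, y) b n))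
        (?S (l, s) (i, x) a m)"
    if a: "a \<in> cat_hom I l i" "m \<in> carrier (fib_hom i (push_ob l i a s) x)"
      and b: "b \<in> cat_hom I i j" "n \<in> carrier (fib_hom j (push_ob i j b x) y)"
      and c: "c \<in> cat_hom I j k" "p \<in> carrier (fib_hom k (push_ob j k c y) z)" for a m b n c p
  proof -
    let ?ba = "cat_comp I l i j b a" and ?cb = "cat_comp I i j k c b"
    have o: "push_ob l i a s \<in> fib_ob i" "push_ob i j b (push_ob l i a s) \<in> fib_ob j" "push_ob i j b x \<in> fib_ob j"
      "push_ob j k c (push_ob i j b (push_ob l i a s)) \<in> fib_ob k" "push_ob j k c (push_ob i j b x) \<in> fib_ob k" "push_ob j k c y \<in> fib_ob k"
      using a b c t u v w by (auto intro!: dia_obj_closed)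
    have bm: "push_mor i j b (push_ob l i a s) x m \<in> carrier (fib_hom j (push_ob i j b (push_ob l i a s)) (push_ob i j b x))"
      using a b o t u v by (intro dia_mor_closed)
    have cn: "push_mor j k c (push_ob i j b x) y n \<in> carrier (fib_hom k (push_ob j k c (push_ob i j b x)) (push_ob j k c y))"
      using b c o v w by (intro dia_mor_closed)
    have cbm: "push_mor j k c (push_ob i j b (push_ob l i a s)) (push_ob i j b x) (push_mor i j b (push_ob l i a s) x m)
        \<in> carrier (fib_hom k (push_ob j k c (push_ob i j b (push_ob l i a s))) (push_ob j k c (push_ob i j b x)))"
      using dia_mor_closed[OF v(2) w(2) c(1) o(2,3) bm] .
    define nm where "nm = kcat_comp (dia_obj X j) (push_ob i j b (push_ob l i a s)) (push_ob i j b x) y n (push_mor i j b (push_ob l i a s) x m)"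
    define pn where "pn = kcat_comp (dia_obj X k) (push_ob j k c (push_ob i j b x)) (push_ob j k c y) z p (push_mor j k c (push_ob i j b x) y n)"
    have ba: "?ba \<in> cat_hom I l j" "?cb \<in> cat_hom I i k" using a b c t u v w by (auto intro!: I.comp_hom)
    have nm: "nm \<in> carrier (fib_hom j (push_ob l j ?ba s) y)"
      using a b bm o t u v by (auto simp: nm_def dia_comp intro!: Xj.k_comp_closed)
    have pn: "pn \<in> carrier (fib_hom k (push_ob i k ?cb x) z)"
      using b c cn o u v w by (auto simp: pn_def dia_comp intro!: Xk.k_comp_closed)
    have "?c (l, s) (j, y) (k, z) (?S (j, y) (k, z) c p)
        (?c (l, s) (i, x) (j, y) (?S (i, x) (j, y) b n) (?S (l, s) (i, x) a m)) =
      ?c (l, s) (j, y) (k, z) (?S (j, y) (k, z) c p) (?S (l, s) (j, y) ?ba nm)"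
      unfolding nm_def by (simp only: gr_comp_single[OF T U V a b])
    also have "\<dots> = ?S (l, s) (k, z) (cat_comp I l j k c ?ba)
        (kcat_comp (dia_obj X k) (push_ob j k c (push_ob i j b (push_ob l i a s))) (push_ob j k c y) z p
          (push_mor j k c (push_ob i j b (push_ob l i a s)) y nm))"
      by (subst gr_comp_single[OF T V W ba(1) nm c]) (use T U V a b in \<open>simp add: dia_comp\<close>)
    also have "\<dots> = ?S (l, s) (k, z) (cat_comp I l i k ?cb a)
        (kcat_comp (dia_obj X k) (push_ob j k c (push_ob i j b (push_ob l i a s))) (push_ob j k c (push_ob i j b x)) z pn
          (push_mor j k c (push_ob i j b (push_ob l i a s)) (push_ob i j b x) (push_mor i j b (push_ob l i a s) x m)))"
    proof -
      have "push_mor j k c (push_ob i j b (push_ob l i a s)) y nm = kcat_comp (dia_obj X k) (push_ob j k c (push_ob i j b (push_ob l i a s)))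
          (push_ob j k c (push_ob i j b x)) (push_ob j k c y) (push_mor j k c (push_ob i j b x) y n)
          (push_mor j k c (push_ob i j b (push_ob l i a s)) (push_ob i j b x) (push_mor i j b (push_ob l i a s) x m))"
        unfolding nm_def using V W c b bm o by (intro k_functor_comp[OF dia_functor])
      then show ?thesis
        using cbm cn c o W a b T U V by (simp add: pn_def Xk.k_assoc I.comp_assoc)
    qed
    also have "\<dots> = ?c (l, s) (i, x) (k, z) (?S (i, x) (k, z) ?cb pn) (?S (l, s) (i, x) a m)"
      by (subst gr_comp_single[OF T U W a ba(2) pn]) (use T U V W a b c o in \<open>simp add: dia_comp\<close>)
    also have "\<dots> = ?c (l, s) (i, x) (k, z) (?c (i, x) (j, y) (k, z) (?S (j, y) (k, z) c p) (?S (i, x) (j, y) b n))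
        (?S (l, s) (i, x) a m)"
      unfolding pn_def by (simp only: gr_comp_single[OF U V W b c])
    finally show ?thesis .
  qed
  note sc = gr_single_closed
  have f1: "?c (l, s) (j, y) (k, z) (?S (j, y) (k, z) c p) (?c (l, s) (i, x) (j, y) (?S (i, x) (j, y) b n) f) =
      ?c (l, s) (i, x) (k, z) (?c (i, x) (j, y) (k, z) (?S (j, y) (k, z) c p) (?S (i, x) (j, y) b n)) f"
    if "b \<in> cat_hom I i j" "n \<in> carrier (fib_hom j (push_ob i j b x) y)"
      "c \<in> cat_hom I j k" "p \<in> carrier (fib_hom k (push_ob j k c y) z)" for b n c p
    by (rule ext[OF T U T W linear_map_comp[OF lin(1)[OF T U V] lin(1)[OF T V W]] lin(1)[OF T U W] homog f])
      (use that T U V W in \<open>auto intro!: sc cl\<close>)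
  have g1: "?c (l, s) (j, y) (k, z) (?S (j, y) (k, z) c p) (?c (l, s) (i, x) (j, y) g f) =
      ?c (l, s) (i, x) (k, z) (?c (i, x) (j, y) (k, z) (?S (j, y) (k, z) c p) g) f"
    if "c \<in> cat_hom I j k" "p \<in> carrier (fib_hom k (push_ob j k c y) z)" for c p
    by (rule ext[OF U V T W linear_map_comp[OF lin(2)[OF T U V] lin(1)[OF T V W]]
          linear_map_comp[OF lin(1)[OF U V W] lin(2)[OF T U W]] f1 g])
      (use that f T U V W in \<open>auto intro!: sc cl\<close>)
  have "?c (l, s) (j, y) (k, z) h (?c (l, s) (i, x) (j, y) g f) =
      ?c (l, s) (i, x) (k, z) (?c (i, x) (j, y) (k, z) h g) f"
    by (rule ext[OF V W T W lin(2)[OF T V W] linear_map_comp[OF lin(2)[OF U V W] lin(2)[OF T U W]] g1 h])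
      (use f g T U V W in \<open>auto intro!: sc cl\<close>)
  then show "?c t v w h (?c t u v g f) = ?c t u w (?c u v w h g) f" by (simp only: t(1) u(1) v(1) w(1))
qed

text \<open>The fibre over \<open>j\<close> sits in the Grothendieck construction in degree \<open>id\<^sub>j\<close>.\<close>

definition fibre_inclusion :: "'i \<Rightarrow> ('o, 'm, 'i \<times> 'o, 'a \<Rightarrow> 'm) functor_data" where
  "fibre_inclusion j = \<lparr>fun_obj = Pair j, fun_mor = (\<lambda>x y. single (gr_component X (j, x) (j, y)) (cat_id I j))\<rparr>"

lemma fibre_inclusion_simps:
  "fun_obj (fibre_inclusion j) x = (j, x)"
  "fun_mor (fibre_inclusion j) x y f = single (gr_component X (j, x) (j, y)) (cat_id I j) f"
  by (simp_all add: fibre_inclusion_def)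

lemma k_functor_fibre_inclusion:
  assumes j: "j \<in> cat_obj I"
  shows "k_functor K (dia_obj X j) Gr (fibre_inclusion j)"
proof (rule k_functorI, unfold fibre_inclusion_simps)
  show "k_category K (dia_obj X j)" using j by (rule dia_cat)
  show "k_category K Gr" by (rule k_category_grothendieck)
  show "(j, x) \<in> kcat_obj Gr" if "x \<in> fib_ob j" for x using that j by (simp add: grothendieck_simps)
  show "single (gr_component X (j, x) (j, x)) (cat_id I j) (kcat_id (dia_obj X j) x) = kcat_id Gr (j, x)" for x
    by (simp add: grothendieck_simps)
  fix x y assume xy: "x \<in> fib_ob j" "y \<in> fib_ob j"
  have "linear_map K (gr_component X (j, x) (j, y) (cat_id I j)) (kcat_hom Gr (j, x) (j, y))
      (single (gr_component X (j, x) (j, y)) (cat_id I j))"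
    unfolding grothendieck_simps
    using j xy by (intro single_linear I.id_hom module_gr_component)
  then show "linear_map K (fib_hom j x y) (kcat_hom Gr (j, x) (j, y))
      (single (gr_component X (j, x) (j, y)) (cat_id I j))"
    using j xy by (simp add: gr_component_apply dia_id)
  fix z f g assume "z \<in> fib_ob j" "f \<in> carrier (fib_hom j x y)" "g \<in> carrier (fib_hom j y z)"
  then show "single (gr_component X (j, x) (j, z)) (cat_id I j) (kcat_comp (dia_obj X j) x y z g f) =
      kcat_comp Gr (j, x) (j, y) (j, z) (single (gr_component X (j, y) (j, z)) (cat_id I j) g)
        (single (gr_component X (j, x) (j, y)) (cat_id I j) f)"
    using j xy by (subst gr_comp_single) (simp_all add: dia_id I.id_hom I.comp_id_left)
qed

text \<open>The homogeneous morphism \<open>m\<close> of degree \<open>a\<close> is \<open>m\<close> in the degree of an identity after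
  the identity of \<open>ax\<close> in degree \<open>a\<close>.  The former has to go to \<open>S j m\<close> and the latter to \<open>\<xi>\<close>, which
  forces this formula.\<close>

definition gr_lift ::
  "('p, 'n, 'k) kcat \<Rightarrow> ('i \<Rightarrow> ('o, 'm, 'p, 'n) functor_data) \<Rightarrow> ('i \<Rightarrow> 'i \<Rightarrow> 'a \<Rightarrow> 'o \<Rightarrow> 'n) \<Rightarrow>
    ('i \<times> 'o, 'a \<Rightarrow> 'm, 'p, 'n) functor_data" where
  "gr_lift E S \<xi> = \<lparr>fun_obj = (\<lambda>(i, x). fun_obj (S i) x),
     fun_mor = (\<lambda>(i, x) (j, y). direct_sum_lift (kcat_hom E (fun_obj (S i) x) (fun_obj (S j) y))
       (cat_hom I i j) (gr_component X (i, x) (j, y))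
       (\<lambda>a m. kcat_comp E (fun_obj (S i) x) (fun_obj (S j) (push_ob i j a x)) (fun_obj (S j) y)
         (fun_mor (S j) (push_ob i j a x) y m) (\<xi> i j a x)))\<rparr>"

end

text \<open>The data of a functor from the Grothendieck construction to \<open>E\<close>: its restrictions to the fibres, and the
  images of the identities placed in degree \<open>a\<close>.\<close>

locale lax_cocone = linear_diagram K I X
  for K :: "'k ring" and I :: "('i, 'a) cat" and X :: "('i, 'a, 'o, 'm, 'k) diagram" +
  fixes E :: "('p, 'n, 'k) kcat" and S :: "'i \<Rightarrow> ('o, 'm, 'p, 'n) functor_data"
    and \<xi> :: "'i \<Rightarrow> 'i \<Rightarrow> 'a \<Rightarrow> 'o \<Rightarrow> 'n"
  assumes E: "k_category K E"
    and S: "\<And>i. i \<in> cat_obj I \<Longrightarrow> k_functor K (dia_obj X i) E (S i)"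
    and \<xi>_closed: "\<And>i j a x. i \<in> cat_obj I \<Longrightarrow> j \<in> cat_obj I \<Longrightarrow> a \<in> cat_hom I i j \<Longrightarrow> x \<in> fib_ob i \<Longrightarrow>
      \<xi> i j a x \<in> Hom E (fun_obj (S i) x) (fun_obj (S j) (push_ob i j a x))"
    and \<xi>_natural: "\<And>i j a x y f. i \<in> cat_obj I \<Longrightarrow> j \<in> cat_obj I \<Longrightarrow> a \<in> cat_hom I i j \<Longrightarrow>
      x \<in> fib_ob i \<Longrightarrow> y \<in> fib_ob i \<Longrightarrow> f \<in> carrier (fib_hom i x y) \<Longrightarrow>
      kcat_comp E (fun_obj (S i) x) (fun_obj (S i) y) (fun_obj (S j) (push_ob i j a y)) (\<xi> i j a y) (fun_mor (S i) x y f) =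
      kcat_comp E (fun_obj (S i) x) (fun_obj (S j) (push_ob i j a x)) (fun_obj (S j) (push_ob i j a y))
        (fun_mor (S j) (push_ob i j a x) (push_ob i j a y) (push_mor i j a x y f)) (\<xi> i j a x)"
    and \<xi>_id: "\<And>i x. i \<in> cat_obj I \<Longrightarrow> x \<in> fib_ob i \<Longrightarrow> \<xi> i i (cat_id I i) x = kcat_id E (fun_obj (S i) x)"
    and \<xi>_comp: "\<And>i j k a b x. i \<in> cat_obj I \<Longrightarrow> j \<in> cat_obj I \<Longrightarrow> k \<in> cat_obj I \<Longrightarrow>
      a \<in> cat_hom I i j \<Longrightarrow> b \<in> cat_hom I j k \<Longrightarrow> x \<in> fib_ob i \<Longrightarrow>
      \<xi> i k (cat_comp I i j k b a) x =
      kcat_comp E (fun_obj (S i) x) (fun_obj (S j) (push_ob i j a x)) (fun_obj (S k) (push_ob j k b (push_ob i j a x)))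
        (\<xi> j k b (push_ob i j a x)) (\<xi> i j a x)"
begin

sublocale E: k_category K E by (rule E)

lemma gr_lift_obj: "fun_obj (gr_lift E S \<xi>) (i, x) = fun_obj (S i) x"
  by (simp add: gr_lift_def)

lemma S_obj: "i \<in> cat_obj I \<Longrightarrow> x \<in> fib_ob i \<Longrightarrow> fun_obj (S i) x \<in> kcat_obj E"
  by (rule k_functor_obj[OF S])

lemma gr_lift_summand:
  assumes "i \<in> cat_obj I" "x \<in> fib_ob i" "j \<in> cat_obj I" "y \<in> fib_ob j" "a \<in> cat_hom I i j"
  shows "linear_map K (gr_component X (i, x) (j, y) a) (kcat_hom E (fun_obj (S i) x) (fun_obj (S j) y))
    (\<lambda>m. kcat_comp E (fun_obj (S i) x) (fun_obj (S j) (push_ob i j a x)) (fun_obj (S j) y)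
         (fun_mor (S j) (push_ob i j a x) y m) (\<xi> i j a x))"
  unfolding gr_component_apply
  by (intro linear_map_comp[OF k_functor_linear[OF S] E.comp_linear_left] assms S_obj \<xi>_closed dia_obj_closed)

lemma gr_lift_linear:
  assumes "i \<in> cat_obj I" "x \<in> fib_ob i" "j \<in> cat_obj I" "y \<in> fib_ob j"
  shows "linear_map K (kcat_hom Gr (i, x) (j, y)) (kcat_hom E (fun_obj (S i) x) (fun_obj (S j) y))
    (fun_mor (gr_lift E S \<xi>) (i, x) (j, y))"
  unfolding grothendieck_simps gr_lift_def functor_data.simps prod.case
  by (rule direct_sum_lift_linear)
    (use assms in \<open>auto intro!: module_gr_component gr_lift_summand E.hom_module S_obj\<close>)

lemma gr_lift_single:
  assumes "i \<in> cat_obj I" "x \<in> fib_ob i" "j \<in> cat_obj I" "y \<in> fib_ob j" "a \<in> cat_hom I i j"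
    and "m \<in> carrier (fib_hom j (push_ob i j a x) y)"
  shows "fun_mor (gr_lift E S \<xi>) (i, x) (j, y) (single (gr_component X (i, x) (j, y)) a m) =
    kcat_comp E (fun_obj (S i) x) (fun_obj (S j) (push_ob i j a x)) (fun_obj (S j) y)
      (fun_mor (S j) (push_ob i j a x) y m) (\<xi> i j a x)"
  unfolding gr_lift_def functor_data.simps prod.case
  by (rule direct_sum_lift_single[where K = K])
    (use assms in \<open>auto simp: gr_component_apply[symmetric] intro!: module_gr_component gr_lift_summand E.hom_module S_obj\<close>)

text \<open>For multiplicativity on homogeneous morphisms, naturality of \<open>\<xi>\<close> moves it past the
  factor \<open>S j m\<close> that stands between the two instances of \<open>\<xi>\<close>.\<close>

lemma k_functor_gr_lift: "k_functor K Gr E (gr_lift E S \<xi>)"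
proof (rule k_functorI)
  let ?F = "gr_lift E S \<xi>" and ?S = "\<lambda>u v. single (gr_component X u v)"
  note objs = grothendieck_simps(1)
  note lin = gr_lift_linear
  show "k_category K Gr" "k_category K E" by (rule k_category_grothendieck E)+
  fix u assume "u \<in> kcat_obj Gr"
  then obtain i x where u: "u = (i, x)" "i \<in> cat_obj I" "x \<in> fib_ob i" by (cases u) (auto simp: objs)
  interpret Xi: k_category K "dia_obj X i" using u by (intro dia_cat)
  show "fun_obj ?F u \<in> kcat_obj E" using u by (simp add: gr_lift_obj S_obj)
  have "fun_mor ?F (i, x) (i, x) (kcat_id Gr (i, x)) = kcat_id E (fun_obj (S i) x)"
    unfolding grothendieck_simps
    by (subst gr_lift_single[OF u(2,3) u(2,3) I.id_hom[OF u(2)] gr_single_arrow_id[OF u(2,3)]])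
      (use u in \<open>simp add: dia_id \<xi>_id k_functor_id[OF S] E.k_id_left E.k_id S_obj\<close>)
  then show "fun_mor ?F u u (kcat_id Gr u) = kcat_id E (fun_obj ?F u)"
    by (simp add: u gr_lift_obj)
  fix v assume "v \<in> kcat_obj Gr"
  then obtain j y where v: "v = (j, y)" "j \<in> cat_obj I" "y \<in> fib_ob j" by (cases v) (auto simp: objs)
  show "linear_map K (kcat_hom Gr u v) (kcat_hom E (fun_obj ?F u) (fun_obj ?F v)) (fun_mor ?F u v)"
    using u v lin by (simp add: gr_lift_obj)
  fix w f g assume "w \<in> kcat_obj Gr"
  then obtain k z where w: "w = (k, z)" "k \<in> cat_obj I" "z \<in> fib_ob k" by (cases w) (auto simp: objs)
  interpret Xk: k_category K "dia_obj X k" using w by (intro dia_cat)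
  assume "f \<in> Hom Gr u v" "g \<in> Hom Gr v w"
  then have f: "f \<in> Hom Gr (i, x) (j, y)" and g: "g \<in> Hom Gr (j, y) (k, z)"
    using u v w by simp_all
  note U = u(2,3) and V = v(2,3) and W = w(2,3)
  let ?c = "kcat_comp Gr (i, x) (j, y) (k, z)"
  let ?d = "kcat_comp E (fun_obj (S i) x) (fun_obj (S j) y) (fun_obj (S k) z)"
  have homog: "fun_mor ?F (i, x) (k, z) (?c (?S (j, y) (k, z) b n) (?S (i, x) (j, y) a m)) =
      ?d (fun_mor ?F (j, y) (k, z) (?S (j, y) (k, z) b n)) (fun_mor ?F (i, x) (j, y) (?S (i, x) (j, y) a m))"
    if a: "a \<in> cat_hom I i j" "m \<in> carrier (fib_hom j (push_ob i j a x) y)"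
      and b: "b \<in> cat_hom I j k" "n \<in> carrier (fib_hom k (push_ob j k b y) z)" for a m b n
  proof -
    let ?ba = "cat_comp I i j k b a" and ?bm = "push_mor j k b (push_ob i j a x) y m"
    have o: "push_ob i j a x \<in> fib_ob j" "push_ob j k b (push_ob i j a x) \<in> fib_ob k" "push_ob j k b y \<in> fib_ob k"
      using a b U V W by (auto intro!: dia_obj_closed)
    have bm: "?bm \<in> carrier (fib_hom k (push_ob j k b (push_ob i j a x)) (push_ob j k b y))"
      using a b o V W by (intro dia_mor_closed)
    let ?nm = "kcat_comp (dia_obj X k) (push_ob j k b (push_ob i j a x)) (push_ob j k b y) z n ?bm"
    have nm: "?nm \<in> carrier (fib_hom k (push_ob i k ?ba x) z)"
      using a b bm o U V W by (auto simp: dia_comp intro!: Xk.k_comp_closed)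
    have "fun_mor ?F (i, x) (k, z) (?c (?S (j, y) (k, z) b n) (?S (i, x) (j, y) a m)) =
        fun_mor ?F (i, x) (k, z) (?S (i, x) (k, z) ?ba ?nm)"
      by (simp only: gr_comp_single[OF U V W a b])
    also have "\<dots> = kcat_comp E (fun_obj (S i) x) (fun_obj (S k) (push_ob j k b (push_ob i j a x))) (fun_obj (S k) z)
        (fun_mor (S k) (push_ob j k b (push_ob i j a x)) z ?nm) (\<xi> i k ?ba x)"
      by (subst gr_lift_single[OF U W _ nm]) (use a b U V W in \<open>auto simp: dia_comp intro!: I.comp_hom\<close>)
    also have "\<dots> = kcat_comp E (fun_obj (S i) x) (fun_obj (S k) (push_ob j k b (push_ob i j a x))) (fun_obj (S k) z)
        (kcat_comp E (fun_obj (S k) (push_ob j k b (push_ob i j a x))) (fun_obj (S k) (push_ob j k b y)) (fun_obj (S k) z)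
          (fun_mor (S k) (push_ob j k b y) z n) (fun_mor (S k) (push_ob j k b (push_ob i j a x)) (push_ob j k b y) ?bm))
        (kcat_comp E (fun_obj (S i) x) (fun_obj (S j) (push_ob i j a x)) (fun_obj (S k) (push_ob j k b (push_ob i j a x)))
          (\<xi> j k b (push_ob i j a x)) (\<xi> i j a x))"
      using a b bm o U V W by (simp add: k_functor_comp[OF S] \<xi>_comp)
    also have "\<dots> = ?d
        (kcat_comp E (fun_obj (S j) y) (fun_obj (S k) (push_ob j k b y)) (fun_obj (S k) z)
          (fun_mor (S k) (push_ob j k b y) z n) (\<xi> j k b y))
        (kcat_comp E (fun_obj (S i) x) (fun_obj (S j) (push_ob i j a x)) (fun_obj (S j) y)
          (fun_mor (S j) (push_ob i j a x) y m) (\<xi> i j a x))"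
      by (rule E.comp_exchange_middle; (intro \<xi>_natural[symmetric])?)
        (use a b bm o U V W in \<open>auto intro!: S_obj k_functor_mor[OF S] \<xi>_closed\<close>)
    also have "\<dots> = ?d (fun_mor ?F (j, y) (k, z) (?S (j, y) (k, z) b n)) (fun_mor ?F (i, x) (j, y) (?S (i, x) (j, y) a m))"
      by (simp only: gr_lift_single[OF U V a] gr_lift_single[OF V W b])
    finally show ?thesis .
  qed
  (* From homogeneous morphisms to arbitrary f, and then to arbitrary g. *)
  note ext = gr_hom_ext[OF _ _ _ _ E.hom_module[OF S_obj[OF U] S_obj[OF W]]]
  note cl = linear_map_closed[OF lin]
  note lr = E.comp_linear_right[OF S_obj[OF U] S_obj[OF V] S_obj[OF W]]
  note ll = E.comp_linear_left[OF S_obj[OF U] S_obj[OF V] S_obj[OF W]]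
  have f1: "fun_mor ?F (i, x) (k, z) (?c (?S (j, y) (k, z) b n) f) =
      ?d (fun_mor ?F (j, y) (k, z) (?S (j, y) (k, z) b n)) (fun_mor ?F (i, x) (j, y) f)"
    if b: "b \<in> cat_hom I j k" "n \<in> carrier (fib_hom k (push_ob j k b y) z)" for b n
    by (rule ext[OF U V linear_map_comp[OF gr_comp_linear(1)[OF U V W] lin[OF U W]]
          linear_map_comp[OF lin[OF U V] lr] homog f])
      (use b V W in \<open>auto intro!: gr_single_closed cl\<close>)
  have "fun_mor ?F (i, x) (k, z) (?c g f) = ?d (fun_mor ?F (j, y) (k, z) g) (fun_mor ?F (i, x) (j, y) f)"
    by (rule ext[OF V W linear_map_comp[OF gr_comp_linear(2)[OF U V W f] lin[OF U W]]
          linear_map_comp[OF lin[OF V W] ll] f1 g])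
      (use f U V in \<open>auto intro!: cl\<close>)
  then show "fun_mor ?F u w (kcat_comp Gr u v w g f) =
      kcat_comp E (fun_obj ?F u) (fun_obj ?F v) (fun_obj ?F w) (fun_mor ?F v w g) (fun_mor ?F u v f)"
    by (simp add: u(1) v(1) w(1) gr_lift_obj)
qed

end

section \<open>Quotients of path categories\<close>

text \<open>A path determines its two ends, so only the zero morphism is shared by different hom-sets.  This
  is needed because elements of a set of relations do not carry a source and a target.\<close>

lemma path_hom_unique:
  assumes Q: "wf_digraph Q"
    and f: "f \<in> Hom (path_kcategory K Q) u v" "f \<in> Hom (path_kcategory K Q) u' v'"
  shows "u = u' \<and> v = v' \<or> f = \<zero>\<^bsub>kcat_hom (path_kcategory K Q) w z\<^esub>"
proof (cases "\<exists>p. f p \<noteq> \<zero>\<^bsub>K\<^esub>")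
  case True
  interpret wf_digraph Q by fact
  from True obtain p where "f p \<noteq> \<zero>\<^bsub>K\<^esub>" ..
  then have "p \<in> cat_hom (path_category Q) u v" "p \<in> cat_hom (path_category Q) u' v'"
    using f by (cases p; auto simp: path_kcategory_simps free_module_def direct_sum_simps)+
  then obtain es where "awalk u es v" "awalk u es v'" "u = u'" by (auto simp: path_category_simps)
  then show ?thesis by (metis awlast_if_cas awalkE')
next
  case False
  then show ?thesis
    by (auto simp: path_kcategory_simps free_module_def direct_sum_simps fun_eq_iff)
qed

context
  fixes K :: "'k ring" and Q :: "('v, 'e) pre_digraph" and S :: "(('v, 'e) path \<Rightarrow> 'k) set"
  assumes K: "cring K" and Q: "wf_digraph Q"
begin

lemmas path_k = k_category_path_kcategory[OF K Q]
lemmas path_ideal = kcat_ideal_ideal_generated[OF path_k, of S]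

lemma quiver_quotient_obj: "kcat_obj (quiver_quotient K Q S) = verts Q"
  by (simp add: quiver_quotient_def quotient_kcat_simps path_kcategory_simps)

lemma k_category_quiver_quotient: "k_category K (quiver_quotient K Q S)"
  unfolding quiver_quotient_def by (rule k_category_quotient_kcat[OF path_k path_ideal])

lemma k_functor_canonical: "k_functor K (path_kcategory K Q) (quiver_quotient K Q S) (canonical_morphism K Q S)"
  unfolding quiver_quotient_def canonical_morphism_def
  by (rule k_functor_quotient_functor[OF path_k path_ideal])

lemma canonical_obj: "fun_obj (canonical_morphism K Q S) u = u"
  by (simp add: canonical_morphism_def quotient_functor_simps)

lemma canonical_eq_zero_iff:
  assumes "u \<in> verts Q" "v \<in> verts Q" "f \<in> Hom (path_kcategory K Q) u v"
  shows "fun_mor (canonical_morphism K Q S) u v f = \<zero>\<^bsub>kcat_hom (quiver_quotient K Q S) u v\<^esub> \<longleftrightarrow>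
    f \<in> ideal_generated K (path_kcategory K Q) S u v"
  using quotient_functor_eq_zero_iff[OF path_k path_ideal] assms
  by (simp add: canonical_morphism_def quotient_functor_simps quiver_quotient_def path_kcategory_simps(1))

lemma quiver_quotient_homE:
  assumes "F \<in> Hom (quiver_quotient K Q S) u v" "u \<in> verts Q" "v \<in> verts Q"
  obtains f where "f \<in> Hom (path_kcategory K Q) u v" "F = fun_mor (canonical_morphism K Q S) u v f"
  using quotient_kcat_homE[OF path_k path_ideal] assms
  by (metis canonical_morphism_def quotient_functor_simps(2) quiver_quotient_def path_kcategory_simps(1))

lemma quiver_quotient_lift:
  assumes F: "k_functor K (path_kcategory K Q) D F"
    and kill: "\<And>f. f \<in> S \<Longrightarrow> \<exists>u\<in>verts Q. \<exists>v\<in>verts Q. f \<in> Hom (path_kcategory K Q) u v \<and>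
      fun_mor F u v f = \<zero>\<^bsub>kcat_hom D (fun_obj F u) (fun_obj F v)\<^esub>"
  shows k_functor_quiver_quotient_lift: "k_functor K (quiver_quotient K Q S) D (quotient_lift F)"
    and quiver_quotient_lift_canonical: "u \<in> verts Q \<Longrightarrow> v \<in> verts Q \<Longrightarrow>
      f \<in> Hom (path_kcategory K Q) u v \<Longrightarrow>
      fun_mor (quotient_lift F) u v (fun_mor (canonical_morphism K Q S) u v f) = fun_mor F u v f"
proof -
  have *: "fun_mor F x y f = \<zero>\<^bsub>kcat_hom D (fun_obj F x) (fun_obj F y)\<^esub>"
    if xy: "x \<in> kcat_obj (path_kcategory K Q)" "y \<in> kcat_obj (path_kcategory K Q)"
      and f: "f \<in> ideal_generated K (path_kcategory K Q) S x y" for x y f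
  proof (rule ideal_generated_killed[OF F _ f])
    fix u v g assume uv: "u \<in> kcat_obj (path_kcategory K Q)" "v \<in> kcat_obj (path_kcategory K Q)"
      and g: "g \<in> S" "g \<in> Hom (path_kcategory K Q) u v"
    obtain u' v' where u': "g \<in> Hom (path_kcategory K Q) u' v'"
        "fun_mor F u' v' g = \<zero>\<^bsub>kcat_hom D (fun_obj F u') (fun_obj F v')\<^esub>" using kill[OF g(1)] by auto
    show "fun_mor F u v g = \<zero>\<^bsub>kcat_hom D (fun_obj F u) (fun_obj F v)\<^esub>"
      using path_hom_unique[OF Q g(2) u'(1), of u v] u'(2) k_functor_zero[OF F uv] by auto
  qed
  show "k_functor K (quiver_quotient K Q S) D (quotient_lift F)"
    unfolding quiver_quotient_def by (rule k_functor_quotient_lift[OF F path_ideal *])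
  show "fun_mor (quotient_lift F) u v (fun_mor (canonical_morphism K Q S) u v f) = fun_mor F u v f"
    if "u \<in> verts Q" "v \<in> verts Q" "f \<in> Hom (path_kcategory K Q) u v"
    unfolding canonical_morphism_def quotient_functor_simps
    by (rule quotient_lift_mor[OF F path_ideal *]) (use that in \<open>auto simp: path_kcategory_simps(1)\<close>)
qed

end


section \<open>The quiver of the Grothendieck construction\<close>

locale presented_diagram =
  fixes K :: "'k ring"
    and Q :: "('q, 'a) pre_digraph"
    and R :: "(('q, 'a) path \<times> ('q, 'a) path) set"
    and X :: "('q, ('q, 'a) path set, 'v, (('v, 'e) path \<Rightarrow> 'k) set, 'k) diagram"
    and Qs :: "'q \<Rightarrow> ('v, 'e) pre_digraph"
    and Rs :: "'q \<Rightarrow> (('v, 'e) path \<Rightarrow> 'k) set"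
  assumes K: "cring K" and Q: "wf_digraph Q"
    and X: "functor_to_kCat K (presented_category Q R) X"
    and Qs: "\<And>i. i \<in> verts Q \<Longrightarrow> wf_digraph (Qs i)"
    and Rs: "\<And>i. i \<in> verts Q \<Longrightarrow> Rs i \<subseteq> kcat_morphisms (path_kcategory K (Qs i))"
    and X_obj: "\<And>i. i \<in> verts Q \<Longrightarrow> dia_obj X i = quiver_quotient K (Qs i) (Rs i)"

sublocale presented_diagram \<subseteq> linear_diagram K "presented_category Q R" X
  by (intro linear_diagram.intro K X)

sublocale presented_diagram \<subseteq> Q: wf_digraph Q by (rule Q)

context presented_diagram
begin

text \<open>\<open>push i j p x\<close> is the vertex \<open>px\<close>.\<close>

abbreviation "I \<equiv> presented_category Q R"
abbreviation "P \<equiv> path_category Q"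
abbreviation "cls i j p \<equiv> path_class Q R i j (i, p)"
abbreviation "push i j p x \<equiv> act Q R X i j (i, p) x"
abbreviation "kQs i \<equiv> path_kcategory K (Qs i)"
abbreviation "\<Phi> i \<equiv> canonical_morphism K (Qs i) (Rs i)"
abbreviation "Q' \<equiv> gr_quiver Q R X Qs"
abbreviation "kQ' \<equiv> path_kcategory K Q'"

interpretation P: category P by (rule category_path_category[OF Q])

lemma I_obj: "cat_obj I = verts Q"
  by (simp add: presented_category_def quotient_cat_def path_category_simps)

lemma cls_closed: "Q.awalk i p j \<Longrightarrow> cls i j p \<in> cat_hom I i j"
  unfolding presented_category_def quotient_cat_def path_class_def cat.simps
  by (rule quotientI) (simp add: path_category_simps)

lemma I_homE:
  assumes "A \<in> cat_hom I i j"
  obtains p where "Q.awalk i p j" "A = cls i j p"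
  using assms unfolding presented_category_def quotient_cat_def path_class_def cat.simps
  by (elim quotientE) (auto simp: path_category_simps)

lemma I_id: "cat_id I i = cls i i []"
  by (simp add: presented_category_def quotient_cat_def path_class_def path_category_simps)

lemma I_comp:
  assumes "Q.awalk i p j" "Q.awalk j q k"
  shows "cat_comp I i j k (cls j k q) (cls i j p) = cls i k (p @ q)"
proof -
  have "i \<in> verts Q" "j \<in> verts Q" "k \<in> verts Q" using assms by auto
  then show ?thesis
    using P.quotient_cat_comp_class[of i j k "(i, p)" "(j, q)" R] assms
    by (simp add: presented_category_def path_class_def path_category_simps)
qed

lemma cls_eq_iff:
  assumes "Q.awalk i p j" "Q.awalk i q j"
  shows "cls i j p = cls i j q \<longleftrightarrow> ((i, p), (i, q)) \<in> generated_equiv P R i j"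
proof -
  have "i \<in> verts Q" "j \<in> verts Q" using assms by auto
  then show ?thesis
    unfolding path_class_def using assms
    by (intro eq_equiv_class_iff[OF P.generated_equiv_equiv]) (auto simp: path_category_simps)
qed

lemma fib_ob_simps: "i \<in> verts Q \<Longrightarrow> fib_ob i = verts (Qs i)"
  by (simp add: X_obj quiver_quotient_obj[OF K Qs])

lemma push_def: "push i j p x = push_ob i j (cls i j p) x"
  by (simp add: act_def)

lemma push_closed: "Q.awalk i p j \<Longrightarrow> x \<in> verts (Qs i) \<Longrightarrow> push i j p x \<in> verts (Qs j)"
  using dia_obj_closed[of i j "cls i j p" x] cls_closed[of i p j] fib_ob_simps[of i] fib_ob_simps[of j]
    Q.awalk_hd_in_verts[of i p j] Q.awalk_last_in_verts[of i p j] by (auto simp: I_obj push_def)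

lemma push_Nil: "i \<in> verts Q \<Longrightarrow> x \<in> verts (Qs i) \<Longrightarrow> push i i [] x = x"
  using dia_id(1)[of i x] by (simp add: I_obj I_id fib_ob_simps push_def)

lemma push_append:
  assumes "Q.awalk i p j" "Q.awalk j q k" "x \<in> verts (Qs i)"
  shows "push i k (p @ q) x = push j k q (push i j p x)"
proof -
  have "i \<in> verts Q" "j \<in> verts Q" "k \<in> verts Q" using assms by auto
  then show ?thesis
    using dia_comp(1)[of i j k "cls i j p" "cls j k q" x] assms
    by (simp add: I_obj cls_closed I_comp fib_ob_simps push_def)
qed

lemma k_functor_\<Phi>: "i \<in> verts Q \<Longrightarrow> k_functor K (kQs i) (dia_obj X i) (\<Phi> i)"
  by (simp add: X_obj k_functor_canonical[OF K Qs])

lemma \<Phi>_obj: "i \<in> verts Q \<Longrightarrow> fun_obj (\<Phi> i) x = x"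
  by (rule canonical_obj[OF K Qs])

lemma \<Phi>_closed:
  assumes "i \<in> verts Q" "x \<in> verts (Qs i)" "y \<in> verts (Qs i)" "f \<in> Hom (kQs i) x y"
  shows "fun_mor (\<Phi> i) x y f \<in> carrier (fib_hom i x y)"
  using k_functor_mor[OF k_functor_\<Phi>, of i x y f] assms by (simp add: path_kcategory_simps(1) \<Phi>_obj)

lemma \<Phi>_surj:
  assumes "F \<in> carrier (fib_hom i x y)" "i \<in> verts Q" "x \<in> verts (Qs i)" "y \<in> verts (Qs i)"
  obtains f where "f \<in> Hom (kQs i) x y" "F = fun_mor (\<Phi> i) x y f"
  using assms quiver_quotient_homE[OF K Qs, of i F "Rs i" x y] by (auto simp: X_obj)

lemma gr_quiver_simps:
  "(i, x) \<in> verts Q' \<longleftrightarrow> i \<in> verts Q \<and> x \<in> verts (Qs i)"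
  "Inner i \<alpha> \<in> arcs Q' \<longleftrightarrow> i \<in> verts Q \<and> \<alpha> \<in> arcs (Qs i)"
  "Cross a i x \<in> arcs Q' \<longleftrightarrow> a \<in> arcs Q \<and> i = tail Q a \<and> x \<in> verts (Qs i)"
  "tail Q' (Inner i \<alpha>) = (i, tail (Qs i) \<alpha>)" "head Q' (Inner i \<alpha>) = (i, head (Qs i) \<alpha>)"
  "tail Q' (Cross a i x) = (i, x)"
  "head Q' (Cross a i x) = (head Q a, push (tail Q a) (head Q a) [a] x)"
  by (auto simp: gr_quiver_def arrow_path_def)

lemma gr_arcE:
  assumes "e \<in> arcs Q'"
  obtains i \<alpha> where "e = Inner i \<alpha>" "i \<in> verts Q" "\<alpha> \<in> arcs (Qs i)"
  | a x where "e = Cross a (tail Q a) x" "a \<in> arcs Q" "x \<in> verts (Qs (tail Q a))"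
  using assms by (cases e) (auto simp: gr_quiver_simps)

lemma wf_gr_quiver: "wf_digraph Q'"
proof
  fix e assume "e \<in> arcs Q'"
  then show "tail Q' e \<in> verts Q'" "head Q' e \<in> verts Q'"
    by (cases rule: gr_arcE;
        simp add: gr_quiver_simps wf_digraph.tail_in_verts[OF Qs] wf_digraph.head_in_verts[OF Qs]
          push_closed Q.arc_implies_awalk)+
qed

sublocale Q': wf_digraph Q' by (rule wf_gr_quiver)

text \<open>The arrows of the path \<open>\<pi>(p, x)\<close>.\<close>

definition cross_arrows :: "'q \<Rightarrow> 'a list \<Rightarrow> 'v \<Rightarrow> ('q, 'a, 'v, 'e) gr_arrow list" where
  "cross_arrows i p x = snd (cross_path Q R X (i, p) x :: ('q \<times> 'v, ('q, 'a, 'v, 'e) gr_arrow) path)"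

lemma cross_path_eq: "cross_path Q R X (i, p) x = ((i, x), cross_arrows i p x)"
  by (simp add: cross_arrows_def cross_path_def)

lemma cross_arrows_map: "cross_arrows i p x = map (\<lambda>k. let q = take k p; ik = Q.awlast i q in Cross (p ! k) ik (push i ik q x)) [0..<length p]"
  by (simp add: cross_arrows_def cross_path_def)

lemma cross_arrows_Nil: "cross_arrows i [] x = []"
  by (simp add: cross_arrows_map)

lemma cross_arrows_arrow: "a \<in> arcs Q \<Longrightarrow> x \<in> verts (Qs (tail Q a)) \<Longrightarrow> cross_arrows (tail Q a) [a] x = [Cross a (tail Q a) x]"
  by (simp add: cross_arrows_map push_Nil)

text \<open>\<open>\<pi>(qp, x) = \<pi>(q, px) \<pi>(p, x)\<close>: the vertices met along the second part are the translates of \<open>px\<close>, by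
  functoriality of \<open>X\<close>.\<close>

lemma cross_arrows_append:
  assumes p: "Q.awalk i p j" and q: "Q.awalk j q k" and x: "x \<in> verts (Qs i)"
  shows "cross_arrows i (p @ q) x = cross_arrows i p x @ cross_arrows j q (push i j p x)"
proof -
  have "[0..<length (p @ q)] = [0..<length p] @ map (\<lambda>n. n + length p) [0..<length q]"
    using upt_add_eq_append[of 0 "length p" "length q"] map_add_upt[of "length p" "length q"]
    by (simp add: add.commute)
  moreover have "Q.awlast i (p @ take n q) = Q.awlast j (take n q)"
    and "push i (Q.awlast j (take n q)) (p @ take n q) x = push j (Q.awlast j (take n q)) (take n q) (push i j p x)" for n
  proof -
    have "Q.awlast i p = j" using p by auto
    then show "Q.awlast i (p @ take n q) = Q.awlast j (take n q)" by (simp add: Q.awlast_append)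
    have "Q.awalk j (take n q @ drop n q) k" using q by simp
    then have "Q.awalk j (take n q) (Q.awlast j (take n q))" by (simp only: Q.awalk_append_iff)
    then show "push i (Q.awlast j (take n q)) (p @ take n q) x =
        push j (Q.awlast j (take n q)) (take n q) (push i j p x)"
      using p x by (intro push_append)
  qed
  ultimately show ?thesis by (simp add: cross_arrows_map nth_append Let_def del: upt_Suc)
qed

lemma cross_arrows_Cons:
  assumes "Q.awalk i (a # p) j" and "x \<in> verts (Qs i)"
  shows "cross_arrows i (a # p) x = Cross a i x # cross_arrows (head Q a) p (push i (head Q a) [a] x)"
proof -
  have a: "a \<in> arcs Q" "i = tail Q a" "Q.awalk (head Q a) p j" using assms by (auto simp: Q.awalk_Cons_iff)
  show ?thesis
    using cross_arrows_append[OF Q.arc_implies_awalk[OF a(1)] a(3), of x] assms(2) a by (simp add: cross_arrows_arrow)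
qed

lemma cross_arrows_awalk: "Q.awalk i p j \<Longrightarrow> x \<in> verts (Qs i) \<Longrightarrow> Q'.awalk (i, x) (cross_arrows i p x) (j, push i j p x)"
proof (induction p arbitrary: i x)
  case Nil
  then have "i = j" "i \<in> verts Q" by (auto simp: Q.awalk_Nil_iff)
  then show ?case using Nil.prems(2) by (simp add: cross_arrows_Nil Q'.awalk_Nil_iff gr_quiver_simps push_Nil)
next
  case (Cons a p)
  then have a: "a \<in> arcs Q" "i = tail Q a" "Q.awalk (head Q a) p j" by (auto simp: Q.awalk_Cons_iff)
  have "push i (head Q a) [a] x \<in> verts (Qs (head Q a))"
    using a Cons.prems by (auto intro!: push_closed Q.arc_implies_awalk)
  moreover have "push i j (a # p) x = push (head Q a) j p (push i (head Q a) [a] x)"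
    using push_append[OF Q.arc_implies_awalk[OF a(1)] a(3), of x] Cons.prems a by simp
  ultimately show ?case
    using Cons.IH[OF a(3)] a(1,2) Cons.prems(2)
    unfolding cross_arrows_Cons[OF Cons.prems] Q'.awalk_Cons_iff gr_quiver_simps by simp
qed

lemma cross_arrows_closed:
  "Q.awalk i p j \<Longrightarrow> x \<in> verts (Qs i) \<Longrightarrow>
    path_morphism K ((i, x), cross_arrows i p x) \<in> Hom kQ' (i, x) (j, push i j p x)"
  by (rule path_morphism_closed[OF K cross_arrows_awalk])

definition \<sigma> :: "'q \<Rightarrow> ('v, ('v, 'e) path \<Rightarrow> 'k, 'q \<times> 'v, ('q \<times> 'v, ('q, 'a, 'v, 'e) gr_arrow) path \<Rightarrow> 'k) functor_data"
  where "\<sigma> i = \<lparr>fun_obj = Pair i, fun_mor = sigma K (Qs i) Q' i\<rparr>"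

lemma \<sigma>_simps: "fun_obj (\<sigma> i) x = (i, x)" "fun_mor (\<sigma> i) = sigma K (Qs i) Q' i"
  by (simp_all add: \<sigma>_def)

lemma inner_awalk:
  assumes "i \<in> verts Q" "pre_digraph.awalk (Qs i) x es y"
  shows "Q'.awalk (i, x) (map (Inner i) es) (i, y)"
proof -
  interpret Qi: wf_digraph "Qs i" using assms(1) by (rule Qs)
  show ?thesis
    using assms(2)
    by (induction es arbitrary: x)
      (auto simp: Qi.awalk_Nil_iff Qi.awalk_Cons_iff Q'.awalk_Nil_iff Q'.awalk_Cons_iff gr_quiver_simps assms(1))
qed

lemma \<sigma>_linear_extension:
  "\<sigma> i = linear_extension K (path_category (Qs i)) kQ' (Pair i) (\<lambda>x y p. path_morphism K (inner_path i p))"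
  by (simp add: \<sigma>_def linear_extension_def sigma_def fun_eq_iff)

lemma k_functor_\<sigma>:
  assumes i: "i \<in> verts Q"
  shows "k_functor K (kQs i) kQ' (\<sigma> i)"
  unfolding \<sigma>_linear_extension path_kcategory_def[of K "Qs i"]
proof (rule k_functor_linear_extension[OF K category_path_category[OF Qs[OF i]] k_category_path_kcategory[OF K wf_gr_quiver]])
  interpret Qi: wf_digraph "Qs i" using i by (rule Qs)
  fix x assume x: "x \<in> cat_obj (path_category (Qs i))"
  then show "(i, x) \<in> kcat_obj kQ'" using i by (simp add: path_kcategory_simps path_category_simps gr_quiver_simps)
  show "path_morphism K (inner_path i (cat_id (path_category (Qs i)) x)) = kcat_id kQ' (i, x)"
    by (simp add: path_kcategory_simps path_category_simps inner_path_def)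
  fix y p assume p: "p \<in> cat_hom (path_category (Qs i)) x y"
  then obtain es where es: "p = (x, es)" "Qi.awalk x es y" by (auto simp: path_category_simps)
  then show "path_morphism K (inner_path i p) \<in> Hom kQ' (i, x) (i, y)"
    by (auto simp: inner_path_def intro!: path_morphism_closed[OF K] inner_awalk[OF i])
  fix z q assume "q \<in> cat_hom (path_category (Qs i)) y z"
  then obtain fs where fs: "q = (y, fs)" "Qi.awalk y fs z" by (auto simp: path_category_simps)
  show "path_morphism K (inner_path i (cat_comp (path_category (Qs i)) x y z q p)) =
      kcat_comp kQ' (i, x) (i, y) (i, z) (path_morphism K (inner_path i q)) (path_morphism K (inner_path i p))"
    using es fs path_morphism_comp[OF K wf_gr_quiver inner_awalk[OF i es(2)] inner_awalk[OF i fs(2)]]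
    by (simp add: inner_path_def path_category_simps)
qed

lemma \<sigma>_closed:
  assumes "i \<in> verts Q" "x \<in> verts (Qs i)" "y \<in> verts (Qs i)" "f \<in> Hom (kQs i) x y"
  shows "sigma K (Qs i) Q' i x y f \<in> Hom kQ' (i, x) (i, y)"
  using k_functor_mor[OF k_functor_\<sigma>[OF assms(1)], of x y f] assms by (simp add: path_kcategory_simps(1) \<sigma>_simps)

lemma \<sigma>_arrow:
  assumes i: "i \<in> verts Q" and \<alpha>: "\<alpha> \<in> arcs (Qs i)"
  shows "sigma K (Qs i) Q' i (tail (Qs i) \<alpha>) (head (Qs i) \<alpha>) (arrow_mor K (Qs i) \<alpha>) =
    arrow_mor K Q' (Inner i \<alpha>)"
proof -
  interpret Qi: wf_digraph "Qs i" using i by (rule Qs)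
  have "fun_mor (\<sigma> i) (tail (Qs i) \<alpha>) (head (Qs i) \<alpha>) (arrow_mor K (Qs i) \<alpha>) =
      path_morphism K (inner_path i (arrow_path (Qs i) \<alpha>))"
    unfolding \<sigma>_linear_extension path_morphism_def[of K "arrow_path (Qs i) \<alpha>"]
  proof (rule linear_extension_basis[OF K category_path_category[OF Qs[OF i]] k_category_path_kcategory[OF K wf_gr_quiver]])
    show "arrow_path (Qs i) \<alpha> \<in> cat_hom (path_category (Qs i)) (tail (Qs i) \<alpha>) (head (Qs i) \<alpha>)"
      using \<alpha> by (simp add: path_category_simps arrow_path_def Qi.arc_implies_awalk)
  qed (use i \<alpha> in \<open>auto simp: path_category_simps path_kcategory_simps(1) gr_quiver_simps inner_path_def
        intro!: path_morphism_closed[OF K] inner_awalk\<close>)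
  then show ?thesis by (simp add: \<sigma>_simps inner_path_def arrow_path_def gr_quiver_simps)
qed


section \<open>The functor from the path category to the Grothendieck construction\<close>

text \<open>An inner arrow is sent to its class in the fibre, placed in the degree of an identity, and a crossing
  arrow \<open>(a, x)\<close> to the identity of \<open>ax\<close>, placed in the degree of \<open>a\<close>.\<close>

definition arrow_value :: "('q, 'a, 'v, 'e) gr_arrow \<Rightarrow> ('q, 'a) path set \<Rightarrow> (('v, 'e) path \<Rightarrow> 'k) set" where
  "arrow_value e = (case e of
     Inner i \<alpha> \<Rightarrow> fun_mor (fibre_inclusion i) (tail (Qs i) \<alpha>) (head (Qs i) \<alpha>)
       (fun_mor (\<Phi> i) (tail (Qs i) \<alpha>) (head (Qs i) \<alpha>) (arrow_mor K (Qs i) \<alpha>))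
   | Cross a i x \<Rightarrow> single (gr_component X (i, x) (head Q a, push i (head Q a) [a] x)) (cls i (head Q a) [a])
       (kcat_id (dia_obj X (head Q a)) (push i (head Q a) [a] x)))"

lemma \<Phi>_arrow_closed:
  assumes "i \<in> verts Q" "\<alpha> \<in> arcs (Qs i)"
  shows "fun_mor (\<Phi> i) (tail (Qs i) \<alpha>) (head (Qs i) \<alpha>) (arrow_mor K (Qs i) \<alpha>)
    \<in> carrier (fib_hom i (tail (Qs i) \<alpha>) (head (Qs i) \<alpha>))"
  using assms by (intro \<Phi>_closed arrow_path_closed[OF K Qs])
    (auto intro: wf_digraph.tail_in_verts[OF Qs] wf_digraph.head_in_verts[OF Qs])

text \<open>The identity of the vertex \<open>px\<close>, placed in the degree of the class of \<open>p\<close>.  It will be the image of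
  the path \<open>\<pi>(p, x)\<close>.\<close>

definition degree_arrow :: "'q \<Rightarrow> 'q \<Rightarrow> 'a list \<Rightarrow> 'v \<Rightarrow> ('q, 'a) path set \<Rightarrow> (('v, 'e) path \<Rightarrow> 'k) set" where
  "degree_arrow i j p x = single (gr_component X (i, x) (j, push i j p x)) (cls i j p) (kcat_id (dia_obj X j) (push i j p x))"

lemma dia_id_closed:
  "i \<in> verts Q \<Longrightarrow> x \<in> verts (Qs i) \<Longrightarrow> kcat_id (dia_obj X i) x \<in> carrier (fib_hom i x x)"
  by (rule k_category.k_id[OF dia_cat]) (simp_all add: I_obj fib_ob_simps)

lemma degree_arrow_closed:
  assumes "Q.awalk i p j" "x \<in> verts (Qs i)"
  shows "degree_arrow i j p x \<in> Hom Gr (i, x) (j, push i j p x)"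
proof -
  have v: "i \<in> verts Q" "j \<in> verts Q" using assms by auto
  show ?thesis
    unfolding degree_arrow_def
    using assms v push_closed[OF assms] dia_id_closed[OF v(2) push_closed[OF assms]] cls_closed[OF assms(1)]
    by (intro gr_single_closed) (auto simp: I_obj fib_ob_simps push_def)
qed

text \<open>For \<open>q\<close> of length zero this writes a homogeneous morphism as one from a fibre after an identity placed
  in its degree.\<close>

lemma single_comp_degree_arrow:
  assumes p: "Q.awalk i p j" and x: "x \<in> verts (Qs i)" and z: "z \<in> verts (Qs k)"
    and q: "Q.awalk j q k" and n: "n \<in> carrier (fib_hom k (push j k q (push i j p x)) z)"
  shows "kcat_comp Gr (i, x) (j, push i j p x) (k, z) (single (gr_component X (j, push i j p x) (k, z)) (cls j k q) n)
      (degree_arrow i j p x) = single (gr_component X (i, x) (k, z)) (cls i k (p @ q)) n"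
proof -
  have v: "i \<in> verts Q" "j \<in> verts Q" "k \<in> verts Q" using p q by auto
  note px = push_closed[OF p x]
  have m: "kcat_id (dia_obj X j) (push i j p x) \<in> carrier (fib_hom j (push_ob i j (cls i j p) x) (push i j p x))"
    using dia_id_closed[OF v(2) px] by (simp add: push_def)
  have f: "k_functor K (dia_obj X j) (dia_obj X k) (dia_mor X j k (cls j k q))"
    using v cls_closed[OF q] by (intro dia_functor) (auto simp: I_obj)
  show ?thesis
    unfolding degree_arrow_def
    using v x z px cls_closed[OF p] cls_closed[OF q] m n I_comp[OF p q] k_functor_id[OF f, of "push i j p x"]
      k_category.k_id_right[OF dia_cat[of k], of "push j k q (push i j p x)" z n] push_closed[OF q px]
    by (subst gr_comp_single) (auto simp: I_obj fib_ob_simps push_def)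
qed

lemma arrow_value_closed:
  assumes "e \<in> arcs Q'"
  shows "arrow_value e \<in> Hom Gr (tail Q' e) (head Q' e)"
  using assms
proof (cases rule: gr_arcE)
  case (1 i \<alpha>)
  interpret Qi: wf_digraph "Qs i" using 1(2) by (rule Qs)
  show ?thesis
    using k_functor_mor[OF k_functor_fibre_inclusion[of i] _ _ \<Phi>_arrow_closed[OF 1(2,3)]] 1
    by (simp add: arrow_value_def gr_quiver_simps I_obj fib_ob_simps fibre_inclusion_simps(1))
next
  case (2 a x)
  then show ?thesis
    using degree_arrow_closed[OF Q.arc_implies_awalk[OF 2(2)] 2(3)]
    by (simp add: arrow_value_def degree_arrow_def gr_quiver_simps)
qed

definition \<Psi> where "\<Psi> = path_functor K Q' Gr (\<lambda>u. u) arrow_value"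

lemma gr_obj: "kcat_obj Gr = verts Q'"
  by (auto simp: grothendieck_def gr_quiver_def I_obj fib_ob_simps)

lemma k_functor_\<Psi>: "k_functor K kQ' Gr \<Psi>"
  unfolding \<Psi>_def
  by (rule k_functor_path_functor[OF K wf_gr_quiver k_category_grothendieck])
    (simp_all add: gr_obj arrow_value_closed)

lemma \<Psi>_obj: "fun_obj \<Psi> u = u"
  unfolding \<Psi>_def
  by (rule path_functor_obj[OF K wf_gr_quiver k_category_grothendieck])
    (simp_all add: gr_obj arrow_value_closed)

lemma \<Psi>_arrow:
  "e \<in> arcs Q' \<Longrightarrow> fun_mor \<Psi> (tail Q' e) (head Q' e) (arrow_mor K Q' e) = arrow_value e"
  unfolding \<Psi>_def
  by (rule path_functor_arrow[OF K wf_gr_quiver k_category_grothendieck])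
    (simp_all add: gr_obj arrow_value_closed)

text \<open>Both sides are functors on the path category of the fibre, and they agree on arrows.\<close>

lemma \<Psi>_\<sigma>:
  assumes i: "i \<in> verts Q" and xy: "x \<in> verts (Qs i)" "y \<in> verts (Qs i)" and f: "f \<in> Hom (kQs i) x y"
  shows "fun_mor \<Psi> (i, x) (i, y) (sigma K (Qs i) Q' i x y f) =
    fun_mor (fibre_inclusion i) x y (fun_mor (\<Phi> i) x y f)"
proof -
  have "fun_mor (comp_functor \<Psi> (\<sigma> i)) x y f = fun_mor (comp_functor (fibre_inclusion i) (\<Phi> i)) x y f"
  proof (rule path_functor_unique[OF K Qs[OF i] k_functor_comp_functor[OF k_functor_\<sigma>[OF i] k_functor_\<Psi>] _ _ _ xy f])
    show "k_functor K (kQs i) Gr (comp_functor (fibre_inclusion i) (\<Phi> i))"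
      using i by (intro k_functor_comp_functor[OF k_functor_\<Phi> k_functor_fibre_inclusion]) (simp_all add: I_obj)
    fix \<alpha> assume \<alpha>: "\<alpha> \<in> arcs (Qs i)"
    then show "fun_mor (comp_functor \<Psi> (\<sigma> i)) (tail (Qs i) \<alpha>) (head (Qs i) \<alpha>) (arrow_mor K (Qs i) \<alpha>) =
        fun_mor (comp_functor (fibre_inclusion i) (\<Phi> i)) (tail (Qs i) \<alpha>) (head (Qs i) \<alpha>) (arrow_mor K (Qs i) \<alpha>)"
      using \<Psi>_arrow[of "Inner i \<alpha>"] i by (simp add: \<sigma>_simps \<sigma>_arrow gr_quiver_simps arrow_value_def \<Phi>_obj)
  qed (simp add: \<sigma>_simps \<Psi>_obj \<Phi>_obj[OF i] fibre_inclusion_simps)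
  then show ?thesis by (simp add: \<sigma>_simps \<Phi>_obj[OF i])
qed

text \<open>The degrees multiply along the path, and all the morphisms that occur are identities.\<close>

lemma \<Psi>_cross:
  "Q.awalk i p j \<Longrightarrow> x \<in> verts (Qs i) \<Longrightarrow>
    fun_mor \<Psi> (i, x) (j, push i j p x) (path_morphism K ((i, x), cross_arrows i p x)) = degree_arrow i j p x"
proof (induction p arbitrary: i x)
  case Nil
  then have "i = j" "i \<in> verts Q" by (auto simp: Q.awalk_Nil_iff)
  then show ?case
    using k_functor_id[OF k_functor_\<Psi>, of "(i, x)"] Nil.prems(2)
    by (simp add: path_kcategory_simps(1,3) gr_quiver_simps cross_arrows_Nil push_Nil degree_arrow_def \<Psi>_obj grothendieck_simps(3) I_id)
next
  case (Cons a p)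
  let ?h = "head Q a" and ?ax = "push i (head Q a) [a] x"
  have a: "a \<in> arcs Q" "i = tail Q a" "Q.awalk ?h p j" using Cons.prems by (auto simp: Q.awalk_Cons_iff)
  have aw: "Q.awalk i [a] ?h" using Q.arc_implies_awalk[OF a(1)] a(2) by simp
  have v: "i \<in> verts Q" "?h \<in> verts Q" "j \<in> verts Q" using a aw by auto
  note ax = push_closed[OF aw Cons.prems(2)]
  note pax = push_closed[OF a(3) ax]
  have acx: "push i j (a # p) x = push ?h j p ?ax" using push_append[OF aw a(3) Cons.prems(2)] by simp
  have aw': "Q'.awalk (i, x) [Cross a i x] (?h, ?ax)"
    using cross_arrows_awalk[OF aw Cons.prems(2)] Cons.prems(2) a by (simp add: cross_arrows_arrow)
  have split: "path_morphism K ((i, x), cross_arrows i (a # p) x) =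
      kcat_comp kQ' (i, x) (?h, ?ax) (j, push ?h j p ?ax) (path_morphism K ((?h, ?ax), cross_arrows ?h p ?ax)) (path_morphism K ((i, x), [Cross a i x]))"
    using path_morphism_comp[OF K wf_gr_quiver aw' cross_arrows_awalk[OF a(3) ax]] by (simp add: cross_arrows_Cons[OF Cons.prems])
  have arr: "fun_mor \<Psi> (i, x) (?h, ?ax) (path_morphism K ((i, x), [Cross a i x])) = degree_arrow i ?h [a] x"
    using \<Psi>_arrow[of "Cross a i x"] a Cons.prems(2)
    by (simp add: gr_quiver_simps arrow_path_def arrow_value_def degree_arrow_def)
  have "fun_mor \<Psi> (i, x) (j, push ?h j p ?ax) (path_morphism K ((i, x), cross_arrows i (a # p) x)) =
      kcat_comp Gr (i, x) (?h, ?ax) (j, push ?h j p ?ax) (degree_arrow ?h j p ?ax) (degree_arrow i ?h [a] x)"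
    unfolding split
    by (subst k_functor_comp[OF k_functor_\<Psi>])
      (use v Cons.prems ax pax path_morphism_closed[OF K aw'] cross_arrows_closed[OF a(3) ax] Cons.IH[OF a(3) ax] arr in
        \<open>simp_all add: path_kcategory_simps(1) gr_quiver_simps \<Psi>_obj\<close>)
  also have "\<dots> = degree_arrow i j (a # p) x"
    unfolding degree_arrow_def[of "head Q a" j]
    using single_comp_degree_arrow[OF aw Cons.prems(2) pax a(3) dia_id_closed[OF v(3) pax]]
    by (simp add: degree_arrow_def acx)
  finally show ?case by (simp add: acx)
qed

section \<open>The defining relations\<close>

text \<open>The third relation with an arbitrary morphism \<open>m\<close> in place of the chosen lift.  Keeping \<open>m\<close> free is what
  allows different choices to be compared.\<close>

definition cross_relation where
  "cross_relation a \<alpha> m = (let i = tail Q a; j = head Q a; x = tail (Qs i) \<alpha>; y = head (Qs i) \<alpha>;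
      ax = push i j [a] x; ay = push i j [a] y
    in kcat_comp kQ' (i, x) (i, y) (j, ay) (arrow_mor K Q' (Cross a i y))
         (arrow_mor K Q' (Inner i \<alpha>))
       \<ominus>\<^bsub>kcat_hom kQ' (i, x) (j, ay)\<^esub>
       kcat_comp kQ' (i, x) (j, ax) (j, ay) (sigma K (Qs j) Q' j ax ay m)
         (arrow_mor K Q' (Cross a i x)))"

lemma gr_relation3_eq: "gr_relation3 K Q R X Qs lift a \<alpha> = cross_relation a \<alpha> (lift a \<alpha>)"
  by (simp add: gr_relation3_def cross_relation_def Let_def arrow_path_def[of Q])

definition lifts_arrow where
  "lifts_arrow a \<alpha> m \<longleftrightarrow> (let i = tail Q a; j = head Q a; x = tail (Qs i) \<alpha>; y = head (Qs i) \<alpha>;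
      ax = push i j [a] x; ay = push i j [a] y
    in m \<in> Hom (kQs j) ax ay \<and>
       fun_mor (\<Phi> j) ax ay m = push_mor i j (cls i j [a]) x y (fun_mor (\<Phi> i) x y (arrow_mor K (Qs i) \<alpha>)))"

lemma admissible_choice_iff:
  "admissible_choice K Q R X Qs Rs lift \<longleftrightarrow>
    (\<forall>a\<in>arcs Q. \<forall>\<alpha>\<in>arcs (Qs (tail Q a)). lifts_arrow a \<alpha> (lift a \<alpha>))"
  unfolding admissible_choice_def lifts_arrow_def by (simp add: arrow_path_def[of Q] Let_def)

lemma arrow_setup:
  assumes "a \<in> arcs Q" "\<alpha> \<in> arcs (Qs (tail Q a))"
  shows "tail Q a \<in> verts Q" "head Q a \<in> verts Q" "tail (Qs (tail Q a)) \<alpha> \<in> verts (Qs (tail Q a))"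
    "head (Qs (tail Q a)) \<alpha> \<in> verts (Qs (tail Q a))"
    "push (tail Q a) (head Q a) [a] (tail (Qs (tail Q a)) \<alpha>) \<in> verts (Qs (head Q a))"
    "push (tail Q a) (head Q a) [a] (head (Qs (tail Q a)) \<alpha>) \<in> verts (Qs (head Q a))"
proof -
  interpret Qi: wf_digraph "Qs (tail Q a)" using assms by (intro Qs) simp
  show "tail Q a \<in> verts Q" "head Q a \<in> verts Q" "tail (Qs (tail Q a)) \<alpha> \<in> verts (Qs (tail Q a))"
    "head (Qs (tail Q a)) \<alpha> \<in> verts (Qs (tail Q a))" using assms by auto
  then show "push (tail Q a) (head Q a) [a] (tail (Qs (tail Q a)) \<alpha>) \<in> verts (Qs (head Q a))"
    "push (tail Q a) (head Q a) [a] (head (Qs (tail Q a)) \<alpha>) \<in> verts (Qs (head Q a))"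
    using push_closed[OF Q.arc_implies_awalk[OF assms(1)]] by auto
qed

lemma dia_mor_cls:
  assumes "Q.awalk i p j" "x \<in> verts (Qs i)" "y \<in> verts (Qs i)" "F \<in> carrier (fib_hom i x y)"
  shows "push_mor i j (cls i j p) x y F \<in> carrier (fib_hom j (push i j p x) (push i j p y))"
proof -
  have "i \<in> verts Q" "j \<in> verts Q" using assms(1) by auto
  then show ?thesis
    using dia_mor_closed[of i j "cls i j p" x y F] assms cls_closed by (simp add: I_obj fib_ob_simps push_def)
qed

lemma ex_lifts_arrow:
  assumes "a \<in> arcs Q" "\<alpha> \<in> arcs (Qs (tail Q a))"
  shows "\<exists>m. lifts_arrow a \<alpha> m"
proof -
  note s = arrow_setup[OF assms]
  show ?thesis
    using \<Phi>_surj[OF dia_mor_cls[OF Q.arc_implies_awalk[OF assms(1)] s(3,4) \<Phi>_arrow_closed[OF s(1) assms(2)]] s(2,5,6)]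
    unfolding lifts_arrow_def Let_def by metis
qed

lemma cross_arrow:
  assumes "a \<in> arcs Q" "x \<in> verts (Qs (tail Q a))"
  shows "arrow_mor K Q' (Cross a (tail Q a) x) = path_morphism K ((tail Q a, x), cross_arrows (tail Q a) [a] x)"
  using assms by (simp add: arrow_path_def gr_quiver_simps cross_arrows_arrow)

lemma cross_relation_terms_closed:
  assumes a: "a \<in> arcs Q" and \<alpha>: "\<alpha> \<in> arcs (Qs (tail Q a))" and m: "lifts_arrow a \<alpha> m"
  defines "i \<equiv> tail Q a" and "j \<equiv> head Q a"
  defines "x \<equiv> tail (Qs i) \<alpha>" and "y \<equiv> head (Qs i) \<alpha>"
  defines "ax \<equiv> push i j [a] x" and "ay \<equiv> push i j [a] y"
  shows "(i, x) \<in> verts Q'" "(i, y) \<in> verts Q'" "(j, ax) \<in> verts Q'" "(j, ay) \<in> verts Q'"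
    "arrow_mor K Q' (Cross a i y) \<in> Hom kQ' (i, y) (j, ay)"
    "arrow_mor K Q' (Inner i \<alpha>) \<in> Hom kQ' (i, x) (i, y)"
    "sigma K (Qs j) Q' j ax ay m \<in> Hom kQ' (j, ax) (j, ay)"
    "arrow_mor K Q' (Cross a i x) \<in> Hom kQ' (i, x) (j, ax)"
    "kcat_comp kQ' (i, x) (i, y) (j, ay) (arrow_mor K Q' (Cross a i y))
       (arrow_mor K Q' (Inner i \<alpha>)) \<in> Hom kQ' (i, x) (j, ay)"
    "kcat_comp kQ' (i, x) (j, ax) (j, ay) (sigma K (Qs j) Q' j ax ay m)
       (arrow_mor K Q' (Cross a i x)) \<in> Hom kQ' (i, x) (j, ay)"
    "cross_relation a \<alpha> m \<in> Hom kQ' (i, x) (j, ay)"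
proof -
  interpret C: k_category K kQ' by (rule k_category_path_kcategory[OF K wf_gr_quiver])
  note s = arrow_setup[OF a \<alpha>, folded i_def j_def x_def y_def ax_def ay_def, folded x_def y_def, folded ax_def ay_def]
  show v: "(i, x) \<in> verts Q'" "(i, y) \<in> verts Q'" "(j, ax) \<in> verts Q'" "(j, ay) \<in> verts Q'"
    using s by (auto simp: gr_quiver_simps)
  have e: "Cross a i y \<in> arcs Q'" "Cross a i x \<in> arcs Q'" "Inner i \<alpha> \<in> arcs Q'"
    using a \<alpha> s by (auto simp: gr_quiver_simps i_def)
  show t1: "arrow_mor K Q' (Cross a i y) \<in> Hom kQ' (i, y) (j, ay)"
    using arrow_path_closed[OF K wf_gr_quiver e(1)] by (simp add: gr_quiver_simps i_def j_def ay_def)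
  show t2: "arrow_mor K Q' (Inner i \<alpha>) \<in> Hom kQ' (i, x) (i, y)"
    using arrow_path_closed[OF K wf_gr_quiver e(3)] by (simp add: gr_quiver_simps x_def y_def)
  show t3: "sigma K (Qs j) Q' j ax ay m \<in> Hom kQ' (j, ax) (j, ay)"
    using m s by (intro \<sigma>_closed) (auto simp: lifts_arrow_def Let_def i_def j_def x_def y_def ax_def ay_def)
  show t4: "arrow_mor K Q' (Cross a i x) \<in> Hom kQ' (i, x) (j, ax)"
    using arrow_path_closed[OF K wf_gr_quiver e(2)] by (simp add: gr_quiver_simps i_def j_def ax_def)
  note v' = v[folded path_kcategory_simps(1)[of K]]
  show t5: "kcat_comp kQ' (i, x) (i, y) (j, ay) (arrow_mor K Q' (Cross a i y))
       (arrow_mor K Q' (Inner i \<alpha>)) \<in> Hom kQ' (i, x) (j, ay)"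
    by (rule C.k_comp_closed[OF v'(1,2,4) t2 t1])
  show t6: "kcat_comp kQ' (i, x) (j, ax) (j, ay) (sigma K (Qs j) Q' j ax ay m)
       (arrow_mor K Q' (Cross a i x)) \<in> Hom kQ' (i, x) (j, ay)"
    by (rule C.k_comp_closed[OF v'(1,3,4) t4 t3])
  interpret M: Module.module K "kcat_hom kQ' (i, x) (j, ay)" by (rule C.hom_module[OF v'(1,4)])
  show "cross_relation a \<alpha> m \<in> Hom kQ' (i, x) (j, ay)"
    using M.minus_closed[OF t5 t6]
    unfolding cross_relation_def Let_def i_def j_def x_def y_def ax_def ay_def .
qed

lemma degree_arrow_comp_fibre:
  assumes p: "Q.awalk i p j" and xy: "x \<in> verts (Qs i)" "y \<in> verts (Qs i)" and F: "F \<in> carrier (fib_hom i x y)"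
  shows "kcat_comp Gr (i, x) (i, y) (j, push i j p y) (degree_arrow i j p y) (fun_mor (fibre_inclusion i) x y F) =
    single (gr_component X (i, x) (j, push i j p y)) (cls i j p) (push_mor i j (cls i j p) x y F)"
proof -
  have v: "i \<in> verts Q" "j \<in> verts Q" using p by auto
  have n: "Q.awalk i [] i" using v by (simp add: Q.awalk_Nil_iff)
  note py = push_closed[OF p xy(2)]
  note d = dia_id_closed[OF v(2) py]
  note aF = dia_mor_cls[OF p xy F]
  have c: "cat_comp I i i j (cls i j p) (cat_id I i) = cls i j p"
    using I_comp[OF n p] by (simp add: I_id)
  have ci: "cat_id I i \<in> cat_hom I i i" using cls_closed[OF n] by (simp add: I_id)
  have idx: "push_ob i i (cat_id I i) x = x" using v xy by (simp add: dia_id I_obj fib_ob_simps)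
  show ?thesis
    unfolding degree_arrow_def fibre_inclusion_simps
    by (subst gr_comp_single)
      (use v xy F py d aF cls_closed[OF p] c ci idx k_category.k_id_left[OF dia_cat[of j], of "push i j p x" "push i j p y"]
        push_closed[OF p xy(1)] in \<open>auto simp: I_obj fib_ob_simps push_def\<close>)
qed

text \<open>Both terms are sent to \<open>X(a)(\<Phi> \<alpha>)\<close> in degree \<open>a\<close>: one because composing with a morphism of
  degree \<open>a\<close> on the left applies \<open>X(a)\<close>, the other because \<open>m\<close> lifts this morphism.\<close>

lemma \<Psi>_cross_relation:
  assumes a: "a \<in> arcs Q" and \<alpha>: "\<alpha> \<in> arcs (Qs (tail Q a))" and m: "lifts_arrow a \<alpha> m"
  defines "i \<equiv> tail Q a" and "j \<equiv> head Q a"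
  defines "x \<equiv> tail (Qs i) \<alpha>" and "y \<equiv> head (Qs i) \<alpha>"
  defines "ay \<equiv> push i j [a] y"
  shows "fun_mor \<Psi> (i, x) (j, ay) (cross_relation a \<alpha> m) = \<zero>\<^bsub>kcat_hom Gr (i, x) (j, ay)\<^esub>"
proof -
  define ax where "ax = push i j [a] x"
  note t = cross_relation_terms_closed[OF a \<alpha> m, folded i_def j_def, folded x_def y_def, folded ax_def ay_def]
  note s = arrow_setup[OF a \<alpha>, folded i_def j_def, folded x_def y_def, folded ax_def ay_def]
  have aw: "Q.awalk i [a] j" using Q.arc_implies_awalk[OF a] by (simp add: i_def j_def)
  have \<alpha>': "\<alpha> \<in> arcs (Qs i)" using \<alpha> by (simp add: i_def)
  define F where "F = fun_mor (\<Phi> i) x y (arrow_mor K (Qs i) \<alpha>)"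
  have F: "F \<in> carrier (fib_hom i x y)" unfolding F_def x_def y_def using s(1) \<alpha>' by (rule \<Phi>_arrow_closed)
  have mc: "m \<in> Hom (kQs j) ax ay" and m\<Phi>: "fun_mor (\<Phi> j) ax ay m = push_mor i j (cls i j [a]) x y F"
    using m by (simp_all add: lifts_arrow_def Let_def i_def j_def x_def y_def ax_def ay_def F_def)
  note aF = dia_mor_cls[OF aw s(3,4) F, folded ax_def ay_def]
  let ?G = "single (gr_component X (i, x) (j, ay)) (cls i j [a]) (push_mor i j (cls i j [a]) x y F)"
  note o = t(1-4)[folded path_kcategory_simps(1)[of K]]
  have pa: "fun_mor \<Psi> (i, z) (j, push i j [a] z) (arrow_mor K Q' (Cross a i z)) = degree_arrow i j [a] z"
    if "z \<in> verts (Qs i)" for z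
    using \<Psi>_cross[OF aw that] cross_arrow[OF a, of z] that by (simp add: i_def)
  have inner: "fun_mor \<Psi> (i, x) (i, y) (arrow_mor K Q' (Inner i \<alpha>)) = fun_mor (fibre_inclusion i) x y F"
    using \<Psi>_arrow[of "Inner i \<alpha>"] s \<alpha>' by (simp add: gr_quiver_simps x_def y_def F_def arrow_value_def)
  have 1: "fun_mor \<Psi> (i, x) (j, ay) (kcat_comp kQ' (i, x) (i, y) (j, ay) (arrow_mor K Q' (Cross a i y))
       (arrow_mor K Q' (Inner i \<alpha>))) = ?G"
    using k_functor_comp[OF k_functor_\<Psi> o(1,2,4) t(6,5)] pa[OF s(4)] inner
      degree_arrow_comp_fibre[OF aw s(3,4) F] by (simp add: \<Psi>_obj ay_def)
  have n: "Q.awalk j [] j" using s by (simp add: Q.awalk_Nil_iff)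
  have 2: "fun_mor \<Psi> (i, x) (j, ay) (kcat_comp kQ' (i, x) (j, ax) (j, ay) (sigma K (Qs j) Q' j ax ay m)
       (arrow_mor K Q' (Cross a i x))) = ?G"
    using k_functor_comp[OF k_functor_\<Psi> o(1,3,4) t(8,7)] pa[OF s(3)] \<Psi>_\<sigma>[OF s(2,5,6) mc]
      single_comp_degree_arrow[OF aw s(3,6) n, folded ax_def, of "push_mor i j (cls i j [a]) x y F"] aF s
    by (simp add: \<Psi>_obj ax_def[symmetric] m\<Phi> fibre_inclusion_simps I_id push_Nil)
  have M: "Module.module K (kcat_hom kQ' (i, x) (j, ay))"
    using k_category.hom_module[OF k_category_path_kcategory[OF K wf_gr_quiver] o(1,4)] .
  have N: "Module.module K (kcat_hom Gr (i, x) (j, ay))"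
    using k_category.hom_module[OF k_category_grothendieck, of "(i, x)" "(j, ay)"] t(1,4) by (simp add: gr_obj)
  interpret N: Module.module K "kcat_hom Gr (i, x) (j, ay)" by (rule N)
  have G: "?G \<in> Hom Gr (i, x) (j, ay)"
    using 1 k_functor_mor[OF k_functor_\<Psi> o(1,4) t(9)] by (simp add: \<Psi>_obj)
  have "fun_mor \<Psi> (i, x) (j, ay) (cross_relation a \<alpha> m) = ?G \<ominus>\<^bsub>kcat_hom Gr (i, x) (j, ay)\<^esub> ?G"
    using linear_map_diff[OF M _ k_functor_linear[OF k_functor_\<Psi> o(1,4)] t(9,10)] N 1 2
    unfolding cross_relation_def Let_def i_def[symmetric] j_def[symmetric] x_def[symmetric] y_def[symmetric]
      ax_def[symmetric] ay_def[symmetric] by (simp add: \<Psi>_obj)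
  then show ?thesis using G N.r_neg by (simp add: a_minus_def)
qed

lemma relations_atE:
  assumes "(g, h) \<in> relations_at P R i j" "i \<in> verts Q" "j \<in> verts Q"
  obtains p q where "g = (i, p)" "h = (i, q)" "Q.awalk i p j" "Q.awalk i q j" "cls i j p = cls i j q"
proof -
  from assms(1) obtain p q where pq: "g = (i, p)" "h = (i, q)" "Q.awalk i p j" "Q.awalk i q j"
    by (auto simp: relations_at_def path_category_simps)
  have "((i, p), (i, q)) \<in> context_closure P R i j"
    unfolding context_closure_def
    by (intro CollectI exI[of _ i] exI[of _ j] exI[of _ "(i, p)"] exI[of _ "(i, q)"] exI[of _ "(i, [])"] exI[of _ "(j, [])"])
      (use assms pq in \<open>simp add: path_category_simps Q.awalk_Nil_iff\<close>)
  then have "cls i j p = cls i j q"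
    using cls_eq_iff[OF pq(3,4)] P.context_closure_generated by blast
  with pq show ?thesis by (rule that)
qed

lemma push_cls_cong: "cls i j p = cls i j q \<Longrightarrow> push i j p x = push i j q x"
  by (simp add: push_def)

end

locale chosen_lifts = presented_diagram K Q R X Qs Rs
  for K :: "'k ring" and Q :: "('q, 'a) pre_digraph" and R
    and X :: "('q, ('q, 'a) path set, 'v, (('v, 'e) path \<Rightarrow> 'k) set, 'k) diagram"
    and Qs and Rs :: "'q \<Rightarrow> (('v, 'e) path \<Rightarrow> 'k) set" +
  fixes lift :: "'a \<Rightarrow> 'e \<Rightarrow> ('v, 'e) path \<Rightarrow> 'k"
  assumes lift: "admissible_choice K Q R X Qs Rs lift"
begin

interpretation P: category P by (rule category_path_category[OF Q])

abbreviation "S \<equiv> gr_relations K Q R X Qs Rs lift"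
abbreviation "E \<equiv> quiver_quotient K Q' S"
abbreviation "\<pi> \<equiv> canonical_morphism K Q' S"

lemma lifts_arrow_lift: "a \<in> arcs Q \<Longrightarrow> \<alpha> \<in> arcs (Qs (tail Q a)) \<Longrightarrow> lifts_arrow a \<alpha> (lift a \<alpha>)"
  using lift by (simp add: admissible_choice_iff)

lemma relation_cases:
  assumes "f \<in> S"
  obtains (1) i x y \<mu> where "f = sigma K (Qs i) Q' i x y \<mu>" "i \<in> verts Q" "x \<in> verts (Qs i)" "y \<in> verts (Qs i)"
      "\<mu> \<in> Rs i" "\<mu> \<in> Hom (kQs i) x y"
  | (2) i j p q x where "f = path_morphism K ((i, x), cross_arrows i p x) \<ominus>\<^bsub>kcat_hom kQ' (i, x) (j, push i j p x)\<^esub>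
        path_morphism K ((i, x), cross_arrows i q x)"
      "Q.awalk i p j" "Q.awalk i q j" "x \<in> verts (Qs i)" "cls i j p = cls i j q"
  | (3) a \<alpha> where "f = cross_relation a \<alpha> (lift a \<alpha>)" "a \<in> arcs Q" "\<alpha> \<in> arcs (Qs (tail Q a))"
  using assms unfolding gr_relations_def
proof (elim UnE)
  assume "f \<in> gr_relations1 K Q R X Qs Rs"
  then show thesis using 1 unfolding gr_relations1_def by blast
next
  assume "f \<in> gr_relations2 K Q R X Qs"
  then obtain i j g h x where f: "f = path_morphism K (cross_path Q R X g x)
        \<ominus>\<^bsub>kcat_hom kQ' (i, x) (j, act Q R X i j g x)\<^esub> path_morphism K (cross_path Q R X h x)"
    and gh: "i \<in> verts Q" "j \<in> verts Q" "(g, h) \<in> relations_at P R i j" "x \<in> verts (Qs i)"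
    unfolding gr_relations2_def Let_def by blast
  from gh(3,1,2) show thesis
  proof (cases rule: relations_atE)
    case (1 p q)
    then show thesis using f gh(4) by (intro 2[of i x j p q]) (simp_all add: cross_path_eq)
  qed
next
  assume "f \<in> gr_relations3 K Q R X Qs lift"
  then show thesis using 3 unfolding gr_relations3_def gr_relation3_eq by blast
qed

text \<open>The relations of a fibre vanish in that fibre, two related paths have the same class and hence give
  the same degree, and the third kind is \<open>\<Psi>_cross_relation\<close>.\<close>

lemma relation_killed:
  assumes "f \<in> S"
  shows "\<exists>u\<in>verts Q'. \<exists>v\<in>verts Q'. f \<in> Hom kQ' u v \<and>
    fun_mor \<Psi> u v f = \<zero>\<^bsub>kcat_hom Gr (fun_obj \<Psi> u) (fun_obj \<Psi> v)\<^esub>"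
  using assms
proof (cases rule: relation_cases)
  case (1 i x y \<mu>)
  have "fun_mor (\<Phi> i) x y \<mu> = \<zero>\<^bsub>fib_hom i x y\<^esub>"
    using canonical_eq_zero_iff[OF K Qs[OF 1(2)] 1(3,4,6)]
      ideal_generated_superset[of x "kQs i" y \<mu> "Rs i" K] 1
    by (simp add: path_kcategory_simps(1) X_obj)
  then have "fun_mor \<Psi> (i, x) (i, y) f = \<zero>\<^bsub>kcat_hom Gr (i, x) (i, y)\<^esub>"
    using \<Psi>_\<sigma>[OF 1(2-4,6)] k_functor_zero[OF k_functor_fibre_inclusion[of i], of x y] 1
    by (simp add: I_obj fib_ob_simps fibre_inclusion_simps(1))
  then show ?thesis
    using 1 \<sigma>_closed[OF 1(2-4,6)]
    by (intro bexI[of _ "(i, x)"] bexI[of _ "(i, y)"]) (auto simp: gr_quiver_simps \<Psi>_obj)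
next
  case (2 i j p q x)
  let ?u = "(i, x)" and ?v = "(j, push i j p x)"
  have v: "?u \<in> verts Q'" "?v \<in> verts Q'"
    using 2 push_closed[OF 2(2,4)] Q.awalk_hd_in_verts[OF 2(2)] Q.awalk_last_in_verts[OF 2(2)]
    by (auto simp: gr_quiver_simps)
  note o = v[folded path_kcategory_simps(1)[of K]]
  interpret M: Module.module K "kcat_hom kQ' ?u ?v"
    using k_category.hom_module[OF k_category_path_kcategory[OF K wf_gr_quiver] o] .
  interpret N: Module.module K "kcat_hom Gr ?u ?v"
    using k_category.hom_module[OF k_category_grothendieck, of ?u ?v] v by (simp add: gr_obj)
  note eq = push_cls_cong[OF 2(5), of x]
  note t = cross_arrows_closed[OF 2(2,4)] cross_arrows_closed[OF 2(3,4), folded eq]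
  have d: "degree_arrow i j q x = degree_arrow i j p x" by (simp add: degree_arrow_def eq 2(5))
  have "fun_mor \<Psi> ?u ?v f = degree_arrow i j p x \<ominus>\<^bsub>kcat_hom Gr ?u ?v\<^esub> degree_arrow i j p x"
    using linear_map_diff[OF M.module_axioms _ k_functor_linear[OF k_functor_\<Psi> o] t] N.module_axioms
      \<Psi>_cross[OF 2(2,4)] \<Psi>_cross[OF 2(3,4), folded eq] by (simp add: \<Psi>_obj 2(1) d)
  also have "\<dots> = \<zero>\<^bsub>kcat_hom Gr ?u ?v\<^esub>"
    using degree_arrow_closed[OF 2(2,4)] N.r_neg by (simp add: a_minus_def)
  finally show ?thesis
    using v M.minus_closed[OF t] by (intro bexI[of _ ?u] bexI[of _ ?v]) (auto simp: \<Psi>_obj 2(1))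
next
  case (3 a \<alpha>)
  note l = lifts_arrow_lift[OF 3(2,3)]
  note t = cross_relation_terms_closed[OF 3(2,3) l]
  show ?thesis
    using \<Psi>_cross_relation[OF 3(2,3) l] t(11)
    by (intro bexI[OF _ t(1)] bexI[OF _ t(4)]) (simp add: \<Psi>_obj 3(1))
qed

lemma relations_subset: "S \<subseteq> kcat_morphisms kQ'"
  using relation_killed by (fastforce simp: kcat_morphisms_def path_kcategory_simps(1))

lemma k_functor_\<Psi>_lift: "k_functor K E Gr (quotient_lift \<Psi>)"
  by (rule k_functor_quiver_quotient_lift[OF K wf_gr_quiver k_functor_\<Psi> relation_killed])

lemma \<Psi>_lift_canonical:
  "u \<in> verts Q' \<Longrightarrow> v \<in> verts Q' \<Longrightarrow> f \<in> Hom kQ' u v \<Longrightarrow>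
    fun_mor (quotient_lift \<Psi>) u v (fun_mor \<pi> u v f) = fun_mor \<Psi> u v f"
  by (rule quiver_quotient_lift_canonical[OF K wf_gr_quiver k_functor_\<Psi> relation_killed])

section \<open>The cocone over the diagram\<close>

lemmas k_functor_\<pi> = k_functor_canonical[OF K wf_gr_quiver, of S]
lemmas \<pi>_obj = canonical_obj[OF K wf_gr_quiver, of S]
lemmas E_obj = quiver_quotient_obj[OF K wf_gr_quiver, of S]
lemmas E_cat = k_category_quiver_quotient[OF K wf_gr_quiver, of S]

interpretation E: k_category K E by (rule E_cat)
interpretation C: k_category K kQ' by (rule k_category_path_kcategory[OF K wf_gr_quiver])

lemma \<pi>_closed:
  "u \<in> verts Q' \<Longrightarrow> v \<in> verts Q' \<Longrightarrow> f \<in> Hom kQ' u v \<Longrightarrow>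
    fun_mor \<pi> u v f \<in> Hom E u v"
  using k_functor_mor[OF k_functor_\<pi>, of u v f] by (simp add: path_kcategory_simps(1) \<pi>_obj)

lemma \<pi>_comp:
  "u \<in> verts Q' \<Longrightarrow> v \<in> verts Q' \<Longrightarrow> w \<in> verts Q' \<Longrightarrow> f \<in> Hom kQ' u v \<Longrightarrow>
    g \<in> Hom kQ' v w \<Longrightarrow>
    fun_mor \<pi> u w (kcat_comp kQ' u v w g f) = kcat_comp E u v w (fun_mor \<pi> v w g) (fun_mor \<pi> u v f)"
  using k_functor_comp[OF k_functor_\<pi>, of u v w f g] by (simp add: path_kcategory_simps(1) \<pi>_obj)

lemma \<pi>_diff_zero_iff:
  assumes "u \<in> verts Q'" "v \<in> verts Q'" "f \<in> Hom kQ' u v" "g \<in> Hom kQ' u v"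
  shows "f \<ominus>\<^bsub>kcat_hom kQ' u v\<^esub> g \<in> ideal_generated K kQ' S u v \<longleftrightarrow> fun_mor \<pi> u v f = fun_mor \<pi> u v g"
proof -
  note o = assms(1,2)[folded path_kcategory_simps(1)[of K]]
  interpret M: Module.module K "kcat_hom kQ' u v" by (rule C.hom_module[OF o])
  interpret N: Module.module K "kcat_hom E u v" by (rule E.hom_module) (simp_all add: E_obj assms)
  have "fun_mor \<pi> u v (f \<ominus>\<^bsub>kcat_hom kQ' u v\<^esub> g) = fun_mor \<pi> u v f \<ominus>\<^bsub>kcat_hom E u v\<^esub> fun_mor \<pi> u v g"
    using linear_map_diff[OF M.module_axioms _ k_functor_linear[OF k_functor_\<pi> o] assms(3,4)] N.module_axioms
    by (simp add: \<pi>_obj)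
  then show ?thesis
    using canonical_eq_zero_iff[OF K wf_gr_quiver assms(1,2) M.minus_closed[OF assms(3,4)], of S]
      module.diff_eq_zero_iff[OF N.module_axioms] \<pi>_closed assms by simp
qed

lemma \<pi>_relation:
  assumes "u \<in> verts Q'" "v \<in> verts Q'" "f \<in> Hom kQ' u v" "g \<in> Hom kQ' u v"
    and "f \<ominus>\<^bsub>kcat_hom kQ' u v\<^esub> g \<in> S"
  shows "fun_mor \<pi> u v f = fun_mor \<pi> u v g"
proof -
  note o = assms(1,2)[folded path_kcategory_simps(1)[of K]]
  interpret M: Module.module K "kcat_hom kQ' u v" by (rule C.hom_module[OF o])
  show ?thesis
    using ideal_generated_superset[OF o assms(5) M.minus_closed[OF assms(3,4)]] \<pi>_diff_zero_iff assms by blast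
qed

text \<open>The functor on the fibre induced by the inclusion \<open>\<sigma> i\<close>; the relations of the first kind make it well
  defined.\<close>

definition \<sigma>E where "\<sigma>E i = quotient_lift (comp_functor \<pi> (\<sigma> i))"

lemma \<sigma>_killed:
  assumes i: "i \<in> verts Q" and \<mu>: "\<mu> \<in> Rs i"
  shows "\<exists>x\<in>verts (Qs i). \<exists>y\<in>verts (Qs i). \<mu> \<in> Hom (kQs i) x y \<and>
    fun_mor (comp_functor \<pi> (\<sigma> i)) x y \<mu> =
      \<zero>\<^bsub>kcat_hom E (fun_obj (comp_functor \<pi> (\<sigma> i)) x) (fun_obj (comp_functor \<pi> (\<sigma> i)) y)\<^esub>"
proof -
  obtain x y where xy: "x \<in> verts (Qs i)" "y \<in> verts (Qs i)" "\<mu> \<in> Hom (kQs i) x y"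
    using Rs[OF i] \<mu> by (auto simp: kcat_morphisms_def path_kcategory_simps(1))
  have "sigma K (Qs i) Q' i x y \<mu> \<in> S"
    unfolding gr_relations_def gr_relations1_def using i xy \<mu> by blast
  then have "fun_mor \<pi> (i, x) (i, y) (sigma K (Qs i) Q' i x y \<mu>) = \<zero>\<^bsub>kcat_hom E (i, x) (i, y)\<^esub>"
    using canonical_eq_zero_iff[OF K wf_gr_quiver _ _ \<sigma>_closed[OF i xy], of S]
      ideal_generated_superset[OF _ _ _ \<sigma>_closed[OF i xy], of S] i xy
    by (simp add: path_kcategory_simps(1) gr_quiver_simps)
  then show ?thesis using xy by (auto simp: \<sigma>_simps \<pi>_obj)
qed

lemma k_functor_\<sigma>E:
  assumes i: "i \<in> verts Q"
  shows "k_functor K (dia_obj X i) E (\<sigma>E i)"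
  unfolding \<sigma>E_def X_obj[OF i]
  by (rule k_functor_quiver_quotient_lift[OF K Qs[OF i] k_functor_comp_functor[OF k_functor_\<sigma>[OF i] k_functor_\<pi>] \<sigma>_killed[OF i]])

lemma \<sigma>E_obj: "fun_obj (\<sigma>E i) x = (i, x)"
  by (simp add: \<sigma>E_def quotient_lift_def \<sigma>_simps \<pi>_obj)

lemma \<sigma>E_\<Phi>:
  assumes i: "i \<in> verts Q" and xy: "x \<in> verts (Qs i)" "y \<in> verts (Qs i)" and f: "f \<in> Hom (kQs i) x y"
  shows "fun_mor (\<sigma>E i) x y (fun_mor (\<Phi> i) x y f) = fun_mor \<pi> (i, x) (i, y) (sigma K (Qs i) Q' i x y f)"
  using quiver_quotient_lift_canonical[OF K Qs[OF i] k_functor_comp_functor[OF k_functor_\<sigma>[OF i] k_functor_\<pi>] \<sigma>_killed[OF i] xy f]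
  by (simp add: \<sigma>E_def \<sigma>_simps)

text \<open>The class of the path \<open>\<pi>(p, x)\<close>.\<close>

definition crossing :: "'q \<Rightarrow> 'q \<Rightarrow> 'a list \<Rightarrow> 'v \<Rightarrow> (('q \<times> 'v, ('q, 'a, 'v, 'e) gr_arrow) path \<Rightarrow> 'k) set" where
  "crossing i j p x = fun_mor \<pi> (i, x) (j, push i j p x) (path_morphism K ((i, x), cross_arrows i p x))"

lemma cross_verts:
  "Q.awalk i p j \<Longrightarrow> x \<in> verts (Qs i) \<Longrightarrow> (i, x) \<in> verts Q' \<and> (j, push i j p x) \<in> verts Q'"
  using push_closed[of i p j x] Q.awalk_hd_in_verts[of i p j] Q.awalk_last_in_verts[of i p j]
  by (simp add: gr_quiver_simps)

lemma crossing_closed: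
  "Q.awalk i p j \<Longrightarrow> x \<in> verts (Qs i) \<Longrightarrow> crossing i j p x \<in> Hom E (i, x) (j, push i j p x)"
  unfolding crossing_def using cross_verts by (intro \<pi>_closed cross_arrows_closed) auto

lemma crossing_Nil: "i \<in> verts Q \<Longrightarrow> x \<in> verts (Qs i) \<Longrightarrow> crossing i i [] x = kcat_id E (i, x)"
  using k_functor_id[OF k_functor_\<pi>, of "(i, x)"]
  by (simp add: crossing_def cross_arrows_Nil push_Nil path_kcategory_simps(1,3) gr_quiver_simps \<pi>_obj)

lemma crossing_append:
  assumes p: "Q.awalk i p j" and q: "Q.awalk j q k" and x: "x \<in> verts (Qs i)"
  shows "crossing i k (p @ q) x = kcat_comp E (i, x) (j, push i j p x) (k, push j k q (push i j p x)) (crossing j k q (push i j p x)) (crossing i j p x)"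
proof -
  note px = push_closed[OF p x]
  have "path_morphism K ((i, x), cross_arrows i (p @ q) x) = kcat_comp kQ' (i, x) (j, push i j p x) (k, push j k q (push i j p x))
      (path_morphism K ((j, push i j p x), cross_arrows j q (push i j p x))) (path_morphism K ((i, x), cross_arrows i p x))"
    using path_morphism_comp[OF K wf_gr_quiver cross_arrows_awalk[OF p x] cross_arrows_awalk[OF q px]] by (simp add: cross_arrows_append[OF p q x])
  then show ?thesis
    using cross_verts[OF p x] cross_verts[OF q px] cross_arrows_closed[OF p x] cross_arrows_closed[OF q px]
    by (simp add: crossing_def push_append[OF p q x] \<pi>_comp)
qed

lemma crossing_relation:
  assumes r: "((i, p), (i, q)) \<in> relations_at P R i j" and ij: "i \<in> verts Q" "j \<in> verts Q" and x: "x \<in> verts (Qs i)"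
  shows "crossing i j p x = crossing i j q x"
  using r ij
proof (cases rule: relations_atE)
  case (1 p' q')
  then have pq: "Q.awalk i p j" "Q.awalk i q j" "cls i j p = cls i j q" by simp_all
  note eq = push_cls_cong[OF pq(3), of x]
  have "path_morphism K ((i, x), cross_arrows i p x) \<ominus>\<^bsub>kcat_hom kQ' (i, x) (j, push i j p x)\<^esub>
      path_morphism K ((i, x), cross_arrows i q x) \<in> gr_relations2 K Q R X Qs"
    unfolding gr_relations2_def Let_def using r ij x by (auto simp: cross_path_eq[symmetric] intro!: exI)
  then show ?thesis
    using \<pi>_relation[OF _ _ cross_arrows_closed[OF pq(1) x] cross_arrows_closed[OF pq(2) x, folded eq]] cross_verts[OF pq(1) x]
    unfolding crossing_def eq[symmetric] gr_relations_def by blast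
qed

text \<open>The pairs of paths with the same crossing form an equivalence relation.  It contains \<open>R\<^sup>c\<close>, because
  crossings are multiplicative and the relations of the second kind identify the crossings of related paths.\<close>

lemma crossing_cls:
  assumes p: "Q.awalk i p j" and q: "Q.awalk i q j" and pq: "cls i j p = cls i j q" and x: "x \<in> verts (Qs i)"
  shows "crossing i j p x = crossing i j q x"
proof -
  have ij: "i \<in> verts Q" "j \<in> verts Q" using p by auto
  (* snd drops the source of a path, which is i throughout. *)
  define H where "H = {(f, g) \<in> cat_hom P i j \<times> cat_hom P i j. crossing i j (snd f) x = crossing i j (snd g) x}"
  have "equiv (cat_hom P i j) H"
    by (intro equivI refl_onI symI transI) (auto simp: H_def)
  moreover have "context_closure P R i j \<subseteq> H"
  proof
    fix r assume r: "r \<in> context_closure P R i j"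
    then obtain k l a b c d where r': "r = (cat_comp P i l j d (cat_comp P i k l a c), cat_comp P i l j d (cat_comp P i k l b c))"
      and kl: "k \<in> verts Q" "l \<in> verts Q" "c \<in> cat_hom P i k" "d \<in> cat_hom P l j" "(a, b) \<in> relations_at P R k l"
      unfolding context_closure_def path_category_simps(1) by blast
    from kl(3,4) obtain c' d' where cd: "c = (i, c')" "Q.awalk i c' k" "d = (l, d')" "Q.awalk l d' j"
      by (auto simp: path_category_simps)
    from kl(5,1,2) show "r \<in> H"
    proof (cases rule: relations_atE)
      case (1 a' b')
      let ?cx = "push i k c' x"
      note cx = push_closed[OF cd(2) x]
      have eq: "push k l a' ?cx = push k l b' ?cx" using 1(5) by (rule push_cls_cong)
      have xab: "crossing k l a' ?cx = crossing k l b' ?cx" using kl(5) 1 kl(1,2) cx by (intro crossing_relation) simp_all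
      have "crossing i l (c' @ a') x = crossing i l (c' @ b') x" "push i l (c' @ a') x = push i l (c' @ b') x"
        using crossing_append[OF cd(2) 1(3) x] crossing_append[OF cd(2) 1(4) x] push_append[OF cd(2) 1(3) x] push_append[OF cd(2) 1(4) x]
          eq xab by simp_all
      then have "crossing i j ((c' @ a') @ d') x = crossing i j ((c' @ b') @ d') x"
        using crossing_append[OF Q.awalk_appendI[OF cd(2) 1(3)] cd(4) x] crossing_append[OF Q.awalk_appendI[OF cd(2) 1(4)] cd(4) x]
        by simp
      then show "r \<in> H"
        using r P.context_closure_subset[of i j R] ij cd 1 by (auto simp: r' H_def path_category_simps(1,4))
    qed
  qed
  ultimately show ?thesis
    using P.generated_equiv_least pq unfolding cls_eq_iff[OF p q] by (fastforce simp: H_def)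
qed

text \<open>A morphism of the index category is a class of paths; any representative may be used, by \<open>crossing_cls\<close>.\<close>

definition \<xi> where "\<xi> i j A x = crossing i j (SOME p. Q.awalk i p j \<and> A = cls i j p) x"

lemma \<xi>_cls:
  assumes "Q.awalk i p j" "x \<in> verts (Qs i)"
  shows "\<xi> i j (cls i j p) x = crossing i j p x"
proof -
  have "Q.awalk i (SOME q. Q.awalk i q j \<and> cls i j p = cls i j q) j \<and>
      cls i j p = cls i j (SOME q. Q.awalk i q j \<and> cls i j p = cls i j q)"
    by (rule someI[of _ p]) (simp add: assms)
  from crossing_cls[OF assms(1) conjunct1[OF this] conjunct2[OF this] assms(2)]
  show ?thesis by (simp add: \<xi>_def)
qed

text \<open>On the arrows of the fibre this is the third relation, since \<open>lift a \<alpha>\<close> represents the value of \<open>X(a)\<close> at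
  the class of \<open>\<alpha>\<close>.\<close>

lemma crossing_natural_arrow:
  assumes a: "a \<in> arcs Q" and xy: "x \<in> verts (Qs (tail Q a))" "y \<in> verts (Qs (tail Q a))"
    and F: "F \<in> carrier (fib_hom (tail Q a) x y)"
  defines "i \<equiv> tail Q a" and "j \<equiv> head Q a"
  shows "kcat_comp E (i, x) (i, y) (j, push i j [a] y) (crossing i j [a] y) (fun_mor (\<sigma>E i) x y F) =
    kcat_comp E (i, x) (j, push i j [a] x) (j, push i j [a] y)
      (fun_mor (\<sigma>E j) (push i j [a] x) (push i j [a] y) (push_mor i j (cls i j [a]) x y F)) (crossing i j [a] x)"
proof -
  have ij: "i \<in> verts Q" "j \<in> verts Q" using a by (simp_all add: i_def j_def)
  have aw: "Q.awalk i [a] j" using Q.arc_implies_awalk[OF a] by (simp add: i_def j_def)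
  have df: "k_functor K (dia_obj X i) (dia_obj X j) (dia_mor X i j (cls i j [a]))"
    using ij cls_closed[OF aw] by (intro dia_functor) (simp_all add: I_obj)
  let ?F = "comp_functor (\<sigma>E i) (\<Phi> i)" and ?G = "comp_functor (comp_functor (\<sigma>E j) (dia_mor X i j (cls i j [a]))) (\<Phi> i)"
  note kF = k_functor_comp_functor[OF k_functor_\<Phi>[OF ij(1)] k_functor_\<sigma>E[OF ij(1)]]
  note kG = k_functor_comp_functor[OF k_functor_\<Phi>[OF ij(1)] k_functor_comp_functor[OF df k_functor_\<sigma>E[OF ij(2)]]]
  obtain f where f: "f \<in> Hom (kQs i) x y" "F = fun_mor (\<Phi> i) x y f"
    using \<Phi>_surj[OF F[folded i_def] ij(1) xy[folded i_def]] by blast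
  note obs = \<sigma>E_obj \<Phi>_obj[OF ij(1)] push_def[symmetric]
  have "kcat_comp E (fun_obj ?F x) (fun_obj ?F y) (fun_obj ?G y) (crossing i j [a] y) (fun_mor ?F x y f) =
      kcat_comp E (fun_obj ?F x) (fun_obj ?G x) (fun_obj ?G y) (fun_mor ?G x y f) (crossing i j [a] x)"
  proof (rule naturality_from_arrows[OF K Qs[OF ij(1)] kF kG _ _ xy[folded i_def] f(1)])
    show "crossing i j [a] z \<in> Hom E (fun_obj ?F z) (fun_obj ?G z)" if "z \<in> verts (Qs i)" for z
      using crossing_closed[OF aw that] by (simp add: obs)
    fix \<alpha> assume \<alpha>: "\<alpha> \<in> arcs (Qs i)"
    define s t m where "s = tail (Qs i) \<alpha>" and "t = head (Qs i) \<alpha>" and "m = lift a \<alpha>"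
    let ?as = "push i j [a] s" and ?at = "push i j [a] t"
    have \<alpha>': "\<alpha> \<in> arcs (Qs (tail Q a))" using \<alpha> by (simp add: i_def)
    have l: "lifts_arrow a \<alpha> m" unfolding m_def using lifts_arrow_lift[OF a \<alpha>'] .
    note st = arrow_setup[OF a \<alpha>', folded i_def j_def, folded s_def t_def]
    note c = cross_relation_terms_closed[OF a \<alpha>' l, folded i_def j_def, folded s_def t_def]
    have m: "m \<in> Hom (kQs j) ?as ?at"
      "fun_mor (\<Phi> j) ?as ?at m = push_mor i j (cls i j [a]) s t (fun_mor (\<Phi> i) s t (arrow_mor K (Qs i) \<alpha>))"
      using l by (simp_all add: lifts_arrow_def Let_def i_def j_def s_def t_def)
    have crossing_arrow: "crossing i j [a] z = fun_mor \<pi> (i, z) (j, push i j [a] z) (arrow_mor K Q' (Cross a i z))"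
      if "z \<in> verts (Qs i)" for z
      using cross_arrow[OF a, of z] that by (simp add: crossing_def i_def)
    have inner: "fun_mor (\<sigma>E i) s t (fun_mor (\<Phi> i) s t (arrow_mor K (Qs i) \<alpha>)) =
        fun_mor \<pi> (i, s) (i, t) (arrow_mor K Q' (Inner i \<alpha>))"
      unfolding s_def t_def
      using \<sigma>E_\<Phi>[OF ij(1) st(3,4) arrow_path_closed[OF K Qs[OF ij(1)] \<alpha>, folded s_def t_def]] \<sigma>_arrow[OF ij(1) \<alpha>]
      by (simp add: s_def t_def)
    have outer: "fun_mor (\<sigma>E j) ?as ?at (push_mor i j (cls i j [a]) s t (fun_mor (\<Phi> i) s t (arrow_mor K (Qs i) \<alpha>))) =
        fun_mor \<pi> (j, ?as) (j, ?at) (sigma K (Qs j) Q' j ?as ?at m)"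
      using \<sigma>E_\<Phi>[OF ij(2) st(5,6) m(1)] by (simp add: m(2))
    have "cross_relation a \<alpha> m \<in> S"
      unfolding gr_relations_def gr_relations3_def gr_relation3_eq m_def using a \<alpha>' by blast
    then have "fun_mor \<pi> (i, s) (j, ?at) (kcat_comp kQ' (i, s) (i, t) (j, ?at) (arrow_mor K Q' (Cross a i t))
          (arrow_mor K Q' (Inner i \<alpha>))) =
        fun_mor \<pi> (i, s) (j, ?at) (kcat_comp kQ' (i, s) (j, ?as) (j, ?at) (sigma K (Qs j) Q' j ?as ?at m)
          (arrow_mor K Q' (Cross a i s)))"
      unfolding cross_relation_def Let_def i_def[symmetric] j_def[symmetric] s_def[symmetric] t_def[symmetric]
      by (rule \<pi>_relation[OF c(1,4,9,10)])
    then have "kcat_comp E (i, s) (i, t) (j, ?at) (crossing i j [a] t) (fun_mor \<pi> (i, s) (i, t) (arrow_mor K Q' (Inner i \<alpha>))) =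
        kcat_comp E (i, s) (j, ?as) (j, ?at) (fun_mor \<pi> (j, ?as) (j, ?at) (sigma K (Qs j) Q' j ?as ?at m)) (crossing i j [a] s)"
      using \<pi>_comp[OF c(1,2,4,6,5)] \<pi>_comp[OF c(1,3,4,8,7)] crossing_arrow st by simp
    then show "kcat_comp E (fun_obj ?F (tail (Qs i) \<alpha>)) (fun_obj ?F (head (Qs i) \<alpha>)) (fun_obj ?G (head (Qs i) \<alpha>))
        (crossing i j [a] (head (Qs i) \<alpha>))
        (fun_mor ?F (tail (Qs i) \<alpha>) (head (Qs i) \<alpha>) (arrow_mor K (Qs i) \<alpha>)) =
      kcat_comp E (fun_obj ?F (tail (Qs i) \<alpha>)) (fun_obj ?G (tail (Qs i) \<alpha>)) (fun_obj ?G (head (Qs i) \<alpha>))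
        (fun_mor ?G (tail (Qs i) \<alpha>) (head (Qs i) \<alpha>) (arrow_mor K (Qs i) \<alpha>))
        (crossing i j [a] (tail (Qs i) \<alpha>))"
      unfolding s_def[symmetric] t_def[symmetric] by (simp add: obs inner outer)
  qed
  then show ?thesis by (simp add: obs f(2))
qed

lemma crossing_natural:
  assumes "Q.awalk i p j" "x \<in> verts (Qs i)" "y \<in> verts (Qs i)" "F \<in> carrier (fib_hom i x y)"
  shows "kcat_comp E (i, x) (i, y) (j, push i j p y) (crossing i j p y) (fun_mor (\<sigma>E i) x y F) =
    kcat_comp E (i, x) (j, push i j p x) (j, push i j p y)
      (fun_mor (\<sigma>E j) (push i j p x) (push i j p y) (push_mor i j (cls i j p) x y F)) (crossing i j p x)"
  using assms
proof (induction p arbitrary: i x y F)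
  case Nil
  then have ij: "i = j" "i \<in> verts Q" by (auto simp: Q.awalk_Nil_iff)
  have "fun_mor (\<sigma>E i) x y F \<in> Hom E (i, x) (i, y)"
    using k_functor_mor[OF k_functor_\<sigma>E[OF ij(2)], of x y F] Nil ij by (simp add: fib_ob_simps \<sigma>E_obj)
  moreover have "push_mor i i (cls i i []) x y F = F"
    using dia_id(2)[of i x y F] Nil ij by (simp add: I_obj fib_ob_simps I_id)
  ultimately show ?case
    using Nil ij by (simp add: push_Nil crossing_Nil E.k_id_left E.k_id_right E_obj gr_quiver_simps)
next
  case (Cons a p)
  let ?h = "head Q a"
  let ?ax = "push i ?h [a] x" and ?ay = "push i ?h [a] y" and ?aF = "push_mor i ?h (cls i ?h [a]) x y F"
  have a: "a \<in> arcs Q" "i = tail Q a" "Q.awalk ?h p j" using Cons.prems by (auto simp: Q.awalk_Cons_iff)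
  have aw: "Q.awalk i [a] ?h" using Q.arc_implies_awalk[OF a(1)] a(2) by simp
  have v: "i \<in> verts Q" "?h \<in> verts Q" "j \<in> verts Q" using a aw by auto
  note ax = push_closed[OF aw Cons.prems(2)] and ay = push_closed[OF aw Cons.prems(3)]
  note pax = push_closed[OF a(3) ax] and pay = push_closed[OF a(3) ay]
  have aF: "?aF \<in> carrier (fib_hom ?h ?ax ?ay)" using aw Cons.prems(2-4) by (rule dia_mor_cls)
  have paF: "push_mor ?h j (cls ?h j p) ?ax ?ay ?aF \<in> carrier (fib_hom j (push ?h j p ?ax) (push ?h j p ?ay))"
    using a(3) ax ay aF by (rule dia_mor_cls)
  have am_append: "push_mor i j (cls i j (a # p)) x y F = push_mor ?h j (cls ?h j p) ?ax ?ay ?aF"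
    using dia_comp(2)[of i ?h j "cls i ?h [a]" "cls ?h j p" x y F] v Cons.prems I_comp[OF aw a(3)]
      cls_closed[OF aw] cls_closed[OF a(3)] by (simp add: I_obj fib_ob_simps push_def)
  have o: "(i, x) \<in> kcat_obj E" "(i, y) \<in> kcat_obj E" "(?h, ?ax) \<in> kcat_obj E" "(?h, ?ay) \<in> kcat_obj E"
    "(j, push ?h j p ?ax) \<in> kcat_obj E" "(j, push ?h j p ?ay) \<in> kcat_obj E"
    using v Cons.prems ax ay pax pay by (simp_all add: E_obj gr_quiver_simps)
  have sm: "fun_mor (\<sigma>E k) u w G \<in> Hom E (k, u) (k, w)"
    if "k \<in> verts Q" "u \<in> verts (Qs k)" "w \<in> verts (Qs k)" "G \<in> carrier (fib_hom k u w)" for k u w G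
    using k_functor_mor[OF k_functor_\<sigma>E[OF that(1)], of u w G] that by (simp add: fib_ob_simps \<sigma>E_obj)
  note sF = sm[OF v(1) Cons.prems(2-4)] and saF = sm[OF v(2) ax ay aF] and spaF = sm[OF v(3) pax pay paF]
  note xs = crossing_closed[OF aw Cons.prems(2)] crossing_closed[OF aw Cons.prems(3)] crossing_closed[OF a(3) ax] crossing_closed[OF a(3) ay]
  note nat = crossing_natural_arrow[OF a(1), folded a(2), OF Cons.prems(2-4)]
  have "kcat_comp E (i, x) (j, push ?h j p ?ax) (j, push ?h j p ?ay)
      (fun_mor (\<sigma>E j) (push ?h j p ?ax) (push ?h j p ?ay) (push_mor ?h j (cls ?h j p) ?ax ?ay ?aF))
      (kcat_comp E (i, x) (?h, ?ax) (j, push ?h j p ?ax) (crossing ?h j p ?ax) (crossing i ?h [a] x)) =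
    kcat_comp E (i, x) (i, y) (j, push ?h j p ?ay)
      (kcat_comp E (i, y) (?h, ?ay) (j, push ?h j p ?ay) (crossing ?h j p ?ay) (crossing i ?h [a] y)) (fun_mor (\<sigma>E i) x y F)"
    by (rule E.paste_squares[OF o(1,3,5,2,4,6) xs(1,3,2,4) sF saF spaF nat[symmetric] Cons.IH[OF a(3) ax ay aF, symmetric]])
  then show ?case
    using crossing_append[OF aw a(3) Cons.prems(2)] crossing_append[OF aw a(3) Cons.prems(3)]
      push_append[OF aw a(3) Cons.prems(2)] push_append[OF aw a(3) Cons.prems(3)] by (simp add: am_append)
qed

lemma cocone: "lax_cocone K I X E \<sigma>E \<xi>"
proof (intro lax_cocone.intro lax_cocone_axioms.intro linear_diagram_axioms E_cat, unfold I_obj \<sigma>E_obj)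
  show "k_functor K (dia_obj X i) E (\<sigma>E i)" if "i \<in> verts Q" for i using that by (rule k_functor_\<sigma>E)
  show "\<xi> i i (cat_id I i) x = kcat_id E (i, x)" if "i \<in> verts Q" "x \<in> fib_ob i" for i x
    using that \<xi>_cls[of i "[]" i x] crossing_Nil by (simp add: I_id fib_ob_simps Q.awalk_Nil_iff)
  fix i j A x assume ij: "i \<in> verts Q" "j \<in> verts Q" and "A \<in> cat_hom I i j" and "x \<in> fib_ob i"
  then obtain p where p: "Q.awalk i p j" "A = cls i j p" and x: "x \<in> verts (Qs i)"
    by (auto elim: I_homE simp: fib_ob_simps)
  show "\<xi> i j A x \<in> Hom E (i, x) (j, push_ob i j A x)"
    using crossing_closed[OF p(1) x] \<xi>_cls[OF p(1) x] by (simp add: p(2) push_def)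
  show "kcat_comp E (i, x) (i, y) (j, push_ob i j A y) (\<xi> i j A y) (fun_mor (\<sigma>E i) x y f) =
      kcat_comp E (i, x) (j, push_ob i j A x) (j, push_ob i j A y)
        (fun_mor (\<sigma>E j) (push_ob i j A x) (push_ob i j A y) (push_mor i j A x y f)) (\<xi> i j A x)"
    if "y \<in> fib_ob i" "f \<in> carrier (fib_hom i x y)" for y f
    using crossing_natural[OF p(1) x, of y f] \<xi>_cls[OF p(1)] x that ij by (simp add: p(2) push_def fib_ob_simps)
  fix k B assume k: "k \<in> verts Q" and "B \<in> cat_hom I j k"
  then obtain q where q: "Q.awalk j q k" "B = cls j k q" by (auto elim: I_homE)
  show "\<xi> i k (cat_comp I i j k B A) x =
      kcat_comp E (i, x) (j, push_ob i j A x) (k, push_ob j k B (push_ob i j A x)) (\<xi> j k B (push_ob i j A x)) (\<xi> i j A x)"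
    using crossing_append[OF p(1) q(1) x] \<xi>_cls[OF Q.awalk_appendI[OF p(1) q(1)] x] \<xi>_cls[OF p(1) x]
      \<xi>_cls[OF q(1) push_closed[OF p(1) x]] by (simp add: p(2) q(2) I_comp[OF p(1) q(1)] push_def)
qed

section \<open>The isomorphism\<close>

sublocale cocone: lax_cocone K I X E \<sigma>E \<xi>
  by (rule cocone)

abbreviation "\<Theta> \<equiv> gr_lift E \<sigma>E \<xi>"

lemma \<Theta>_obj: "fun_obj \<Theta> u = u"
  by (cases u) (simp add: cocone.gr_lift_obj \<sigma>E_obj)

lemma \<Theta>_single:
  assumes p: "Q.awalk i p j" and x: "x \<in> verts (Qs i)" and y: "y \<in> verts (Qs j)"
    and m: "m \<in> carrier (fib_hom j (push i j p x) y)"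
  shows "fun_mor \<Theta> (i, x) (j, y) (single (gr_component X (i, x) (j, y)) (cls i j p) m) =
    kcat_comp E (i, x) (j, push i j p x) (j, y) (fun_mor (\<sigma>E j) (push i j p x) y m) (crossing i j p x)"
proof -
  have "i \<in> verts Q" "j \<in> verts Q" using p by auto
  then show ?thesis
    using cocone.gr_lift_single[of i x j y "cls i j p" m] assms cls_closed[OF p] \<xi>_cls[OF p x]
    by (simp add: I_obj fib_ob_simps push_def \<sigma>E_obj)
qed

text \<open>For either kind of arrow one of the two factors in \<open>\<Theta>_single\<close> is an identity.\<close>

lemma \<Theta>_arrow_value:
  assumes "e \<in> arcs Q'"
  shows "fun_mor \<Theta> (tail Q' e) (head Q' e) (arrow_value e) =
    fun_mor \<pi> (tail Q' e) (head Q' e) (arrow_mor K Q' e)"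
  using assms
proof (cases rule: gr_arcE)
  case (1 i \<alpha>)
  let ?x = "tail (Qs i) \<alpha>" and ?y = "head (Qs i) \<alpha>"
  have xy: "?x \<in> verts (Qs i)" "?y \<in> verts (Qs i)"
    using 1 wf_digraph.tail_in_verts[OF Qs] wf_digraph.head_in_verts[OF Qs] by auto
  have n: "Q.awalk i [] i" using 1 by (simp add: Q.awalk_Nil_iff)
  note f = \<Phi>_arrow_closed[OF 1(2,3)]
  have b: "arrow_mor K Q' (Inner i \<alpha>) \<in> Hom kQ' (i, ?x) (i, ?y)"
    using arrow_path_closed[OF K wf_gr_quiver assms] by (simp add: 1(1) gr_quiver_simps)
  have "fun_mor (\<sigma>E i) ?x ?y (fun_mor (\<Phi> i) ?x ?y (arrow_mor K (Qs i) \<alpha>)) =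
      fun_mor \<pi> (i, ?x) (i, ?y) (arrow_mor K Q' (Inner i \<alpha>))"
    using \<sigma>E_\<Phi>[OF 1(2) xy arrow_path_closed[OF K Qs[OF 1(2)] 1(3)]] \<sigma>_arrow[OF 1(2,3)] by simp
  moreover have "fun_mor \<pi> (i, ?x) (i, ?y) (arrow_mor K Q' (Inner i \<alpha>)) \<in> Hom E (i, ?x) (i, ?y)"
    using xy 1 b by (intro \<pi>_closed) (simp_all add: gr_quiver_simps)
  ultimately show ?thesis
    using \<Theta>_single[OF n xy, of "fun_mor (\<Phi> i) ?x ?y (arrow_mor K (Qs i) \<alpha>)"] f 1 xy
    by (simp add: arrow_value_def fibre_inclusion_simps I_id push_Nil crossing_Nil E.k_id_right E_obj gr_quiver_simps)
next
  case (2 a x)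
  let ?i = "tail Q a" and ?j = "head Q a"
  note aw = Q.arc_implies_awalk[OF 2(2)]
  have v: "?i \<in> verts Q" "?j \<in> verts Q" using 2 by auto
  note ax = push_closed[OF aw 2(3)]
  have "fun_mor (\<sigma>E ?j) (push ?i ?j [a] x) (push ?i ?j [a] x) (kcat_id (dia_obj X ?j) (push ?i ?j [a] x)) = kcat_id E (?j, push ?i ?j [a] x)"
    using k_functor_id[OF k_functor_\<sigma>E[OF v(2)], of "push ?i ?j [a] x"] ax v by (simp add: fib_ob_simps \<sigma>E_obj)
  then show ?thesis
    using \<Theta>_single[OF aw 2(3) ax dia_id_closed[OF v(2) ax]] crossing_closed[OF aw 2(3)] v ax 2 cross_arrow[OF 2(2,3)]
    by (simp add: arrow_value_def gr_quiver_simps E.k_id_left E_obj) (simp add: crossing_def)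
qed

lemma \<Theta>_\<Psi>:
  assumes "u \<in> verts Q'" "v \<in> verts Q'" "f \<in> Hom kQ' u v"
  shows "fun_mor \<Theta> u v (fun_mor \<Psi> u v f) = fun_mor \<pi> u v f"
proof -
  have "fun_mor (comp_functor \<Theta> \<Psi>) u v f = fun_mor \<pi> u v f"
    by (rule path_functor_unique[OF K wf_gr_quiver
          k_functor_comp_functor[OF k_functor_\<Psi> cocone.k_functor_gr_lift] k_functor_\<pi> _ _ assms])
      (simp_all add: \<Theta>_obj \<Psi>_obj \<pi>_obj \<Psi>_arrow \<Theta>_arrow_value)
  then show ?thesis by (simp add: \<Psi>_obj)
qed

lemma \<Psi>_\<sigma>E:
  assumes i: "i \<in> verts Q" and xy: "x \<in> verts (Qs i)" "y \<in> verts (Qs i)" and F: "F \<in> carrier (fib_hom i x y)"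
  shows "fun_mor (quotient_lift \<Psi>) (i, x) (i, y) (fun_mor (\<sigma>E i) x y F) = fun_mor (fibre_inclusion i) x y F"
proof -
  obtain f where f: "f \<in> Hom (kQs i) x y" "F = fun_mor (\<Phi> i) x y f" using \<Phi>_surj[OF F i xy] .
  show ?thesis
    using i xy by (simp add: f(2) \<sigma>E_\<Phi>[OF i xy f(1)] \<Psi>_lift_canonical \<sigma>_closed[OF i xy f(1)] \<Psi>_\<sigma>[OF i xy f(1)] gr_quiver_simps)
qed

lemma \<Psi>_xi:
  "Q.awalk i p j \<Longrightarrow> x \<in> verts (Qs i) \<Longrightarrow>
    fun_mor (quotient_lift \<Psi>) (i, x) (j, push i j p x) (crossing i j p x) = degree_arrow i j p x"
  unfolding crossing_def using cross_verts by (simp add: \<Psi>_lift_canonical cross_arrows_closed \<Psi>_cross)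

lemma \<Psi>_lift_obj: "fun_obj (quotient_lift \<Psi>) u = u"
  by (simp add: quotient_lift_def \<Psi>_obj)

text \<open>A homogeneous morphism is one from a fibre after an identity placed in its degree; \<open>\<Theta>\<close>
  followed by \<open>\<Psi>\<close> fixes both factors.\<close>

lemma \<Psi>_\<Theta>:
  assumes "u \<in> verts Q'" "v \<in> verts Q'" "f \<in> Hom Gr u v"
  shows "fun_mor (quotient_lift \<Psi>) u v (fun_mor \<Theta> u v f) = f"
proof -
  obtain i x j y where uv: "u = (i, x)" "v = (j, y)" by (cases u, cases v)
  have v: "i \<in> verts Q" "x \<in> verts (Qs i)" "j \<in> verts Q" "y \<in> verts (Qs j)" using assms by (auto simp: uv gr_quiver_simps)
  have v': "i \<in> cat_obj I" "x \<in> fib_ob i" "j \<in> cat_obj I" "y \<in> fib_ob j" using v by (simp_all add: I_obj fib_ob_simps)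
  have lin: "linear_map K (kcat_hom Gr (i, x) (j, y)) (kcat_hom Gr (i, x) (j, y))
      (fun_mor (comp_functor (quotient_lift \<Psi>) \<Theta>) (i, x) (j, y))"
    using k_functor_linear[OF k_functor_comp_functor[OF cocone.k_functor_gr_lift k_functor_\<Psi>_lift], of "(i, x)" "(j, y)"] assms
    by (simp add: gr_obj uv \<Theta>_obj \<Psi>_lift_obj)
  have "fun_mor (comp_functor (quotient_lift \<Psi>) \<Theta>) (i, x) (j, y) f = f"
  proof (rule gr_hom_ext[OF v' module_gr_hom[OF v'] lin linear_map_ident _ assms(3)[unfolded uv]])
    fix A m assume A: "A \<in> cat_hom I i j" and m: "m \<in> carrier (fib_hom j (push_ob i j A x) y)"
    obtain p where p: "Q.awalk i p j" "A = cls i j p" using A by (rule I_homE)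
    have m': "m \<in> carrier (fib_hom j (push i j p x) y)" using m by (simp add: p(2) push_def)
    note px = push_closed[OF p(1) v(2)]
    have n: "Q.awalk j [] j" using v by (simp add: Q.awalk_Nil_iff)
    have sm: "fun_mor (\<sigma>E j) (push i j p x) y m \<in> Hom E (j, push i j p x) (j, y)"
      using k_functor_mor[OF k_functor_\<sigma>E[OF v(3)], of "push i j p x" y m] v px m' by (simp add: fib_ob_simps \<sigma>E_obj)
    have o: "(i, x) \<in> kcat_obj E" "(j, push i j p x) \<in> kcat_obj E" "(j, y) \<in> kcat_obj E"
      using v px by (simp_all add: E_obj gr_quiver_simps)
    have "fun_mor (quotient_lift \<Psi>) (i, x) (j, y) (fun_mor \<Theta> (i, x) (j, y) (single (gr_component X (i, x) (j, y)) A m)) =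
        kcat_comp Gr (i, x) (j, push i j p x) (j, y) (fun_mor (fibre_inclusion j) (push i j p x) y m) (degree_arrow i j p x)"
      using \<Theta>_single[OF p(1) v(2,4) m'] k_functor_comp[OF k_functor_\<Psi>_lift o crossing_closed[OF p(1) v(2)] sm]
        \<Psi>_\<sigma>E[OF v(3) px v(4) m'] \<Psi>_xi[OF p(1) v(2)] by (simp add: p(2) \<Psi>_lift_obj)
    also have "\<dots> = single (gr_component X (i, x) (j, y)) A m"
      using single_comp_degree_arrow[OF p(1) v(2,4) n, of m] m' px v
      by (simp add: fibre_inclusion_simps I_id push_Nil p(2))
    finally show "fun_mor (comp_functor (quotient_lift \<Psi>) \<Theta>) (i, x) (j, y) (single (gr_component X (i, x) (j, y)) A m) =
        single (gr_component X (i, x) (j, y)) A m"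
      by (simp add: \<Theta>_obj)
  qed
  then show ?thesis by (simp add: uv \<Theta>_obj)
qed

lemma presented: "presented_by_quiver K Gr Q' S"
  unfolding presented_by_quiver_def k_isomorphic_def
proof (intro conjI exI)
  show "wf_digraph Q'" by (rule wf_gr_quiver)
  show "S \<subseteq> kcat_morphisms kQ'" by (rule relations_subset)
  show "k_functor K Gr E \<Theta>" by (rule cocone.k_functor_gr_lift)
  show "k_functor K E Gr (quotient_lift \<Psi>)" by (rule k_functor_\<Psi>_lift)
  show "functor_eq Gr (comp_functor (quotient_lift \<Psi>) \<Theta>) id_functor"
    using \<Psi>_\<Theta> by (simp add: functor_eq_def gr_obj \<Theta>_obj \<Psi>_lift_obj)
  show "functor_eq E (comp_functor \<Theta> (quotient_lift \<Psi>)) id_functor"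
    using \<Theta>_\<Psi> by (auto simp: functor_eq_def E_obj \<Theta>_obj \<Psi>_lift_obj \<Psi>_lift_canonical elim!: quiver_quotient_homE[OF K wf_gr_quiver])
qed

text \<open>Here \<open>m\<close> is any lift.  The relation is killed by \<open>\<Psi>\<close>, hence by the canonical functor
  \<open>\<Theta> \<circ> \<Psi>\<close>, whose kernel is the ideal.\<close>

lemma cross_relation_in_ideal:
  assumes a: "a \<in> arcs Q" and \<alpha>: "\<alpha> \<in> arcs (Qs (tail Q a))" and m: "lifts_arrow a \<alpha> m"
  defines "i \<equiv> tail Q a" and "j \<equiv> head Q a"
  shows "cross_relation a \<alpha> m \<in> ideal_generated K kQ' S (i, tail (Qs i) \<alpha>) (j, push i j [a] (head (Qs i) \<alpha>))"
proof -
  define x y where "x = tail (Qs i) \<alpha>" and "y = head (Qs i) \<alpha>"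
  note t = cross_relation_terms_closed[OF a \<alpha> m, folded i_def j_def, folded x_def y_def]
  have "fun_mor \<Psi> (i, x) (j, push i j [a] y) (cross_relation a \<alpha> m) = \<zero>\<^bsub>kcat_hom Gr (i, x) (j, push i j [a] y)\<^esub>"
    using \<Psi>_cross_relation[OF a \<alpha> m] by (simp add: i_def j_def x_def y_def)
  then have "fun_mor \<pi> (i, x) (j, push i j [a] y) (cross_relation a \<alpha> m) = \<zero>\<^bsub>kcat_hom E (i, x) (j, push i j [a] y)\<^esub>"
    using \<Theta>_\<Psi>[OF t(1,4,11)] k_functor_zero[OF cocone.k_functor_gr_lift, of "(i, x)" "(j, push i j [a] y)"] t(1,4)
    by (simp add: gr_obj \<Theta>_obj)
  then show ?thesis
    using canonical_eq_zero_iff[OF K wf_gr_quiver t(1,4,11)] by (simp add: x_def y_def)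
qed

lemma ideal_contains_relations:
  assumes lift': "admissible_choice K Q R X Qs Rs lift'"
  shows "ideal_generated K kQ' (gr_relations K Q R X Qs Rs lift') u v \<subseteq> ideal_generated K kQ' S u v"
proof (rule ideal_generated_least)
  show id: "kcat_ideal K kQ' (ideal_generated K kQ' S)"
    by (rule kcat_ideal_ideal_generated[OF k_category_path_kcategory[OF K wf_gr_quiver]])
  fix u v assume uv: "u \<in> kcat_obj kQ'" "v \<in> kcat_obj kQ'"
  show "gr_relations K Q R X Qs Rs lift' \<inter> Hom kQ' u v \<subseteq> ideal_generated K kQ' S u v"
  proof
    fix f assume f: "f \<in> gr_relations K Q R X Qs Rs lift' \<inter> Hom kQ' u v"
    show "f \<in> ideal_generated K kQ' S u v"
    proof (cases "f \<in> S")
      case True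
      then show ?thesis using uv f by (intro ideal_generated_superset) auto
    next
      case False
      then obtain a \<alpha> where a\<alpha>: "f = cross_relation a \<alpha> (lift' a \<alpha>)" "a \<in> arcs Q" "\<alpha> \<in> arcs (Qs (tail Q a))"
        using f unfolding gr_relations_def gr_relations3_def gr_relation3_eq by blast
      have l: "lifts_arrow a \<alpha> (lift' a \<alpha>)" using lift' a\<alpha>(2,3) by (simp add: admissible_choice_iff)
      note m = cross_relation_in_ideal[OF a\<alpha>(2,3) l, folded a\<alpha>(1)]
      note c = cross_relation_terms_closed(11)[OF a\<alpha>(2,3) l, folded a\<alpha>(1)]
      (* The hom-set in which f was found need not be the one in which its membership in the ideal is known. *)
      from path_hom_unique[OF wf_gr_quiver _ c, of u v u v] f show ?thesis
        using m kcat_ideal_closed(2)[OF k_category_path_kcategory[OF K wf_gr_quiver] id uv] by auto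
    qed
  qed
qed

end

theorem theorem3p1:
  fixes K :: "'k ring"
    and Q :: "('q, 'a) pre_digraph"
    and R :: "(('q, 'a) path \<times> ('q, 'a) path) set"
    and X :: "('q, ('q, 'a) path set, 'v, (('v, 'e) path \<Rightarrow> 'k) set, 'k) diagram"
    and Qs :: "'q \<Rightarrow> ('v, 'e) pre_digraph"
    and Rs :: "'q \<Rightarrow> (('v, 'e) path \<Rightarrow> 'k) set"
  assumes "field K"
    and "wf_digraph Q"
    and "R \<subseteq> cat_relations (path_category Q)"
    and "functor_to_kCat K (presented_category Q R) X"
    and "\<And>i. i \<in> verts Q \<Longrightarrow> wf_digraph (Qs i)"
    and "\<And>i. i \<in> verts Q \<Longrightarrow> Rs i \<subseteq> kcat_morphisms (path_kcategory K (Qs i))"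
    and "\<And>i. i \<in> verts Q \<Longrightarrow> dia_obj X i = quiver_quotient K (Qs i) (Rs i)"
    and "\<And>i x. i \<in> verts Q \<Longrightarrow> x \<in> verts (Qs i) \<Longrightarrow>
      kcat_id (path_kcategory K (Qs i)) x \<notin> ideal_generated K (path_kcategory K (Qs i)) (Rs i) x x"
  shows "(\<exists>lift. admissible_choice K Q R X Qs Rs lift) \<and>
    (\<forall>lift lift'. admissible_choice K Q R X Qs Rs lift \<longrightarrow> admissible_choice K Q R X Qs Rs lift' \<longrightarrow>
      (\<forall>u\<in>verts (gr_quiver Q R X Qs). \<forall>v\<in>verts (gr_quiver Q R X Qs).
        ideal_generated K (path_kcategory K (gr_quiver Q R X Qs)) (gr_relations K Q R X Qs Rs lift) u v =
        ideal_generated K (path_kcategory K (gr_quiver Q R X Qs)) (gr_relations K Q R X Qs Rs lift') u v)) \<and>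
    (\<forall>lift. admissible_choice K Q R X Qs Rs lift \<longrightarrow>
      presented_by_quiver K (grothendieck (presented_category Q R) X)
        (gr_quiver Q R X Qs) (gr_relations K Q R X Qs Rs lift))"
proof -
  interpret K: field K by fact
  interpret presented_diagram K Q R X Qs Rs
    using assms K.is_cring by (intro presented_diagram.intro)
  have lifts: "chosen_lifts K Q R X Qs Rs lift" if "admissible_choice K Q R X Qs Rs lift" for lift
    by (intro chosen_lifts.intro chosen_lifts_axioms.intro presented_diagram_axioms that)
  have "\<exists>lift. \<forall>a \<alpha>. a \<in> arcs Q \<and> \<alpha> \<in> arcs (Qs (tail Q a)) \<longrightarrow> lifts_arrow a \<alpha> (lift a \<alpha>)"
    using ex_lifts_arrow by (subst choice_iff[symmetric])+ blast
  then have "\<exists>lift. admissible_choice K Q R X Qs Rs lift"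
    by (auto simp: admissible_choice_iff)
  then show ?thesis
    using chosen_lifts.presented[OF lifts] chosen_lifts.ideal_contains_relations[OF lifts]
    by (intro conjI allI impI ballI subset_antisym) auto
qed

end
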